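(* A polytope $P$ is totally splittable if and only if it has the same oriented matroid as a simplex, a (regular) crosspolytope, a polygon, a prism over a simplex, or a (possibly multiple) join of these polytopes.
   Context: Polytopes are convex hulls of finitely many points; a $d$-polytope is a polytope of dimension $d$, regarded as a full-dimensional polytope in $\mathbb{R}^d$. Subdivisions and triangulations: all polytopal subdivisions of a polytope $P$ are subdivisions without new vertices, i.e. every vertex of every cell is a vertex of $P$. A subdivision is regular if it is induced by a lifting function on the vertices of $P$ (projection of the lower hull of the lifted vertices). A triangulation is a subdivision all of whose cells are simplices. A split of $P$ is a subdivision of $P$ with exactly two maximal cells (splits are automatically regular). A split triangulation is a triangulation that is a common refinement of a set of splits (the set may be empty, in which case it is the trivial subdivision). $P$ is totally splittable if every regular triangulation of $P$ is a split triangulation. Oriented matroid: for a $d$-polytope $P\subset\mathbb{R}^d$ with vertices $p_1,\dots,p_n$, the covectors of $P$ are the sign vectors $(\operatorname{sign} a(1,p_i))_{i}$, where $a$ ranges over the linear forms on $\mathbb{R}^{d+1}$; the cocircuits are the nonzero covectors of inclusion-minimal support, and the oriented matroid of $P$ is its set of cocircuits. Two polytopes have the same oriented matroid if there is a bijection between their vertex sets carrying the cocircuits of one onto the cocircuits of the other. The regular crosspolytope of dimension $d$ is $\operatorname{conv}\{\pm e_i : i=1,\dots,d\}$. A prism over a simplex is the product of a simplex with a segment. The join $P*Q$ of a $d$-polytope $P$ and an $e$-polytope $Q$ is the convex hull of $P\cup Q$ when $P$ and $Q$ are placed in mutually skew affine subspaces of $\mathbb{R}^{d+e+1}$. *)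

theory Defs
  imports "HOL-Analysis.Analysis"
begin

(* All notions below are intrinsic to the affine hull of the polytope, so that a d-polytope may
   sit in any Euclidean space of dimension at least d. *)

definition vertices :: "'a::euclidean_space set \<Rightarrow> 'a set" where
  "vertices P = {v. v extreme_point_of P}"

section \<open>Subdivisions\<close>

(* A subdivision is the full complex of its cells: it is closed under taking faces, and so it
   contains the empty face. *)

definition subdivision :: "'a::euclidean_space set \<Rightarrow> 'a set set \<Rightarrow> bool" where
  "subdivision P S \<longleftrightarrow>
     finite S \<and> (\<forall>C\<in>S. polytope C) \<and> \<Union>S = P \<and>
     (\<forall>C\<in>S. \<forall>F. F face_of C \<longrightarrow> F \<in> S) \<and>
     (\<forall>C\<in>S. \<forall>D\<in>S. (C \<inter> D) face_of C \<and> (C \<inter> D) face_of D) \<and>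
     (\<forall>C\<in>S. vertices C \<subseteq> vertices P)"

definition maximal_cells :: "'a set set \<Rightarrow> 'a set set" where
  "maximal_cells S = {C \<in> S. \<forall>D\<in>S. C \<subseteq> D \<longrightarrow> D = C}"

definition lifted_hull :: "'a::euclidean_space set \<Rightarrow> ('a \<Rightarrow> real) \<Rightarrow> ('a \<times> real) set" where
  "lifted_hull P w = convex hull ((\<lambda>v. (v, w v)) ` vertices P)"

(* Lower faces are those cut out by a supporting halfspace whose inner normal has positive last
   coordinate (scaled to 1). The halfspace may miss the set, which yields the empty face. *)

definition lower_face_of :: "('a::euclidean_space \<times> real) set \<Rightarrow> ('a \<times> real) set \<Rightarrow> bool" where
  "lower_face_of F L \<longleftrightarrow>
     (\<exists>a b. (\<forall>(x, t)\<in>L. b \<le> a \<bullet> x + t) \<and> F = {(x, t). (x, t) \<in> L \<and> a \<bullet> x + t = b})"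

definition induced_subdivision :: "'a::euclidean_space set \<Rightarrow> ('a \<Rightarrow> real) \<Rightarrow> 'a set set" where
  "induced_subdivision P w = {fst ` F | F. lower_face_of F (lifted_hull P w)}"

definition regular_subdivision :: "'a::euclidean_space set \<Rightarrow> 'a set set \<Rightarrow> bool" where
  "regular_subdivision P S \<longleftrightarrow> subdivision P S \<and> (\<exists>w. S = induced_subdivision P w)"

definition triangulation_of :: "'a::euclidean_space set \<Rightarrow> 'a set set \<Rightarrow> bool" where
  "triangulation_of P T \<longleftrightarrow> subdivision P T \<and> (\<forall>C\<in>T. \<exists>n. n simplex C)"

definition split_of :: "'a::euclidean_space set \<Rightarrow> 'a set set \<Rightarrow> bool" where
  "split_of P S \<longleftrightarrow> subdivision P S \<and> card (maximal_cells S) = 2"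

(* The cells are all intersections with one cell from each member of the family. Intersecting in
   addition with the faces of P changes nothing for a nonempty family of subdivisions of P, and
   turns the empty family into the trivial subdivision. *)

definition common_refinement :: "'a::euclidean_space set \<Rightarrow> 'a set set set \<Rightarrow> 'a set set" where
  "common_refinement P \<S> = {F \<inter> (\<Inter>S\<in>\<S>. f S) | F f. F face_of P \<and> (\<forall>S\<in>\<S>. f S \<in> S)}"

definition split_triangulation :: "'a::euclidean_space set \<Rightarrow> 'a set set \<Rightarrow> bool" where
  "split_triangulation P T \<longleftrightarrow>
     triangulation_of P T \<and> (\<exists>\<S>. (\<forall>S\<in>\<S>. split_of P S) \<and> T = common_refinement P \<S>)"

definition totally_splittable :: "'a::euclidean_space set \<Rightarrow> bool" where
  "totally_splittable P \<longleftrightarrow>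
     (\<forall>T. regular_subdivision P T \<and> triangulation_of P T \<longrightarrow> split_triangulation P T)"

section \<open>Oriented matroids\<close>

(* Sign vectors indexed by the vertices of P are extended by 0 outside the vertex set. *)

definition covectors :: "'a::euclidean_space set \<Rightarrow> ('a \<Rightarrow> real) set" where
  "covectors P =
     {(\<lambda>v. if v \<in> vertices P then sgn (a (1, v)) else 0) | a :: real \<times> 'a \<Rightarrow> real. linear a}"

definition sign_support :: "('a \<Rightarrow> real) \<Rightarrow> 'a set" where
  "sign_support X = {v. X v \<noteq> 0}"

definition cocircuits :: "'a::euclidean_space set \<Rightarrow> ('a \<Rightarrow> real) set" where
  "cocircuits P =
     {X \<in> covectors P. sign_support X \<noteq> {} \<and>
        (\<forall>Y\<in>covectors P. sign_support Y \<noteq> {} \<and> sign_support Y \<subseteq> sign_support X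
            \<longrightarrow> sign_support Y = sign_support X)}"

definition same_oriented_matroid ::
    "'a::euclidean_space set \<Rightarrow> 'b::euclidean_space set \<Rightarrow> bool" where
  "same_oriented_matroid P Q \<longleftrightarrow>
     (\<exists>f. bij_betw f (vertices P) (vertices Q) \<and>
        cocircuits P = (\<lambda>Y v. if v \<in> vertices P then Y (f v) else 0) ` cocircuits Q)"

section \<open>The building blocks and their joins\<close>

definition affinely_isomorphic ::
    "'a::euclidean_space set \<Rightarrow> 'b::euclidean_space set \<Rightarrow> bool" where
  "affinely_isomorphic A B \<longleftrightarrow>
     (\<exists>h c. linear h \<and> inj_on (\<lambda>x. c + h x) (affine hull A) \<and> B = (\<lambda>x. c + h x) ` A)"

definition regular_crosspolytope :: "'a::euclidean_space set \<Rightarrow> 'a set" where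
  "regular_crosspolytope D = convex hull (D \<union> uminus ` D)"

(* A crosspolytope is an affine copy of the regular one of some dimension, not an arbitrary polytope
   with the same face lattice. *)

definition crosspolytope :: "'a::euclidean_space set \<Rightarrow> bool" where
  "crosspolytope Q \<longleftrightarrow>
     (\<exists>D::'a set. D \<subseteq> Basis \<and> D \<noteq> {} \<and> affinely_isomorphic (regular_crosspolytope D) Q)"

definition polygon :: "'a::euclidean_space set \<Rightarrow> bool" where
  "polygon Q \<longleftrightarrow> polytope Q \<and> aff_dim Q = 2"

definition prism_over_simplex :: "'a::euclidean_space set \<Rightarrow> bool" where
  "prism_over_simplex Q \<longleftrightarrow>
     (\<exists>n (\<Delta>::'a set). n \<ge> 0 \<and> n simplex \<Delta> \<and> affinely_isomorphic (\<Delta> \<times> {0..1::real}) Q)"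

definition skew :: "'a::euclidean_space set \<Rightarrow> 'a set \<Rightarrow> bool" where
  "skew A B \<longleftrightarrow>
     A \<inter> B = {} \<and> {x - y | x y. x \<in> A \<and> y \<in> A} \<inter> {x - y | x y. x \<in> B \<and> y \<in> B} = {0}"

(* The four basic classes are closed under injective affine maps, so every placement of the factors
   of a join in skew affine subspaces is covered. The factors of a join have smaller dimension than
   the join, so they fit into the same ambient space. *)

inductive join_of_basic :: "'a::euclidean_space set \<Rightarrow> bool" where
  simplex: "n \<ge> 0 \<Longrightarrow> n simplex Q \<Longrightarrow> join_of_basic Q"
| crosspolytope: "crosspolytope Q \<Longrightarrow> join_of_basic Q"
| polygon: "polygon Q \<Longrightarrow> join_of_basic Q"
| prism: "prism_over_simplex Q \<Longrightarrow> join_of_basic Q"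
| join: "join_of_basic Q1 \<Longrightarrow> join_of_basic Q2 \<Longrightarrow> skew (affine hull Q1) (affine hull Q2)
    \<Longrightarrow> join_of_basic (convex hull (Q1 \<union> Q2))"

end

theory Submission
  imports Defs
begin

text \<open>Both sides are equivalent to the condition that every circuit of the vertex set has at most four
  elements. Such a circuit is the crossing of the two diagonals of a quadrilateral.

  If some circuit \<open>C\<close> has three elements of the same sign, a generic lift that is lowest on \<open>C\<close> induces a
  regular triangulation in which three simplices \<open>C - {b}\<close> surround a common face, and no split can
  separate them. Conversely, if all circuits have four elements, a hyperplane spanned by a facet of a simplex
  of a triangulation cuts no edge of that triangulation, because it would have to cross an edge of
  the facet. So all these hyperplanes define splits, and together they cut out the triangulation.

  For the classification, the coordinate vectors of the other vertices with respect to a basis of vertices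
  have exactly three nonzero entries, and two of these supports meet in 0, 2 or 3 elements. Disjoint
  classes of supports yield a join. A class with a single support is a polygon. In any other class
  all supports share a pair \<open>a\<close>, \<open>b\<close>, the vertices come in pairs whose lines pass through a common
  point on the line \<open>ab\<close>, and rescaling the homogeneous coordinates by positive factors gives a
  crosspolytope or a prism with the same oriented matroid.\<close>

section \<open>Affine dependencies and point sets in convex position\<close>

text \<open>Four is the smallest size that a circuit can have here: in convex position a dependency
  has at least two positive and two negative coefficients. The bound therefore also fixes the sign
  pattern 2+2. This is why only affine dependence has to be carried through the cocircuits from a
  join back to \<open>P\<close>; the signs are recovered from convexity.

  A split triangulation must equal the common refinement as a complex, including all
  lower-dimensional cells and the empty face. Covering the maximal cells is not enough, and the
  comparison of cells goes through points in their relative interiors.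

  Multiplying a homogeneous point \<open>(1, v)\<close> by a positive number changes no sign of a
  linear form. The relations \<alpha> x + \<beta> y = p of the pairs can thus be normalised one by
  one: to reflections in a common point if \<alpha> and \<beta> are positive, to a common
  translation if their signs differ. The new points stay in the affine hull of the old ones, so that
  blocks normalised separately still span skew subspaces.\<close>

definition convex_position :: "'a::euclidean_space set \<Rightarrow> bool" where
  "convex_position V \<longleftrightarrow> finite V \<and> (\<forall>v\<in>V. v \<notin> convex hull (V - {v}))"

text \<open>Bounds the circuits without naming minimal sets: for finite \<open>V\<close>, a minimal
  \<open>D\<close> must equal the small \<open>E\<close> inside it. In this form the condition
  passes to subsets and applies to any dependent set at hand.\<close>

definition circuits_le_4 :: "'a::euclidean_space set \<Rightarrow> bool" where
  "circuits_le_4 V \<longleftrightarrow>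
     (\<forall>D\<subseteq>V. affine_dependent D \<longrightarrow> (\<exists>E\<subseteq>D. card E \<le> 4 \<and> affine_dependent E))"

lemma circuits_le_4D:
  assumes "circuits_le_4 V" "D \<subseteq> V" "affine_dependent D"
  obtains E where "E \<subseteq> D" "card E \<le> 4" "affine_dependent E"
  using assms by (auto simp: circuits_le_4_def)

lemma circuits_le_4_mono: "circuits_le_4 V \<Longrightarrow> W \<subseteq> V \<Longrightarrow> circuits_le_4 W"
  unfolding circuits_le_4_def by (meson subset_trans)

lemma convex_position_mono:
  assumes "convex_position V" "W \<subseteq> V"
  shows "convex_position W"
proof -
  have "convex hull (W - {v}) \<subseteq> convex hull (V - {v})" for v
    by (intro hull_mono) (use assms in auto)
  then show ?thesis
    using assms finite_subset unfolding convex_position_def by blast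
qed

lemma finite_vertices: "polytope P \<Longrightarrow> finite (vertices P)"
  unfolding vertices_def by (simp add: finite_polyhedron_extreme_points polytope_imp_polyhedron)

lemma convex_hull_vertices: "polytope P \<Longrightarrow> convex hull (vertices P) = P"
  unfolding vertices_def
  by (metis Krein_Milman_Minkowski polytope_imp_compact polytope_imp_convex)

lemma extreme_point_not_in_hull:
  assumes "v extreme_point_of S" "A \<subseteq> S" "v \<notin> A" "convex S"
  shows "v \<notin> convex hull A"
proof -
  have "convex (S - {v})"
    using assms by (simp add: extreme_point_of_stillconvex)
  then have "convex hull A \<subseteq> S - {v}"
    by (intro hull_minimal) (use assms in auto)
  then show ?thesis by auto
qed

lemma convex_position_vertices: "polytope P \<Longrightarrow> convex_position (vertices P)"
  unfolding convex_position_def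
proof (intro conjI ballI)
  assume P: "polytope P"
  show "finite (vertices P)" using P by (rule finite_vertices)
  fix v assume "v \<in> vertices P"
  then show "v \<notin> convex hull (vertices P - {v})"
    by (intro extreme_point_not_in_hull[of v P])
      (use P in \<open>auto simp: vertices_def extreme_point_of_def polytope_imp_convex\<close>)
qed

lemma vertices_convex_hull:
  assumes "convex_position V"
  shows "vertices (convex hull V) = V"
  using assms extreme_point_of_convex_hull_convex_independent[of V]
  unfolding convex_position_def vertices_def by (auto simp: finite_imp_compact)

lemma vertices_convex_hull_subset: "vertices (convex hull V) \<subseteq> V"
  unfolding vertices_def by (auto dest: extreme_point_of_convex_hull)

section \<open>Affine functionals and dependencies\<close>

lemma affine_interpolation:
  fixes S :: "'a::euclidean_space set"
  assumes "\<not> affine_dependent S"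
  obtains a c where "\<And>x. x \<in> S \<Longrightarrow> c + a \<bullet> x = (r x :: real)"
proof (cases "S = {}")
  case True
  then show ?thesis using that by blast
next
  case False
  then obtain s where s: "s \<in> S" by blast
  \<comment> \<open>Moving \<open>s\<close> to the origin turns affine into linear independence, so
    the prescribed differences \<open>r x - r s\<close> extend to a linear form.\<close>
  have ind: "independent ((\<lambda>x. - s + x) ` (S - {s}))"
    using assms affine_dependent_iff_dependent2[OF s] by simp
  obtain f :: "'a \<Rightarrow> real" where f: "linear f"
    and fx: "\<And>y. y \<in> (\<lambda>x. - s + x) ` (S - {s}) \<Longrightarrow> f y = r (s + y) - r s"
    using linear_independent_extend[OF ind, of "\<lambda>y. r (s + y) - r s"] by blast
  define a where "a = adjoint f 1"
  have fa: "f x = a \<bullet> x" for x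
    using adjoint_works[OF f, of x 1] by (simp add: a_def inner_commute)
  show ?thesis
  proof
    fix x assume "x \<in> S"
    show "(r s - a \<bullet> s) + a \<bullet> x = r x"
    proof (cases "x = s")
      case False
      then have "f (- s + x) = r x - r s"
        using fx[of "- s + x"] \<open>x \<in> S\<close> by auto
      then show ?thesis by (simp add: fa inner_simps)
    qed simp
  qed
qed

lemma affine_combination:
  fixes a :: "'a::euclidean_space" and l :: "'a \<Rightarrow> real"
  shows "(\<Sum>v\<in>S. l v * (c + a \<bullet> v)) = sum l S * c + a \<bullet> (\<Sum>v\<in>S. l v *\<^sub>R v)"
  by (simp add: inner_sum_right sum_distrib_right sum.distrib distrib_left)

text \<open>The device for reading off coefficients: a functional that vanishes at most points of
  \<open>S\<close> leaves an equation between the coefficients of the few others.\<close>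

lemma affine_dependency_eval:
  fixes a :: "'a::euclidean_space"
  assumes "sum l S = 0" "(\<Sum>v\<in>S. l v *\<^sub>R v) = 0"
  shows "(\<Sum>v\<in>S. l v * (c + a \<bullet> v)) = 0"
  using affine_combination[of l c a S] assms by simp

lemma affine_independentD:
  assumes "\<not> affine_dependent S" "finite S" "sum l S = 0" "(\<Sum>v\<in>S. l v *\<^sub>R v) = 0" "v \<in> S"
  shows "l v = 0"
  using assms unfolding affine_dependent_explicit_finite[OF assms(2)] by blast

text \<open>With a single negative coefficient at \<open>u\<close>, the point \<open>u\<close> would be a convex combination of
  the others.\<close>

lemma convex_position_two_negative:
  fixes V :: "'a::euclidean_space set"
  assumes V: "convex_position V" and l0: "sum l V = 0" and l1: "(\<Sum>v\<in>V. l v *\<^sub>R v) = 0"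
    and u: "u \<in> V" "l u < 0"
  shows "\<exists>u'\<in>V. u' \<noteq> u \<and> l u' < 0"
proof (rule ccontr)
  assume "\<not> ?thesis"
  then have pos: "l v \<ge> 0" if "v \<in> V - {u}" for v using that by force
  have fin: "finite V" using V by (simp add: convex_position_def)
  have s0: "sum l (V - {u}) = - l u"
    using l0 fin u by (simp add: sum_diff1)
  have s1: "(\<Sum>v\<in>V-{u}. l v *\<^sub>R v) = - l u *\<^sub>R u"
    using l1 fin u by (simp add: sum_diff1)
  have "(\<Sum>v\<in>V-{u}. (l v / - l u) *\<^sub>R v) = (1 / - l u) *\<^sub>R (\<Sum>v\<in>V-{u}. l v *\<^sub>R v)"
    by (simp add: scaleR_sum_right)
  also have "\<dots> = u" using s1 u by simp
  finally have "(\<Sum>v\<in>V-{u}. (l v / - l u) *\<^sub>R v) = u" .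
  moreover have "(\<Sum>v\<in>V-{u}. l v / - l u) = 1"
    using s0 u by (simp add: sum_divide_distrib[symmetric] del: divide_minus_right)
  moreover have "\<forall>v\<in>V-{u}. 0 \<le> l v / - l u" using pos u by (simp add: divide_nonneg_pos del: divide_minus_right)
  ultimately have "u \<in> convex hull (V - {u})"
    using fin by (auto simp: convex_hull_finite simp del: divide_minus_right intro!: exI[of _ "\<lambda>v. l v / - l u"])
  then show False using V u by (simp add: convex_position_def)
qed

lemma convex_position_two_positive:
  assumes V: "convex_position V" and l0: "sum l V = 0" and l1: "(\<Sum>v\<in>V. l v *\<^sub>R v) = 0"
    and u: "u \<in> V" "l u > 0"
  shows "\<exists>u'\<in>V. u' \<noteq> u \<and> l u' > 0"
proof -
  have "(\<Sum>v\<in>V. - l v *\<^sub>R v) = 0" "(\<Sum>v\<in>V. - l v) = 0"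
    using l0 l1 by (simp_all add: sum_negf)
  then show ?thesis
    using convex_position_two_negative[OF V, of "\<lambda>v. - l v" u] u by auto
qed

text \<open>A point with coefficient 0 could be dropped, leaving a smaller dependent set; so
  minimality forces every coefficient to be nonzero.\<close>

lemma minimal_dependent_subset:
  assumes "finite D" "affine_dependent D"
  obtains C l where "C \<subseteq> D" "affine_dependent C" "\<forall>E. E \<subset> C \<longrightarrow> \<not> affine_dependent E"
    "sum l C = 0" "(\<Sum>v\<in>C. l v *\<^sub>R v) = 0" "\<forall>v\<in>C. l v \<noteq> 0"
proof -
  have "\<exists>C. C \<subseteq> D \<and> affine_dependent C \<and> (\<forall>E. E \<subset> C \<longrightarrow> \<not> affine_dependent E)"
    using assms
  proof (induction D rule: finite_psubset_induct)
    case (psubset D)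
    show ?case
    proof (cases "\<exists>E. E \<subset> D \<and> affine_dependent E")
      case True
      then obtain E where E: "E \<subset> D" "affine_dependent E" by blast
      then show ?thesis by (meson psubset.IH dual_order.strict_implies_order subset_trans)
    next
      case False
      then show ?thesis using psubset.prems by blast
    qed
  qed
  then obtain C where C: "C \<subseteq> D" "affine_dependent C" "\<And>E. E \<subset> C \<Longrightarrow> \<not> affine_dependent E"
    by blast
  have fin: "finite C" using C assms finite_subset by blast
  obtain l where l: "sum l C = 0" "(\<Sum>v\<in>C. l v *\<^sub>R v) = 0" "\<exists>v\<in>C. l v \<noteq> 0"
    using C(2) unfolding affine_dependent_explicit_finite[OF fin] by blast
  have "l v \<noteq> 0" if v: "v \<in> C" for v
  proof
    assume "l v = 0"
    then have "sum l (C - {v}) = 0" "(\<Sum>v\<in>C-{v}. l v *\<^sub>R v) = 0" "\<exists>w\<in>C-{v}. l w \<noteq> 0"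
      using l fin v by (auto simp: sum_diff1)
    then have "affine_dependent (C - {v})"
      unfolding affine_dependent_explicit_finite[OF finite_Diff[OF fin]] by blast
    then show False using C(3)[of "C - {v}"] v by blast
  qed
  then show ?thesis using that C l by blast
qed

section \<open>Regular subdivisions\<close>

lemma convex_hull_Int_supporting_hyperplane:
  fixes S :: "'a::euclidean_space set"
  assumes "finite S" "\<And>z. z \<in> S \<Longrightarrow> b \<le> a \<bullet> z"
  shows "convex hull S \<inter> {z. a \<bullet> z = b} = convex hull {z \<in> S. a \<bullet> z = b}"
    and "convex hull {z \<in> S. a \<bullet> z = b} face_of convex hull S"
proof -
  have ge: "convex hull S \<subseteq> {z. a \<bullet> z \<ge> b}"
    by (intro hull_minimal) (use assms in \<open>auto simp: convex_halfspace_ge\<close>)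
  then have face: "convex hull S \<inter> {z. a \<bullet> z = b} face_of convex hull S"
    by (intro face_of_Int_supporting_hyperplane_ge) auto
  then obtain S' where S': "S' \<subseteq> S" "convex hull S \<inter> {z. a \<bullet> z = b} = convex hull S'"
    using face_of_convex_hull_subset finite_imp_compact assms(1) by metis
  then have "S' \<subseteq> {z \<in> S. a \<bullet> z = b}"
    using hull_subset[of S' convex] by blast
  then have "convex hull S' \<subseteq> convex hull {z \<in> S. a \<bullet> z = b}"
    by (rule hull_mono)
  moreover have "convex hull {z \<in> S. a \<bullet> z = b} \<subseteq> convex hull S"
    by (rule hull_mono) auto
  moreover have "convex hull {z \<in> S. a \<bullet> z = b} \<subseteq> {z. a \<bullet> z = b}"
    by (intro hull_minimal) (auto simp: convex_hyperplane)
  ultimately show eq: "convex hull S \<inter> {z. a \<bullet> z = b} = convex hull {z \<in> S. a \<bullet> z = b}"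
    using S'(2) by blast
  show "convex hull {z \<in> S. a \<bullet> z = b} face_of convex hull S"
    using face eq by simp
qed

section \<open>Lower cells of a lifted point set\<close>

definition lower_cell :: "'a::euclidean_space set \<Rightarrow> ('a \<Rightarrow> real) \<Rightarrow> 'a \<Rightarrow> real \<Rightarrow> 'a set" where
  "lower_cell V w a b = convex hull {v \<in> V. a \<bullet> v + w v = b}"

text \<open>Since \<open>fst\<close> commutes with convex hulls, the projection of a lower face is
  spanned by the vertices at which its inequality is tight. The lifted polytope is thereby replaced
  by finitely many inequalities on the vertices.\<close>

lemma induced_subdivision_eq:
  assumes P: "polytope P"
  shows "induced_subdivision P w =
    {lower_cell (vertices P) w a b | a b. \<forall>v\<in>vertices P. b \<le> a \<bullet> v + w v}"
proof -
  define V where "V = vertices P"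
  define g where "g = (\<lambda>v. (v, w v))"
  have fin: "finite V" using finite_vertices[OF P] by (simp add: V_def)
  have L: "lifted_hull P w = convex hull (g ` V)" by (simp add: lifted_hull_def V_def g_def)
  have valid: "(\<forall>(x, t)\<in>convex hull (g ` V). b \<le> a \<bullet> x + t) \<longleftrightarrow> (\<forall>v\<in>V. b \<le> a \<bullet> v + w v)" for a b
  proof
    assume "\<forall>(x, t)\<in>convex hull (g ` V). b \<le> a \<bullet> x + t"
    then show "\<forall>v\<in>V. b \<le> a \<bullet> v + w v"
      using hull_subset[of "g ` V" convex] by (fastforce simp: g_def)
  next
    assume "\<forall>v\<in>V. b \<le> a \<bullet> v + w v"
    then have "convex hull (g ` V) \<subseteq> {z. (a, 1) \<bullet> z \<ge> b}"
      by (intro hull_minimal) (auto simp: convex_halfspace_ge g_def)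
    then show "\<forall>(x, t)\<in>convex hull (g ` V). b \<le> a \<bullet> x + t" by auto
  qed
  have cell: "fst ` {(x, t). (x, t) \<in> convex hull (g ` V) \<and> a \<bullet> x + t = b} = lower_cell V w a b"
    if "\<forall>v\<in>V. b \<le> a \<bullet> v + w v" for a b
  proof -
    have "{(x, t). (x, t) \<in> convex hull (g ` V) \<and> a \<bullet> x + t = b}
        = convex hull (g ` V) \<inter> {z. (a, 1) \<bullet> z = b}" by auto
    also have "\<dots> = convex hull {z \<in> g ` V. (a, 1) \<bullet> z = b}"
      by (rule convex_hull_Int_supporting_hyperplane) (use that fin in \<open>auto simp: g_def\<close>)
    also have "fst ` \<dots> = convex hull (fst ` {z \<in> g ` V. (a, 1) \<bullet> z = b})"
      by (simp add: convex_hull_linear_image linear_fst)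
    also have "fst ` {z \<in> g ` V. (a, 1) \<bullet> z = b} = {v \<in> V. a \<bullet> v + w v = b}"
      by (force simp: g_def)
    finally show ?thesis by (simp add: lower_cell_def)
  qed
  show ?thesis
    unfolding induced_subdivision_def lower_face_of_def L V_def[symmetric] valid
    using cell by blast
qed

text \<open>Lets a supporting hyperplane be tilted slightly without losing finitely many strict
  inequalities.\<close>

lemma small_multiple_below:
  fixes f g :: "'b \<Rightarrow> real"
  assumes "finite A" "\<And>v. v \<in> A \<Longrightarrow> f v > 0"
  obtains e where "e > 0" "\<And>v. v \<in> A \<Longrightarrow> e * g v < f v"
proof -
  have "\<exists>e>0. \<forall>v\<in>A. e * g v < f v"
    using assms
  proof (induction A rule: finite_induct)
    case empty
    then show ?case by (auto intro: exI[of _ 1])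
  next
    case (insert x A)
    then obtain e where e: "e > 0" "\<forall>v\<in>A. e * g v < f v" by blast
    \<comment> \<open>The summand 1 avoids a division by zero and the factor 2 leaves room for
      strictness; the minimum with \<open>e\<close> keeps the bounds already obtained.\<close>
    define d where "d = min e (f x / (2 * (\<bar>g x\<bar> + 1)))"
    have fx: "f x > 0" using insert by blast
    then have d: "d > 0" "d \<le> e" using e by (auto simp: d_def)
    have "d * g x < f x"
    proof -
      have "d * g x \<le> d * (\<bar>g x\<bar> + 1)" using d by (intro mult_left_mono) auto
      also have "\<dots> \<le> f x / (2 * (\<bar>g x\<bar> + 1)) * (\<bar>g x\<bar> + 1)"
        by (intro mult_right_mono) (auto simp: d_def)
      also have "\<dots> = f x / 2" by (simp add: field_simps)
      finally show ?thesis using fx by linarith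
    qed
    moreover have "d * g v < f v" if "v \<in> A" for v
    proof (cases "g v \<ge> 0")
      case True
      then have "d * g v \<le> e * g v" using d by (intro mult_right_mono) auto
      then show ?thesis using e that by fastforce
    next
      case False
      then have "d * g v < 0" using d by (simp add: mult_pos_neg)
      then show ?thesis using insert.prems[of v] that by auto
    qed
    ultimately show ?case using d by blast
  qed
  then show ?thesis using that by blast
qed

text \<open>A minimal lift of a relative interior point lies on the relative boundary of the lifted
  polytope thickened upwards. A supporting hyperplane there cannot be vertical.\<close>

lemma lower_cells_cover_rel_interior:
  assumes fin: "finite V" and x: "x \<in> rel_interior (convex hull V)"
  obtains a b where "\<And>v. v \<in> V \<Longrightarrow> b \<le> a \<bullet> v + w v" "x \<in> lower_cell V w a b"
proof -
  define g where "g = (\<lambda>v. (v, w v))"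
  define L where "L = convex hull (g ` V)"
  define K where "K = {z. \<exists>s\<le>snd z. (fst z, s) \<in> L}"
  have cL: "convex L" "compact L"
    by (auto simp: L_def fin finite_imp_compact_convex_hull)
  have "fst ` g ` V = V" by (force simp: g_def)
  then have fstL: "fst ` L = convex hull V"
    unfolding L_def by (simp add: convex_hull_linear_image linear_fst)
  have lift: "\<exists>t. (y, t) \<in> L" if "y \<in> convex hull V" for y
  proof -
    have "y \<in> fst ` L" using that fstL by simp
    then show ?thesis by force
  qed
  have cK: "convex K"
  proof (rule convexI)
    fix y z :: "'a \<times> real" and u v :: real
    assume "y \<in> K" "z \<in> K" and uv: "0 \<le> u" "0 \<le> v" "u + v = 1"
    then obtain s t where s: "s \<le> snd y" "(fst y, s) \<in> L" and t: "t \<le> snd z" "(fst z, t) \<in> L"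
      unfolding K_def by blast
    have "u *\<^sub>R (fst y, s) + v *\<^sub>R (fst z, t) \<in> L"
      using cL(1) s t uv by (intro convexD) auto
    moreover have "u * s + v * t \<le> u * snd y + v * snd z"
      using s t uv by (intro add_mono mult_left_mono) auto
    ultimately show "u *\<^sub>R y + v *\<^sub>R z \<in> K"
      unfolding K_def by auto
  qed
  have xV: "x \<in> convex hull V" using x rel_interior_subset by blast
  have "compact (L \<inter> {z. fst z = x})"
    by (intro compact_Int_closed cL closed_Collect_eq continuous_intros)
  moreover have "L \<inter> {z. fst z = x} \<noteq> {}" using lift[OF xV] by force
  moreover have "continuous_on (L \<inter> {z. fst z = x}) snd" by (intro continuous_intros)
  ultimately obtain z0 where z0: "z0 \<in> L \<inter> {z. fst z = x}"
      "\<forall>z\<in>L \<inter> {z. fst z = x}. snd z0 \<le> snd z"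
    using continuous_attains_inf by blast
  define t0 where "t0 = snd z0"
  have z0_eq: "z0 = (x, t0)" using z0(1) by (auto simp: t0_def)
  have xt: "(x, t0) \<in> L" and min: "\<And>t. (x, t) \<in> L \<Longrightarrow> t0 \<le> t"
    using z0 unfolding z0_eq by (simp, force)
  have LK: "L \<subseteq> K" unfolding K_def by auto
  have up: "(x, t0 + 1) \<in> K" using xt unfolding K_def by (auto intro!: exI[of _ t0])
  \<comment> \<open>Otherwise the segment from \<open>(x, t0 + 1)\<close> to \<open>(x, t0)\<close>
    could be prolonged inside \<open>K\<close>, below the lowest lift of \<open>x\<close>.\<close>
  have notint: "(x, t0) \<notin> rel_interior K"
  proof
    assume "(x, t0) \<in> rel_interior K"
    then obtain e where e: "e > 1" "(1 - e) *\<^sub>R (x, t0 + 1) + e *\<^sub>R (x, t0) \<in> K"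
      using convex_rel_interior_iff[OF cK] up by blast
    have "(1 - e) *\<^sub>R (x, t0 + 1) + e *\<^sub>R (x, t0) = (x, t0 + (1 - e))"
      by (simp add: algebra_simps flip: scaleR_add_left)
    then obtain s where "s \<le> t0 + (1 - e)" "(x, s) \<in> L" using e unfolding K_def by auto
    then show False using min e by fastforce
  qed
  obtain hc where hc: "hc \<noteq> 0" "\<And>y. y \<in> K \<Longrightarrow> hc \<bullet> (x, t0) \<le> hc \<bullet> y"
      "\<And>y. y \<in> rel_interior K \<Longrightarrow> hc \<bullet> (x, t0) < hc \<bullet> y"
    using supporting_hyperplane_rel_boundary[OF cK _ notint] xt LK by blast
  obtain h c where hceq: "hc = (h, c)" by fastforce
  have sup: "h \<bullet> x + c * t0 \<le> h \<bullet> y + c * t" if "(y, t) \<in> K" for y t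
    using hc(2)[OF that] by (simp add: hceq)
  have c0: "c \<ge> 0" using sup[OF up] by (simp add: algebra_simps)
  \<comment> \<open>A vertical hyperplane would give a functional on \<open>convex hull V\<close>
    that is minimal at the relative interior point \<open>x\<close>. It would be constant, against
    the strict inequality on the relative interior of \<open>K\<close>.\<close>
  have "c \<noteq> 0"
  proof
    assume c: "c = 0"
    have const: "h \<bullet> y = h \<bullet> x" if y: "y \<in> convex hull V" for y
    proof -
      have le: "h \<bullet> x \<le> h \<bullet> y" if "y \<in> convex hull V" for y
      proof -
        from that obtain t where "(y, t) \<in> L" using lift by blast
        then show ?thesis using sup[of y t] LK c by auto
      qed
      obtain e where e: "e > 1" "(1 - e) *\<^sub>R y + e *\<^sub>R x \<in> convex hull V"
        using x y convex_rel_interior_iff[OF convex_convex_hull, of V x] by blast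
      have "h \<bullet> x \<le> (1 - e) * (h \<bullet> y) + e * (h \<bullet> x)"
        using le[OF e(2)] by (simp add: inner_simps)
      then have "(e - 1) * (h \<bullet> y) \<le> (e - 1) * (h \<bullet> x)" by (simp add: algebra_simps)
      then have "h \<bullet> y \<le> h \<bullet> x" using e by simp
      then show ?thesis using le[OF y] by simp
    qed
    obtain z where z: "z \<in> rel_interior K"
      using cK up rel_interior_eq_empty by blast
    then have "z \<in> K" using rel_interior_subset by blast
    then obtain s where "(fst z, s) \<in> L" unfolding K_def by blast
    then have "fst z \<in> convex hull V" unfolding fstL[symmetric] by (metis fst_conv imageI)
    then show False using hc(3)[OF z] const[of "fst z"]
      by (simp add: hceq c inner_prod_def)
  qed
  then have c: "c > 0" using c0 by simp
  define a where "a = h /\<^sub>R c"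
  define b where "b = a \<bullet> x + t0"
  have valid: "b \<le> a \<bullet> y + t" if "(y, t) \<in> K" for y t
  proof -
    have "h \<bullet> z = c * (a \<bullet> z)" for z using c by (simp add: a_def)
    then have "c * (a \<bullet> x + t0) \<le> c * (a \<bullet> y + t)" using sup[OF that] by (simp add: algebra_simps)
    then show ?thesis using c by (simp add: b_def)
  qed
  have gV: "(v, w v) \<in> K" if "v \<in> V" for v
    using that hull_subset[of "g ` V" convex] LK by (auto simp: L_def g_def)
  show ?thesis
  proof
    show "b \<le> a \<bullet> v + w v" if "v \<in> V" for v using valid[OF gV[OF that]] .
    have "(x, t0) \<in> convex hull (g ` V) \<inter> {z. (a, 1) \<bullet> z = b}"
      using xt by (simp add: L_def b_def)
    also have "\<dots> = convex hull {z \<in> g ` V. (a, 1) \<bullet> z = b}"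
      by (rule convex_hull_Int_supporting_hyperplane) (use fin valid gV in \<open>auto simp: g_def\<close>)
    finally have "fst (x, t0) \<in> fst ` (convex hull {z \<in> g ` V. (a, 1) \<bullet> z = b})"
      by (rule imageI)
    also have "\<dots> = convex hull (fst ` {z \<in> g ` V. (a, 1) \<bullet> z = b})"
      by (simp add: convex_hull_linear_image linear_fst)
    also have "fst ` {z \<in> g ` V. (a, 1) \<bullet> z = b} = {v \<in> V. a \<bullet> v + w v = b}"
      by (force simp: g_def)
    finally show "x \<in> lower_cell V w a b" by (simp add: lower_cell_def)
  qed
qed

text \<open>The difference \<open>(a' - a) \<bullet> x - (b' - b)\<close> of the two supporting
  functions is nonnegative on the first cell and nonpositive on the second. The cells meet exactly
  where it vanishes on the first cell, which is a face of it.\<close>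

lemma lower_cell_Int_face_of:
  assumes fin: "finite V" and "\<And>v. v \<in> V \<Longrightarrow> b \<le> a \<bullet> v + w v"
    and "\<And>v. v \<in> V \<Longrightarrow> b' \<le> a' \<bullet> v + w v"
  shows "lower_cell V w a b \<inter> lower_cell V w a' b' face_of lower_cell V w a b"
proof -
  define E where "E = {v \<in> V. a \<bullet> v + w v = b}"
  define E' where "E' = {v \<in> V. a' \<bullet> v + w v = b'}"
  have half: "convex hull {v \<in> V. a \<bullet> v + w v = b} \<subseteq> {x. b' - b \<le> (a' - a) \<bullet> x}"
    if "\<And>v. v \<in> V \<Longrightarrow> b' \<le> a' \<bullet> v + w v" for a b a' b'
  proof (intro hull_minimal convex_halfspace_ge subsetI)
    fix v assume "v \<in> {v \<in> V. a \<bullet> v + w v = b}"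
    then show "v \<in> {x. b' - b \<le> (a' - a) \<bullet> x}"
      using that[of v] by (auto simp: inner_diff_left)
  qed
  have sup: "convex hull E \<inter> {x. (a' - a) \<bullet> x = b' - b} = convex hull {v \<in> E. (a' - a) \<bullet> v = b' - b}"
    "convex hull {v \<in> E. (a' - a) \<bullet> v = b' - b} face_of convex hull E"
  proof -
    have "finite E" using fin by (simp add: E_def)
    moreover have "b' - b \<le> (a' - a) \<bullet> v" if "v \<in> E" for v
      using that assms(3)[of v] by (auto simp: E_def inner_diff_left)
    ultimately show "convex hull E \<inter> {x. (a' - a) \<bullet> x = b' - b} = convex hull {v \<in> E. (a' - a) \<bullet> v = b' - b}"
        "convex hull {v \<in> E. (a' - a) \<bullet> v = b' - b} face_of convex hull E"
      by (rule convex_hull_Int_supporting_hyperplane; blast)+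
  qed
  have "{v \<in> E. (a' - a) \<bullet> v = b' - b} \<subseteq> E'"
    by (auto simp: E_def E'_def inner_diff_left)
  then have "convex hull E \<inter> {x. (a' - a) \<bullet> x = b' - b} \<subseteq> convex hull E'"
    unfolding sup(1) by (rule hull_mono)
  moreover have "convex hull E \<inter> convex hull E' \<subseteq> {x. (a' - a) \<bullet> x = b' - b}"
  proof
    fix x assume x: "x \<in> convex hull E \<inter> convex hull E'"
    then have "b' - b \<le> (a' - a) \<bullet> x"
      using half[OF assms(3), of a b] by (auto simp: E_def)
    moreover have "b - b' \<le> (a - a') \<bullet> x"
      using half[OF assms(2), of a' b'] x by (auto simp: E'_def)
    ultimately show "x \<in> {x. (a' - a) \<bullet> x = b' - b}" by (simp add: inner_diff_left)
  qed
  ultimately have "convex hull E \<inter> convex hull E' = convex hull E \<inter> {x. (a' - a) \<bullet> x = b' - b}"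
    by blast
  then show ?thesis using sup by (simp add: lower_cell_def E_def E'_def)
qed

text \<open>A face of a cell is exposed by some \<open>h\<close>. Tilting the supporting hyperplane
  of the cell by a small multiple of \<open>h\<close> lifts it off the vertices outside the face,
  while the points outside the cell remain strictly above.\<close>

lemma face_of_lower_cell:
  assumes fin: "finite V" and valid: "\<And>v. v \<in> V \<Longrightarrow> b \<le> a \<bullet> v + w v"
    and F: "F face_of lower_cell V w a b"
  obtains a' b' where "\<And>v. v \<in> V \<Longrightarrow> b' \<le> a' \<bullet> v + w v" "F = lower_cell V w a' b'"
proof -
  define E where "E = {v \<in> V. a \<bullet> v + w v = b}"
  have finE: "finite E" using fin by (simp add: E_def)
  have "F exposed_face_of convex hull E"
    using F finE by (simp add: exposed_face_of_polyhedron polyhedron_convex_hull lower_cell_def E_def)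
  then obtain h c where h: "convex hull E \<subseteq> {x. h \<bullet> x \<le> c}" "F = convex hull E \<inter> {x. h \<bullet> x = c}"
    unfolding exposed_face_of_def by blast
  have hE: "h \<bullet> v \<le> c" if "v \<in> E" for v using h(1) hull_inc[OF that] by blast
  obtain e where e: "e > 0" "\<And>v. v \<in> V - E \<Longrightarrow> e * (h \<bullet> v - c) < a \<bullet> v + w v - b"
  proof (rule small_multiple_below[of "V - E" "\<lambda>v. a \<bullet> v + w v - b" "\<lambda>v. h \<bullet> v - c"])
    fix v assume "v \<in> V - E"
    then show "0 < a \<bullet> v + w v - b" using valid[of v] by (force simp: E_def)
  qed (use fin in auto)
  define a' where "a' = a - e *\<^sub>R h"
  define b' where "b' = b - e * c"
  have eq: "a' \<bullet> v + w v - b' = (a \<bullet> v + w v - b) - e * (h \<bullet> v - c)" for v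
    by (simp add: a'_def b'_def inner_diff_left algebra_simps)
  have onE: "a' \<bullet> v + w v - b' = e * (c - h \<bullet> v)" if "v \<in> E" for v
    using that eq[of v] by (simp add: E_def algebra_simps)
  have offE: "a' \<bullet> v + w v - b' > 0" if "v \<in> V - E" for v
    using e(2)[OF that] eq[of v] by simp
  have "F = convex hull {v \<in> E. - h \<bullet> v = - c}"
    using h(2) convex_hull_Int_supporting_hyperplane(1)[OF finE, of "- c" "- h"] hE by simp
  also have "{v \<in> E. - h \<bullet> v = - c} = {v \<in> V. a' \<bullet> v + w v = b'}"
  proof -
    have "v \<in> E \<and> - h \<bullet> v = - c \<longleftrightarrow> v \<in> V \<and> a' \<bullet> v + w v = b'" for v
    proof (cases "v \<in> E")
      case True
      then have "v \<in> V" by (simp add: E_def)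
      then show ?thesis using onE[OF True] e(1) True by auto
    next
      case False
      then show ?thesis using offE[of v] by auto
    qed
    then show ?thesis by auto
  qed
  finally have "F = lower_cell V w a' b'" by (simp add: lower_cell_def)
  moreover have "b' \<le> a' \<bullet> v + w v" if "v \<in> V" for v
  proof (cases "v \<in> E")
    case True
    then have "0 \<le> e * (c - h \<bullet> v)" using hE e(1) by simp
    then show ?thesis using onE[OF True] by simp
  next
    case False
    then show ?thesis using offE[of v] that by simp
  qed
  ultimately show ?thesis using that by blast
qed

lemma subdivision_induced:
  assumes P: "polytope P"
  shows "subdivision P (induced_subdivision P w)"
proof -
  define V where "V = vertices P"
  have fin: "finite V" and PV: "P = convex hull V"
    using finite_vertices[OF P] convex_hull_vertices[OF P] by (auto simp: V_def)
  define S where "S = {lower_cell V w a b | a b. \<forall>v\<in>V. b \<le> a \<bullet> v + w v}"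
  have S: "S = induced_subdivision P w"
    by (simp add: S_def V_def induced_subdivision_eq[OF P])
  have "S \<subseteq> (\<lambda>E. convex hull E) ` Pow V"
    by (auto simp: S_def lower_cell_def)
  then have finS: "finite S" using fin by (meson finite_Pow_iff finite_imageI finite_subset)
  have poly: "polytope C" if "C \<in> S" for C
    using that fin by (auto simp: S_def lower_cell_def intro!: polytope_convex_hull)
  have vert: "vertices C \<subseteq> V" if "C \<in> S" for C
  proof -
    from that obtain a b where "C = lower_cell V w a b" by (auto simp: S_def)
    then show ?thesis
      using vertices_convex_hull_subset[of "{v \<in> V. a \<bullet> v + w v = b}"] by (auto simp: lower_cell_def)
  qed
  have "\<Union>S = P"
  proof
    have "lower_cell V w a b \<subseteq> P" for a b
      unfolding PV lower_cell_def by (intro hull_mono) auto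
    then show "\<Union>S \<subseteq> P" by (auto simp: S_def)
    \<comment> \<open>Only the relative interior is covered directly; the rest of \<open>P\<close>
      follows because a finite union of polytopes is closed.\<close>
    have "closed (\<Union>S)"
      by (intro closed_Union finS ballI polytope_imp_closed poly)
    moreover have "rel_interior P \<subseteq> \<Union>S"
    proof
      fix x assume "x \<in> rel_interior P"
      then obtain a b where "\<And>v. v \<in> V \<Longrightarrow> b \<le> a \<bullet> v + w v" "x \<in> lower_cell V w a b"
        using lower_cells_cover_rel_interior[OF fin] PV by metis
      then show "x \<in> \<Union>S" by (auto simp: S_def)
    qed
    ultimately have "closure (rel_interior P) \<subseteq> \<Union>S" by (simp add: closure_minimal)
    then show "P \<subseteq> \<Union>S"
      using convex_closure_rel_interior[of P] P polytope_imp_convex closure_subset by blast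
  qed
  moreover have "F \<in> S" if "C \<in> S" "F face_of C" for C F
  proof -
    from that obtain a b where "C = lower_cell V w a b" "\<And>v. v \<in> V \<Longrightarrow> b \<le> a \<bullet> v + w v"
      by (auto simp: S_def)
    with that(2) obtain a' b' where "\<And>v. v \<in> V \<Longrightarrow> b' \<le> a' \<bullet> v + w v" "F = lower_cell V w a' b'"
      using face_of_lower_cell[OF fin] by metis
    then show ?thesis by (auto simp: S_def)
  qed
  moreover have "C \<inter> D face_of C" if "C \<in> S" "D \<in> S" for C D
    using that lower_cell_Int_face_of[OF fin] by (auto simp: S_def)
  ultimately have "subdivision P S"
    unfolding subdivision_def V_def[symmetric]
    using finS poly vert by (metis inf_commute)
  then show ?thesis by (simp add: S)
qed

section \<open>Lifts that induce triangulations\<close>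

lemma simplex_convex_hull_independent:
  "\<not> affine_dependent C \<Longrightarrow> \<exists>n. n simplex (convex hull C)"
  unfolding simplex_def by (rule exI[of _ "int (card C) - 1"]) auto

lemma triangulation_induced:
  assumes P: "polytope P"
    and gen: "\<And>a c. \<not> affine_dependent {v \<in> vertices P. w v = c + a \<bullet> v}"
  shows "triangulation_of P (induced_subdivision P w)"
  unfolding triangulation_of_def
proof (intro conjI ballI)
  fix C assume "C \<in> induced_subdivision P w"
  then obtain a b where "C = lower_cell (vertices P) w a b"
    by (auto simp: induced_subdivision_eq[OF P])
  moreover have "{v \<in> vertices P. a \<bullet> v + w v = b} = {v \<in> vertices P. w v = b + (- a) \<bullet> v}"
    by auto
  ultimately show "\<exists>n. n simplex C"
    unfolding lower_cell_def using gen[of b "- a"] by (simp add: simplex_convex_hull_independent)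
qed (rule subdivision_induced[OF P])

text \<open>The points of \<open>V\<close> are lifted one at a time. A height for \<open>x\<close>
  is bad if it is the value at \<open>x\<close> of a functional that agrees with \<open>w\<close> on
  a set \<open>E\<close> whose affine hull contains \<open>x\<close>. That value is determined by
  \<open>E\<close>, so there are finitely many bad heights, and a good one exists above any
  bound.\<close>

lemma generic_lift_exists:
  fixes M w0 :: "'a::euclidean_space \<Rightarrow> real"
  assumes "finite V" "finite C" "V \<inter> C = {}"
    and "\<And>a c. \<not> affine_dependent {v \<in> C. w0 v = c + a \<bullet> v}"
  shows "\<exists>w. (\<forall>v\<in>C. w v = w0 v) \<and> (\<forall>v\<in>V. w v > M v) \<and>
    (\<forall>a c. \<not> affine_dependent {v \<in> C \<union> V. w v = c + a \<bullet> v})"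
  using assms(1,3)
proof (induction V rule: finite_induct)
  case empty
  then show ?case using assms(4) by auto
next
  case (insert x V)
  define U where "U = C \<union> V"
  obtain w where w: "\<forall>v\<in>C. w v = w0 v" "\<forall>v\<in>V. w v > M v"
      "\<And>a c. \<not> affine_dependent {v \<in> U. w v = c + a \<bullet> v}"
    using insert by (auto simp: U_def)
  have xU: "x \<notin> U" using insert by (auto simp: U_def)
  define bad where "bad = {c + a \<bullet> x | a c. x \<in> affine hull {v \<in> U. w v = c + a \<bullet> v}}"
  have "finite bad"
  proof -
    define B where "B = (\<lambda>E. {c + a \<bullet> x | a c. x \<in> affine hull E \<and> (\<forall>v\<in>E. w v = c + a \<bullet> v)})"
    have "bad \<subseteq> (\<Union>E\<in>Pow U. B E)"
    proof
      fix y assume "y \<in> bad"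
      then obtain a c where "y = c + a \<bullet> x" "x \<in> affine hull {v \<in> U. w v = c + a \<bullet> v}"
        unfolding bad_def by blast
      then have "y \<in> B {v \<in> U. w v = c + a \<bullet> v}" unfolding B_def by blast
      moreover have "{v \<in> U. w v = c + a \<bullet> v} \<in> Pow U" by blast
      ultimately show "y \<in> (\<Union>E\<in>Pow U. B E)" by (rule UN_I[rotated])
    qed
    moreover have "finite (B E)" if "E \<in> Pow U" for E
    proof -
      have finE: "finite E" using that insert assms(2) by (auto simp: U_def intro: finite_subset)
      have "y = z" if yz: "y \<in> B E" "z \<in> B E" for y z
      proof -
        obtain a c a' c' where y: "y = c + a \<bullet> x" "\<forall>v\<in>E. w v = c + a \<bullet> v"
          and z: "z = c' + a' \<bullet> x" "\<forall>v\<in>E. w v = c' + a' \<bullet> v" and x: "x \<in> affine hull E"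
          using yz unfolding B_def by blast
        obtain u where u: "sum u E = 1" "(\<Sum>v\<in>E. u v *\<^sub>R v) = x"
          using x unfolding affine_hull_finite[OF finE] by blast
        have "(\<Sum>v\<in>E. u v * (c + a \<bullet> v)) = (\<Sum>v\<in>E. u v * (c' + a' \<bullet> v))"
          using y(2) z(2) by (intro sum.cong) (auto simp del: distrib_left)
        then show ?thesis unfolding affine_combination by (simp add: u y z)
      qed
      then show ?thesis
        by (metis finite.emptyI finite.insertI finite_subset insertI1 subsetI)
    qed
    moreover have "finite (Pow U)" using insert.hyps assms(2) by (simp add: U_def)
    ultimately show ?thesis by (meson finite_UN_I finite_subset)
  qed
  then obtain r where r: "r > M x" "r \<notin> bad"
    using infinite_Ioi[of "M x"] by (meson finite_subset greaterThan_iff subsetI)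
  define w' where "w' = w(x := r)"
  have "\<not> affine_dependent {v \<in> C \<union> insert x V. w' v = c + a \<bullet> v}" for a c
  proof (cases "r = c + a \<bullet> x")
    case True
    then have "{v \<in> C \<union> insert x V. w' v = c + a \<bullet> v} = insert x {v \<in> U. w v = c + a \<bullet> v}"
      using xU by (auto simp: w'_def U_def)
    moreover have "x \<notin> affine hull {v \<in> U. w v = c + a \<bullet> v}"
      using r(2) True by (auto simp: bad_def)
    ultimately show ?thesis using w(3) affine_independent_insert by metis
  next
    case False
    then have "{v \<in> C \<union> insert x V. w' v = c + a \<bullet> v} = {v \<in> U. w v = c + a \<bullet> v}"
      using xU by (auto simp: w'_def U_def)
    then show ?thesis using w(3) by metis
  qed
  moreover have "\<forall>v\<in>C. w' v = w0 v" "\<forall>v\<in>insert x V. w' v > M v"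
    using w insert r by (auto simp: w'_def)
  ultimately show ?case by blast
qed

section \<open>Circuits of totally splittable polytopes\<close>

lemma subset_maximal_cell:
  assumes "finite S" "D \<in> S"
  obtains M where "M \<in> maximal_cells S" "D \<subseteq> M"
proof -
  obtain M where "M \<in> S" "D \<subseteq> M" "\<forall>E\<in>S. M \<subseteq> E \<longrightarrow> M = E"
    using finite_has_maximal2[OF assms] by blast
  then show ?thesis using that[of M] by (auto simp: maximal_cells_def)
qed

lemma extreme_point_of_subset:
  "x extreme_point_of S \<Longrightarrow> T \<subseteq> S \<Longrightarrow> x \<in> T \<Longrightarrow> x extreme_point_of T"
  unfolding extreme_point_of_def by blast

text \<open>Each split has only two maximal cells, so one of them contains two of the three simplices, and
  any two of these cover all of \<open>C\<close>.\<close>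

lemma split_triangulation_three_simplices:
  assumes T: "split_triangulation P T" and C: "C \<subseteq> vertices P" "affine_dependent C"
    and P: "polytope P"
    and b: "b1 \<noteq> b2" "b1 \<noteq> b3" "b2 \<noteq> b3"
    and cells: "convex hull (C - {b1}) \<in> T" "convex hull (C - {b2}) \<in> T" "convex hull (C - {b3}) \<in> T"
  shows False
proof -
  obtain \<S> where split: "\<forall>S\<in>\<S>. split_of P S" and Teq: "T = common_refinement P \<S>"
    using T by (auto simp: split_triangulation_def)
  have sub: "\<exists>D\<in>S. K \<subseteq> D" if cell: "convex hull K \<in> T" and S: "S \<in> \<S>" for K S
  proof -
    obtain F f where "\<forall>S\<in>\<S>. f S \<in> S" "convex hull K = F \<inter> (\<Inter>S\<in>\<S>. f S)"
      using cell unfolding Teq common_refinement_def by blast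
    then show ?thesis using S hull_subset[of K convex] by blast
  qed
  have "\<exists>M\<in>S. C \<subseteq> M" if S: "S \<in> \<S>" for S
  proof -
    have "finite S" and "card (maximal_cells S) = 2"
      using split S by (auto simp: split_of_def subdivision_def)
    then obtain M1 M2 where M: "maximal_cells S = {M1, M2}" by (meson card_2_iff)
    then have inS: "M1 \<in> S" "M2 \<in> S" by (auto simp: maximal_cells_def)
    have "C - {b} \<subseteq> M1 \<or> C - {b} \<subseteq> M2" if cell: "convex hull (C - {b}) \<in> T" for b
    proof -
      obtain D where "D \<in> S" "C - {b} \<subseteq> D" using sub[OF cell S] by blast
      moreover then obtain M where "M \<in> maximal_cells S" "D \<subseteq> M"
        using subset_maximal_cell[OF \<open>finite S\<close>] by blast
      ultimately show ?thesis using M by blast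
    qed
    then have "C - {b1} \<subseteq> M1 \<or> C - {b1} \<subseteq> M2" "C - {b2} \<subseteq> M1 \<or> C - {b2} \<subseteq> M2"
      "C - {b3} \<subseteq> M1 \<or> C - {b3} \<subseteq> M2" using cells by blast+
    then have "C \<subseteq> M1 \<or> C \<subseteq> M2" using b by blast
    then show ?thesis using inS by blast
  qed
  then obtain f where f: "\<forall>S\<in>\<S>. f S \<in> S \<and> C \<subseteq> f S" by metis
  \<comment> \<open>These cells intersect in a cell of \<open>T\<close>, hence in a simplex. The
    points of \<open>C\<close> are extreme in \<open>P\<close>, so they would be among its affinely
    independent vertices.\<close>
  define K where "K = P \<inter> (\<Inter>S\<in>\<S>. f S)"
  have "P face_of P" using P by (simp add: face_of_refl polytope_imp_convex)
  then have "K \<in> T" unfolding Teq common_refinement_def K_def using f by blast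
  then obtain n where "n simplex K"
    using T by (auto simp: split_triangulation_def triangulation_of_def)
  then obtain W where W: "\<not> affine_dependent W" "K = convex hull W"
    by (auto simp: simplex_def)
  have "C \<subseteq> W"
  proof
    fix c assume "c \<in> C"
    then have c: "c extreme_point_of P" using C by (auto simp: vertices_def)
    then have "c \<in> K" using f \<open>c \<in> C\<close> by (auto simp: K_def extreme_point_of_def)
    then have "c extreme_point_of K"
      using c by (intro extreme_point_of_subset[OF c]) (auto simp: K_def)
    then show "c \<in> W" using W extreme_point_of_convex_hull by blast
  qed
  then show False using W(1) C(2) affine_dependent_subset by blast
qed

text \<open>Lift \<open>C\<close> by a function that is not affine on it. The functional through the
  lifted \<open>C - {b}\<close> misses the lift of \<open>b\<close> by \<open>l u / l b\<close>, so
  it passes below it exactly if \<open>l b > 0\<close>. Raising all other vertices far enough makes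
  this functional support the lower hull precisely along \<open>C - {b}\<close>.\<close>

lemma three_positive_circuit_simplices:
  assumes P: "polytope P" and C: "C \<subseteq> vertices P" "affine_dependent C"
    and minimal: "\<And>E. E \<subset> C \<Longrightarrow> \<not> affine_dependent E"
    and l: "sum l C = 0" "(\<Sum>v\<in>C. l v *\<^sub>R v) = 0"
    and u: "u \<in> C" "l u > 0"
  obtains T where "regular_subdivision P T" "triangulation_of P T"
    "\<And>b. b \<in> C \<Longrightarrow> l b > 0 \<Longrightarrow> convex hull (C - {b}) \<in> T"
proof -
  define V where "V = vertices P"
  have finV: "finite V" using finite_vertices[OF P] by (simp add: V_def)
  then have finC: "finite C" using C finite_subset V_def by blast
  \<comment> \<open>Raising \<open>u\<close> alone gives the sum of \<open>l v * w0 v\<close> the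
    value \<open>l u > 0\<close>, whereas a lift affine on \<open>C\<close> would give 0.\<close>
  define w0 :: "'a \<Rightarrow> real" where "w0 = (\<lambda>v. if v = u then 1 else 0)"
  have lw0: "(\<Sum>v\<in>C. l v * w0 v) = l u"
    using finC u by (simp add: w0_def if_distrib cong: if_cong)
  have gen0: "\<not> affine_dependent {v \<in> C. w0 v = c + a \<bullet> v}" for a c
  proof
    assume "affine_dependent {v \<in> C. w0 v = c + a \<bullet> v}"
    then have "\<not> {v \<in> C. w0 v = c + a \<bullet> v} \<subset> C" using minimal by metis
    then have "\<forall>v\<in>C. w0 v = c + a \<bullet> v" by auto
    then have "(\<Sum>v\<in>C. l v * w0 v) = (\<Sum>v\<in>C. l v * (c + a \<bullet> v))"
      by (intro sum.cong) auto
    then show False using affine_dependency_eval[OF l, of c a] lw0 u by simp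
  qed
  have "\<exists>a c. \<forall>x\<in>C-{b}. c + a \<bullet> x = w0 x" if "b \<in> C" for b
  proof -
    have "C - {b} \<subset> C" using that by blast
    from affine_interpolation[OF minimal[OF this], of w0] show ?thesis by metis
  qed
  then obtain a c where ac: "\<And>b x. b \<in> C \<Longrightarrow> x \<in> C - {b} \<Longrightarrow> c b + a b \<bullet> x = w0 x"
    by metis
  \<comment> \<open>Lies above all the interpolating functionals at once, so the vertices outside
    \<open>C\<close> stay off all the cells \<open>C - {b}\<close>.\<close>
  define M where "M = (\<lambda>v. \<Sum>b\<in>C. \<bar>c b + a b \<bullet> v\<bar>)"
  have M: "c b + a b \<bullet> v \<le> M v" if "b \<in> C" for b v
  proof -
    have "\<bar>c b + a b \<bullet> v\<bar> \<le> M v" unfolding M_def by (rule member_le_sum) (use that finC in auto)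
    then show ?thesis by linarith
  qed
  obtain w where w: "\<forall>v\<in>C. w v = w0 v" "\<forall>v\<in>V-C. w v > M v"
      "\<And>a c. \<not> affine_dependent {v \<in> C \<union> (V - C). w v = c + a \<bullet> v}"
    using generic_lift_exists[of "V - C" C w0 M] finV finC gen0 by blast
  have CV: "C \<union> (V - C) = V" using C by (auto simp: V_def)
  define T where "T = induced_subdivision P w"
  show ?thesis
  proof
    show "regular_subdivision P T"
      unfolding regular_subdivision_def T_def using subdivision_induced[OF P] by blast
    show "triangulation_of P T"
      unfolding T_def using w(3) unfolding CV unfolding V_def by (rule triangulation_induced[OF P])
    fix b assume b: "b \<in> C" "l b > 0"
    have "(\<Sum>v\<in>C. l v * (c b + a b \<bullet> v)) = l b * (c b + a b \<bullet> b) + (\<Sum>v\<in>C-{b}. l v * w0 v)"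
      using ac[OF b(1)] finC b by (simp add: sum.remove)
    moreover have "(\<Sum>v\<in>C. l v * w0 v) = l b * w0 b + (\<Sum>v\<in>C-{b}. l v * w0 v)"
      using finC b by (simp add: sum.remove)
    ultimately have "l b * (w0 b - (c b + a b \<bullet> b)) = l u"
      using affine_dependency_eval[OF l, of "c b" "a b"] lw0 by (simp add: algebra_simps)
    then have "w0 b - (c b + a b \<bullet> b) > 0"
      using u b by (metis zero_less_mult_pos)
    then have wb: "c b + a b \<bullet> b < w b" using w(1) b by simp
    have out: "c b + a b \<bullet> v < w v" if "v \<in> V - C" for v
      using w(2)[rule_format, OF that] M[OF b(1), of v] by (rule le_less_trans[rotated])
    have on: "c b + a b \<bullet> v = w v" if "v \<in> C - {b}" for v
      using ac[OF b(1) that] w(1) that by simp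
    have "{v \<in> V. (- a b) \<bullet> v + w v = c b} = C - {b}"
    proof -
      have "v \<in> V \<and> (- a b) \<bullet> v + w v = c b \<longleftrightarrow> v \<in> C - {b}" for v
      proof (cases "v \<in> C - {b}")
        case True
        then show ?thesis using on[OF True] CV by auto
      next
        case False
        show ?thesis
        proof
          assume v: "v \<in> V \<and> (- a b) \<bullet> v + w v = c b"
          show "v \<in> C - {b}"
          proof (cases "v = b")
            case True
            then show ?thesis using v wb by simp
          next
            case False
            then show ?thesis using v out[of v] by force
          qed
        qed (use False in simp)
      qed
      then show ?thesis by blast
    qed
    then have "convex hull (C - {b}) = lower_cell V w (- a b) (c b)"
      by (simp add: lower_cell_def)
    moreover have "\<forall>v\<in>V. c b \<le> (- a b) \<bullet> v + w v"
    proof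
      fix v assume "v \<in> V"
      then consider "v \<in> C - {b}" | "v = b" | "v \<in> V - C" by blast
      then show "c b \<le> (- a b) \<bullet> v + w v" using on[of v] wb out[of v] by cases auto
    qed
    ultimately show "convex hull (C - {b}) \<in> T"
      unfolding T_def induced_subdivision_eq[OF P] V_def by blast
  qed
qed

lemma three_elements:
  assumes "card A \<ge> 3"
  obtains x y z where "x \<in> A" "y \<in> A" "z \<in> A" "x \<noteq> y" "x \<noteq> z" "y \<noteq> z"
proof -
  obtain B where "B \<subseteq> A" "card B = 3" using obtain_subset_with_card_n[OF assms] by metis
  then show ?thesis using that by (auto simp: card_3_iff)
qed

lemma totally_splittable_imp_circuits_le_4:
  assumes P: "polytope P" and ts: "totally_splittable P"
  shows "circuits_le_4 (vertices P)"
  unfolding circuits_le_4_def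
proof (intro allI impI)
  fix D assume D: "D \<subseteq> vertices P" "affine_dependent D"
  then have "finite D" using finite_vertices[OF P] finite_subset by blast
  then obtain C l where C: "C \<subseteq> D" "affine_dependent C" and minimal: "\<forall>E. E \<subset> C \<longrightarrow> \<not> affine_dependent E"
    and l: "sum l C = 0" "(\<Sum>v\<in>C. l v *\<^sub>R v) = 0" and l0: "\<forall>v\<in>C. l v \<noteq> 0"
    by (rule minimal_dependent_subset[OF _ D(2)])
  \<comment> \<open>Stated for an arbitrary dependency \<open>m\<close> because it is applied to
    both \<open>l\<close> and \<open>- l\<close>: at most two coefficients of each sign leave at
    most four elements.\<close>
  have no_three: "card {v \<in> C. m v > 0} < 3"
    if m: "sum m C = 0" "(\<Sum>v\<in>C. m v *\<^sub>R v) = 0" for m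
  proof (rule ccontr)
    assume "\<not> ?thesis"
    then have "3 \<le> card {v \<in> C. m v > 0}" by simp
    then obtain x y z where "x \<in> {v \<in> C. m v > 0}" "y \<in> {v \<in> C. m v > 0}" "z \<in> {v \<in> C. m v > 0}"
        and neq: "x \<noteq> y" "x \<noteq> z" "y \<noteq> z"
      by (rule three_elements)
    then have xyz: "x \<in> C" "y \<in> C" "z \<in> C" "m x > 0" "m y > 0" "m z > 0" by auto
    have CV: "C \<subseteq> vertices P" using C D by blast
    obtain T where T: "regular_subdivision P T" "triangulation_of P T"
      "\<And>b. b \<in> C \<Longrightarrow> m b > 0 \<Longrightarrow> convex hull (C - {b}) \<in> T"
      using three_positive_circuit_simplices[OF P CV C(2) minimal[rule_format] m xyz(1,4)] by metis
    then have "split_triangulation P T" using ts by (simp add: totally_splittable_def)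
    then show False
      using split_triangulation_three_simplices[OF _ CV C(2) P neq] T(3) xyz by blast
  qed
  have "(\<Sum>v\<in>C. - l v *\<^sub>R v) = 0" "(\<Sum>v\<in>C. - l v) = 0"
    using l by (simp_all add: sum_negf)
  then have "card {v \<in> C. - l v > 0} < 3" by (intro no_three)
  moreover have "card {v \<in> C. l v > 0} < 3" by (rule no_three[OF l])
  moreover have "C = {v \<in> C. l v > 0} \<union> {v \<in> C. - l v > 0}" using l0 by force
  ultimately have "card C \<le> 4"
    using card_Un_le[of "{v \<in> C. l v > 0}" "{v \<in> C. - l v > 0}"] by simp
  then show "\<exists>E\<subseteq>D. card E \<le> 4 \<and> affine_dependent E" using C by blast
qed

section \<open>Triangulations whose circuits are small\<close>

lemma triangulation_simplex:
  assumes "triangulation_of P T" "C \<in> T"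
  obtains E where "\<not> affine_dependent E" "C = convex hull E" "E \<subseteq> vertices P"
proof -
  obtain E where E: "\<not> affine_dependent E" "C = convex hull E"
    using assms by (auto simp: triangulation_of_def simplex_def)
  have "vertices C = E"
    using E extreme_point_of_convex_hull_affine_independent by (auto simp: vertices_def)
  then show ?thesis using that E assms by (auto simp: triangulation_of_def subdivision_def)
qed

lemma triangulation_subset_simplex:
  assumes T: "triangulation_of P T" and "convex hull E \<in> T" "\<not> affine_dependent E" "F \<subseteq> E"
  shows "convex hull F \<in> T"
proof -
  have "convex hull F face_of convex hull E"
    using assms face_of_convex_hull_affine_independent by blast
  then show ?thesis using assms by (auto simp: triangulation_of_def subdivision_def)
qed

text \<open>If the hyperplane of a facet cut an edge \<open>uv\<close>, the circuit inside the facet together with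
  \<open>u\<close> and \<open>v\<close> would consist of \<open>u\<close>, \<open>v\<close> and an edge of the facet crossing \<open>uv\<close>.\<close>

lemma facet_hyperplane_cuts_no_cell:
  fixes P :: "'a::euclidean_space set"
  assumes P: "polytope P" and circ: "circuits_le_4 (vertices P)" and T: "triangulation_of P T"
    and E: "convex hull E \<in> T" "\<not> affine_dependent E" "E \<subseteq> vertices P" "P \<subseteq> affine hull E"
    and e: "e \<in> E" and h: "\<And>v. v \<in> E - {e} \<Longrightarrow> h \<bullet> v = c"
    and \<tau>: "\<tau> \<in> T" "x \<in> \<tau>" "h \<bullet> x < c" "y \<in> \<tau>" "h \<bullet> y > c"
  shows False
proof -
  define V where "V = vertices P"
  obtain G where G: "\<not> affine_dependent G" "\<tau> = convex hull G" "G \<subseteq> V"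
    using triangulation_simplex[OF T \<tau>(1)] by (auto simp: V_def)
  have "\<not> convex hull G \<subseteq> {x. h \<bullet> x \<ge> c}" "\<not> convex hull G \<subseteq> {x. h \<bullet> x \<le> c}"
    using \<tau> G by auto
  then have "\<not> G \<subseteq> {x. h \<bullet> x \<ge> c}" "\<not> G \<subseteq> {x. h \<bullet> x \<le> c}"
    by (metis hull_minimal convex_halfspace_ge, metis hull_minimal convex_halfspace_le)
  then obtain u v where u: "u \<in> G" "h \<bullet> u < c" and v: "v \<in> G" "h \<bullet> v > c" by force
  have finV: "finite V" using finite_vertices[OF P] by (simp add: V_def)
  have VP: "V \<subseteq> P" using convex_hull_vertices[OF P] hull_subset V_def by metis
  define F where "F = E - {e}"
  have FV: "F \<subseteq> V" "finite F" "finite E" using E finV finite_subset by (auto simp: F_def V_def)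
  have hF: "h \<bullet> w = c" if "w \<in> F" for w using h that by (simp add: F_def)
  have notF: "u \<notin> F" "v \<notin> F" "u \<noteq> v" using hF u v by force+
  define D where "D = insert u (insert v F)"
  have DV: "D \<subseteq> V" using FV G u v by (auto simp: D_def)
  \<comment> \<open>A dimension count: \<open>D\<close> has one point more than the independent set
    \<open>E\<close>, whose affine hull contains it.\<close>
  have "affine_dependent D"
  proof (rule ccontr)
    assume "\<not> affine_dependent D"
    then have "aff_dim D = int (card D) - 1" using affine_independent_iff_card by blast
    moreover have "card D = Suc (card E)"
      using notF FV e card_Suc_Diff1[of E e] by (simp add: D_def F_def[symmetric])
    moreover have "aff_dim D \<le> aff_dim (affine hull E)"
      using DV VP E(4) by (intro aff_dim_subset) auto
    moreover have "aff_dim E = int (card E) - 1" using E(2) affine_independent_iff_card by blast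
    ultimately show False by simp
  qed
  then obtain D' where D': "D' \<subseteq> D" "card D' \<le> 4" "affine_dependent D'"
    by (rule circuits_le_4D[OF circ DV[unfolded V_def]])
  have finD': "finite D'" by (rule finite_subset[OF _ finV]) (use D' DV in blast)
  obtain C l where C: "C \<subseteq> D'" "affine_dependent C"
    and l: "sum l C = 0" "(\<Sum>v\<in>C. l v *\<^sub>R v) = 0" and l0: "\<forall>v\<in>C. l v \<noteq> 0"
    by (rule minimal_dependent_subset[OF finD' D'(3)])
  have finC: "finite C" using C finD' finite_subset by blast
  have card: "card C \<le> 4" using C D' finD' by (meson card_mono order_trans)
  have CD: "C \<subseteq> D" using C D' by blast
  \<comment> \<open>The functional \<open>h - c\<close> kills all points of \<open>F\<close>. What
    remains shows that \<open>u\<close> and \<open>v\<close> both occur in \<open>C\<close>, and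
    with the same sign because they lie on opposite sides.\<close>
  have "(\<Sum>w\<in>C. l w * (- c + h \<bullet> w)) = 0" by (rule affine_dependency_eval[OF l])
  also have "(\<Sum>w\<in>C. l w * (- c + h \<bullet> w)) = (\<Sum>w\<in>C \<inter> {u, v}. l w * (- c + h \<bullet> w))"
    using hF CD finC by (intro sum.mono_neutral_right) (auto simp: D_def)
  finally have eq: "(\<Sum>w\<in>C \<inter> {u, v}. l w * (- c + h \<bullet> w)) = 0" .
  have "C \<inter> {u, v} \<noteq> {}"
  proof
    assume "C \<inter> {u, v} = {}"
    then have "C \<subseteq> E" using CD by (auto simp: D_def F_def)
    then show False using C E affine_dependent_subset by blast
  qed
  have uv: "u \<in> C \<and> v \<in> C"
  proof (rule ccontr)
    assume "\<not> ?thesis"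
    then have "C \<inter> {u, v} = {u} \<or> C \<inter> {u, v} = {v}" using \<open>C \<inter> {u, v} \<noteq> {}\<close> by blast
    then show False using eq l0 u v by fastforce
  qed
  then have Cuv: "C \<inter> {u, v} = {u, v}" by blast
  have luv: "l u * (c - h \<bullet> u) = l v * (h \<bullet> v - c)"
    using eq notF(3) unfolding Cuv by (simp add: algebra_simps)
  define m where "m = (\<lambda>w. if l u > 0 then l w else - l w)"
  have m: "sum m C = 0" "(\<Sum>v\<in>C. m v *\<^sub>R v) = 0"
    using l by (cases "l u > 0"; simp add: m_def sum_negf)+
  have mu: "m u > 0" using l0 uv by (force simp: m_def)
  have "m u * (c - h \<bullet> u) = m v * (h \<bullet> v - c)" using luv by (simp add: m_def)
  then have mv: "m v > 0"
    using mu u v by (metis diff_gt_0_iff_gt mult_pos_pos zero_less_mult_pos2)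
  have cp: "convex_position C"
    using convex_position_vertices[OF P] CD DV by (auto simp: V_def intro: convex_position_mono)
  have "\<exists>f\<in>C. m f < 0"
  proof (rule ccontr)
    assume "\<not> ?thesis"
    then have "sum m C > 0" using mu uv finC by (intro sum_pos2[of C u]) auto
    then show False using m by simp
  qed
  then obtain f where f: "f \<in> C" "m f < 0" by blast
  then obtain f' where f': "f' \<in> C" "f' \<noteq> f" "m f' < 0"
    using convex_position_two_negative[OF cp m] by blast
  have neq: "f \<notin> {u, v}" "f' \<notin> {u, v}" using mu mv f f' by force+
  have "{u, v, f, f'} = C"
  proof (rule card_subset_eq[OF finC])
    show "card {u, v, f, f'} = card C"
    proof (rule antisym)
      show "card {u, v, f, f'} \<le> card C" using uv f f' finC by (intro card_mono) auto
      have "card {u, v, f, f'} = 4" using notF(3) neq f'(2) by (auto simp: card_insert_if)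
      then show "card C \<le> card {u, v, f, f'}" using card by simp
    qed
  qed (use uv f f' in auto)
  then have Ceq: "C = {u, v, f, f'}" by simp
  define s where "s = m u + m v"
  have s: "s > 0" using mu mv by (simp add: s_def)
  have sm: "m u + m v + m f + m f' = 0"
    and sv: "m u *\<^sub>R u + m v *\<^sub>R v + m f *\<^sub>R f + m f' *\<^sub>R f' = 0"
  proof -
    have d: "u \<notin> {v, f, f'}" "v \<notin> {f, f'}" "f \<notin> {f'}" using neq notF(3) f'(2) by auto
    show "m u + m v + m f + m f' = 0"
      using m(1) d unfolding Ceq by (simp add: add.assoc)
    show "m u *\<^sub>R u + m v *\<^sub>R v + m f *\<^sub>R f + m f' *\<^sub>R f' = 0"
      using m(2) d unfolding Ceq by (simp add: add.assoc)
  qed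
  \<comment> \<open>The crossing point of the two diagonals; \<open>s\<close> normalises the
    positive and the negative part of the dependency to convex combinations.\<close>
  define z where "z = (m u / s) *\<^sub>R u + (m v / s) *\<^sub>R v"
  have z': "z = (- m f / s) *\<^sub>R f + (- m f' / s) *\<^sub>R f'"
  proof -
    have "m u *\<^sub>R u + m v *\<^sub>R v = - m f *\<^sub>R f - m f' *\<^sub>R f'"
      using sv by (simp add: algebra_simps eq_neg_iff_add_eq_0)
    then have "(1 / s) *\<^sub>R (m u *\<^sub>R u + m v *\<^sub>R v) = (1 / s) *\<^sub>R (- m f *\<^sub>R f - m f' *\<^sub>R f')" by simp
    then show ?thesis by (simp add: z_def scaleR_add_right scaleR_diff_right)
  qed
  have sum1: "m u / s = 1 - m v / s" using s by (simp add: s_def field_simps)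
  have z1: "z \<in> open_segment u v"
    unfolding in_segment using notF(3) mu mv s sum1
    by (intro conjI exI[of _ "m v / s"]) (auto simp: z_def s_def)
  have "- m f / s = 1 - (- m f' / s)"
  proof -
    have "s = - m f - m f'" using sm by (simp add: s_def)
    then show ?thesis using s by (simp add: field_simps)
  qed
  moreover have "- m f / s \<ge> 0" "- m f' / s \<ge> 0" using f f' s by (simp_all add: divide_nonpos_pos)
  ultimately have z2: "z \<in> convex hull {f, f'}"
    unfolding convex_hull_2 z' by fastforce
  have ff: "f \<in> F" "f' \<in> F" using f f' neq CD by (auto simp: D_def)
  \<comment> \<open>Both segments are cells of \<open>T\<close>, so they meet in a face of the
    segment \<open>uv\<close>. This face contains the inner point \<open>z\<close>, hence also
    \<open>u\<close>, which lies off the hyperplane through \<open>f\<close> and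
    \<open>f'\<close>.\<close>
  have "convex hull {u, v} \<in> T"
    using triangulation_subset_simplex[OF T, of G] \<tau> G u v by simp
  moreover have "convex hull {f, f'} \<in> T"
    using triangulation_subset_simplex[OF T, of E] E ff by (simp add: F_def)
  ultimately have "convex hull {u, v} \<inter> convex hull {f, f'} face_of convex hull {u, v}"
    using T by (auto simp: triangulation_of_def subdivision_def)
  moreover have "z \<in> convex hull {u, v} \<inter> convex hull {f, f'}"
    using z1 z2 segment_open_subset_closed segment_convex_hull by blast
  moreover have "u \<in> convex hull {u, v}" "v \<in> convex hull {u, v}" by (simp_all add: hull_inc)
  ultimately have "u \<in> convex hull {f, f'}"
    using face_ofD[OF _ z1] by blast
  moreover have "convex hull {f, f'} \<subseteq> {x. h \<bullet> x = c}"
    by (intro hull_minimal) (use hF ff in \<open>auto simp: convex_hyperplane\<close>)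
  ultimately show False using u by auto
qed

section \<open>Splits along uncut hyperplanes\<close>

lemma halfspace_split:
  fixes P :: "'a::euclidean_space set"
  assumes P: "polytope P"
    and v1: "vertices (P \<inter> {x. h \<bullet> x \<le> c}) \<subseteq> vertices P"
    and v2: "vertices (P \<inter> {x. h \<bullet> x \<ge> c}) \<subseteq> vertices P"
    and x: "x \<in> P" "h \<bullet> x < c" and y: "y \<in> P" "h \<bullet> y > c"
  shows "split_of P ({F. F face_of P \<inter> {x. h \<bullet> x \<le> c}} \<union> {F. F face_of P \<inter> {x. h \<bullet> x \<ge> c}})"
proof -
  define P1 where "P1 = P \<inter> {x. h \<bullet> x \<le> c}"
  define P2 where "P2 = P \<inter> {x. h \<bullet> x \<ge> c}"
  define S where "S = {F. F face_of P1} \<union> {F. F face_of P2}"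
  have poly: "polytope P1" "polytope P2"
    using P by (auto simp: P1_def P2_def polytope_Int_polyhedron polyhedron_halfspace_le polyhedron_halfspace_ge)
  have H: "P1 \<inter> P2 = P \<inter> {x. h \<bullet> x = c}" by (auto simp: P1_def P2_def)
  have H1: "P1 \<inter> P2 face_of P1" and H2: "P1 \<inter> P2 face_of P2"
  proof -
    have "P1 \<inter> {x. h \<bullet> x = c} face_of P1"
      using poly by (intro face_of_Int_supporting_hyperplane_le) (auto simp: polytope_imp_convex P1_def)
    then show "P1 \<inter> P2 face_of P1" unfolding H by (simp add: P1_def Int_assoc Int_absorb1 Collect_mono)
    have "P2 \<inter> {x. h \<bullet> x = c} face_of P2"
      using poly by (intro face_of_Int_supporting_hyperplane_ge) (auto simp: polytope_imp_convex P2_def)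
    then show "P1 \<inter> P2 face_of P2" unfolding H by (simp add: P2_def Int_assoc Int_absorb1 Collect_mono)
  qed
  \<comment> \<open>If \<open>A\<close> and \<open>B\<close> meet in a common face, faces of the two
    meet inside that face, where the intersection can be formed. Taking \<open>A = B\<close> covers
    two faces of the same half.\<close>
  have mixed: "C \<inter> D face_of C \<and> C \<inter> D face_of D" if C: "C face_of A" and D: "D face_of B"
    and AB: "A \<inter> B face_of A" "A \<inter> B face_of B" for A B C D :: "'a set"
  proof -
    have "C \<inter> D = (C \<inter> (A \<inter> B)) \<inter> (D \<inter> (A \<inter> B))"
      using C D face_of_imp_subset by blast
    moreover have "C \<inter> (A \<inter> B) face_of A \<inter> B"
      using face_of_subset[OF face_of_Int[OF C AB(1)]] by blast
    moreover have "D \<inter> (A \<inter> B) face_of A \<inter> B"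
      using face_of_subset[OF face_of_Int[OF D AB(2)]] by blast
    ultimately have "C \<inter> D face_of A \<inter> B" by (simp add: face_of_Int)
    then have "C \<inter> D face_of A" "C \<inter> D face_of B" using AB face_of_trans by blast+
    then show ?thesis using C D face_of_imp_subset
      by (meson face_of_subset inf_le1 inf_le2)
  qed
  have vert: "vertices C \<subseteq> vertices Q" if "C face_of Q" for C Q :: "'a set"
    using that extreme_point_of_face by (auto simp: vertices_def)
  have "subdivision P S"
    unfolding subdivision_def
  proof (intro conjI ballI allI impI)
    show "finite S" using poly by (simp add: S_def finite_polytope_faces)
    show "\<Union>S = P"
    proof
      show "\<Union>S \<subseteq> P" unfolding S_def P1_def P2_def by (auto dest: face_of_imp_subset)
      have "P \<subseteq> P1 \<union> P2" by (auto simp: P1_def P2_def)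
      moreover have "P1 \<in> S" "P2 \<in> S" using poly by (auto simp: S_def face_of_refl polytope_imp_convex)
      ultimately show "P \<subseteq> \<Union>S" by blast
    qed
    fix C assume C: "C \<in> S"
    show "polytope C" using C poly by (auto simp: S_def dest: face_of_polytope_polytope)
    \<comment> \<open>New vertices on the hyperplane are what could prevent such a cut from being a
      split; the assumptions on the two halves exclude them.\<close>
    show "vertices C \<subseteq> vertices P"
      using C v1 v2 vert by (fastforce simp: S_def P1_def P2_def)
    show "F \<in> S" if "F face_of C" for F
      using that C by (auto simp: S_def dest: face_of_trans)
    fix D assume D: "D \<in> S"
    have refl: "P1 \<inter> P1 face_of P1" "P2 \<inter> P2 face_of P2"
      using poly by (auto simp: face_of_refl polytope_imp_convex)
    have H': "P2 \<inter> P1 face_of P1" "P2 \<inter> P1 face_of P2" using H1 H2 by (simp_all add: Int_commute)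
    have "C \<inter> D face_of C \<and> C \<inter> D face_of D"
      using C D mixed[OF _ _ H1 H2] mixed[OF _ _ H'(2,1)] mixed[OF _ _ refl(1) refl(1)] mixed[OF _ _ refl(2) refl(2)]
      by (auto simp: S_def)
    then show "C \<inter> D face_of C" "C \<inter> D face_of D" by auto
  qed
  moreover have "maximal_cells S = {P1, P2}"
  proof -
    have ne: "\<not> P1 \<subseteq> P2" "\<not> P2 \<subseteq> P1" using x y by (auto simp: P1_def P2_def)
    have in_S: "P1 \<in> S" "P2 \<in> S" using poly by (auto simp: S_def face_of_refl polytope_imp_convex)
    have sub: "C \<subseteq> P1 \<or> C \<subseteq> P2" if "C \<in> S" for C
      using that face_of_imp_subset by (auto simp: S_def)
    have "P1 \<in> maximal_cells S" "P2 \<in> maximal_cells S"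
      unfolding maximal_cells_def using in_S sub ne by fastforce+
    moreover have "C = P1 \<or> C = P2" if "C \<in> maximal_cells S" for C
    proof -
      have "C \<in> S" "\<forall>D\<in>S. C \<subseteq> D \<longrightarrow> D = C" using that by (simp_all add: maximal_cells_def)
      then show ?thesis using sub in_S by metis
    qed
    ultimately show ?thesis by blast
  qed
  moreover have "P1 \<noteq> P2"
  proof -
    have "x \<in> P1" "x \<notin> P2" using x by (auto simp: P1_def P2_def)
    then show ?thesis by blast
  qed
  ultimately show ?thesis unfolding split_of_def S_def P1_def P2_def by simp
qed

text \<open>A simplex within the halfspace is spanned by old vertices there. A simplex on the other
  side meets the halfspace in the face spanned by its vertices on the hyperplane. So the half of
  \<open>P\<close> is the hull of old vertices.\<close>

lemma uncut_halfspace: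
  fixes P :: "'a::euclidean_space set"
  assumes P: "polytope P" and T: "triangulation_of P T"
    and uncut: "\<And>\<tau>. \<tau> \<in> T \<Longrightarrow> \<tau> \<subseteq> {x. h \<bullet> x \<le> c} \<or> \<tau> \<subseteq> {x. h \<bullet> x \<ge> c}"
  shows "vertices (P \<inter> {x. h \<bullet> x \<le> c}) \<subseteq> vertices P"
proof -
  have "P \<inter> {x. h \<bullet> x \<le> c} \<subseteq> convex hull (vertices P \<inter> {x. h \<bullet> x \<le> c})"
  proof
    fix x assume x: "x \<in> P \<inter> {x. h \<bullet> x \<le> c}"
    then obtain \<tau> where \<tau>: "\<tau> \<in> T" "x \<in> \<tau>"
      using T by (auto simp: triangulation_of_def subdivision_def)
    obtain G where G: "\<not> affine_dependent G" "\<tau> = convex hull G" "G \<subseteq> vertices P"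
      using triangulation_simplex[OF T \<tau>(1)] by blast
    have finG: "finite G" using G aff_independent_finite by blast
    have "x \<in> convex hull (G \<inter> {x. h \<bullet> x \<le> c})"
    proof (cases "\<tau> \<subseteq> {x. h \<bullet> x \<le> c}")
      case True
      then have "G \<inter> {x. h \<bullet> x \<le> c} = G" using G hull_subset[of G convex] by blast
      then show ?thesis using \<tau> G by simp
    next
      case False
      then have "\<tau> \<subseteq> {x. h \<bullet> x \<ge> c}" using uncut \<tau> by blast
      moreover have "G \<subseteq> \<tau>" using G hull_subset[of G convex] by simp
      ultimately have ge: "c \<le> h \<bullet> v" if "v \<in> G" for v using that by blast
      have "h \<bullet> x = c" using x \<tau> \<open>\<tau> \<subseteq> {x. h \<bullet> x \<ge> c}\<close> by fastforce
      then have "x \<in> convex hull {v \<in> G. h \<bullet> v = c}"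
        using convex_hull_Int_supporting_hyperplane(1)[OF finG ge] \<tau> G by blast
      moreover have "{v \<in> G. h \<bullet> v = c} \<subseteq> G \<inter> {x. h \<bullet> x \<le> c}" by auto
      ultimately show ?thesis using hull_mono by blast
    qed
    moreover have "G \<inter> {x. h \<bullet> x \<le> c} \<subseteq> vertices P \<inter> {x. h \<bullet> x \<le> c}" using G by blast
    ultimately show "x \<in> convex hull (vertices P \<inter> {x. h \<bullet> x \<le> c})"
      using hull_mono by blast
  qed
  moreover have "convex hull (vertices P \<inter> {x. h \<bullet> x \<le> c}) \<subseteq> P \<inter> {x. h \<bullet> x \<le> c}"
    using polytope_imp_convex[OF P]
    by (intro hull_minimal convex_Int convex_halfspace_le)
      (auto simp: vertices_def extreme_point_of_def)
  ultimately have "P \<inter> {x. h \<bullet> x \<le> c} = convex hull (vertices P \<inter> {x. h \<bullet> x \<le> c})" by blast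
  then show ?thesis using vertices_convex_hull_subset by (metis inf.boundedE)
qed

text \<open>Take an inclusion-minimal cell containing \<open>x\<close>; if \<open>x\<close> were on
  its relative boundary, a facet through \<open>x\<close> would be a smaller one.\<close>

lemma rel_interior_cell_exists:
  fixes S :: "'a::euclidean_space set set"
  assumes "finite S" "\<And>C. C \<in> S \<Longrightarrow> polytope C" "\<And>C F. C \<in> S \<Longrightarrow> F face_of C \<Longrightarrow> F \<in> S"
    and "C \<in> S" "x \<in> C"
  obtains D where "D \<in> S" "x \<in> rel_interior D"
proof -
  have fin: "finite {D \<in> S. x \<in> D}" using assms(1) by simp
  obtain D where D: "D \<in> S" "x \<in> D" and min: "\<forall>E\<in>{D \<in> S. x \<in> D}. E \<subseteq> D \<longrightarrow> D = E"
    using finite_has_minimal2[OF fin, of C] assms(4,5) by auto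
  have "x \<in> rel_interior D"
  proof (rule ccontr)
    assume "x \<notin> rel_interior D"
    then have "x \<in> D - rel_interior D" using D by blast
    also have "\<dots> = \<Union>{F. F facet_of D}"
      using D assms(2) by (intro rel_boundary_of_polyhedron polytope_imp_polyhedron)
    finally obtain F where F: "F facet_of D" "x \<in> F" by blast
    then have "F face_of D" "F \<noteq> D" by (auto simp: facet_of_imp_face_of)
    then have "F \<in> S" "F \<subseteq> D" using assms(3) D face_of_imp_subset by blast+
    then show False using min F(2) \<open>F \<noteq> D\<close> by blast
  qed
  then show ?thesis using that D by blast
qed

text \<open>A point outside the simplex \<sigma> has a negative barycentric coordinate at some
  vertex \<open>e\<close>, so the hyperplane of the facet opposite to \<open>e\<close> separates it
  from \<sigma>. By \<open>facet_hyperplane_cuts_no_cell\<close> this hyperplane cuts no cell of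
  \<open>T\<close> and thus defines a split.\<close>

lemma separating_split:
  assumes P: "polytope P" and circ: "circuits_le_4 (vertices P)" and T: "triangulation_of P T"
    and \<sigma>: "\<sigma> \<in> T" "aff_dim \<sigma> = aff_dim P" and x: "x \<in> P" "x \<notin> \<sigma>"
  obtains S h c where "split_of P S" "\<forall>C\<in>T. \<exists>D\<in>S. C \<subseteq> D"
    "\<forall>D\<in>S. D \<subseteq> {x. h \<bullet> x \<le> c} \<or> D \<subseteq> {x. h \<bullet> x \<ge> c}"
    "\<sigma> \<subseteq> {x. h \<bullet> x \<ge> c}" "h \<bullet> x < c"
proof -
  obtain E where E: "\<not> affine_dependent E" "\<sigma> = convex hull E" "E \<subseteq> vertices P"
    by (rule triangulation_simplex[OF T \<sigma>(1)])
  have finE: "finite E" using E(1) aff_independent_finite by blast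
  have \<sigma>P: "\<sigma> \<subseteq> P" using T \<sigma> by (auto simp: triangulation_of_def subdivision_def)
  have hull: "affine hull \<sigma> = affine hull P"
    using aff_dim_eq_full_gen[OF \<sigma>P] \<sigma>(2) by simp
  then have PE: "P \<subseteq> affine hull E" using E(2) hull_subset by (metis affine_hull_convex_hull)
  then obtain u where u: "sum u E = 1" "(\<Sum>v\<in>E. u v *\<^sub>R v) = x"
    using x unfolding affine_hull_finite[OF finE] by blast
  have "\<exists>e\<in>E. u e < 0"
  proof (rule ccontr)
    assume "\<not> ?thesis"
    then have "\<forall>v\<in>E. 0 \<le> u v" by (simp add: not_less)
    then have "x \<in> convex hull E" unfolding convex_hull_finite[OF finE] using u by blast
    then show False using x E by simp
  qed
  then obtain e where e: "e \<in> E" "u e < 0" by blast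
  \<comment> \<open>This functional is the barycentric coordinate at \<open>e\<close>.\<close>
  obtain h c0 where hc: "\<And>v. v \<in> E \<Longrightarrow> c0 + h \<bullet> v = (if v = e then 1 else 0)"
    using affine_interpolation[OF E(1), of "\<lambda>v. if v = e then 1 else 0"] by blast
  define c where "c = - c0"
  have "c0 + h \<bullet> x = (\<Sum>v\<in>E. u v * (c0 + h \<bullet> v))"
    using affine_combination[of u c0 h E] u by simp
  also have "\<dots> = (\<Sum>v\<in>E. u v * (if v = e then 1 else 0))"
    using hc by (intro sum.cong) auto
  also have "\<dots> = u e" using finE e by (simp add: if_distrib cong: if_cong)
  finally have hx: "h \<bullet> x < c" using e by (simp add: c_def)
  have hE: "h \<bullet> v = c" if "v \<in> E - {e}" for v using hc[of v] that by (simp add: c_def)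
  have he: "h \<bullet> e > c" using hc[OF e(1)] by (simp add: c_def)
  have uncut: "\<tau> \<subseteq> {x. h \<bullet> x \<le> c} \<or> \<tau> \<subseteq> {x. h \<bullet> x \<ge> c}" if \<tau>: "\<tau> \<in> T" for \<tau>
  proof (rule ccontr)
    assume "\<not> ?thesis"
    then obtain y z where "y \<in> \<tau>" "h \<bullet> y < c" "z \<in> \<tau>" "h \<bullet> z > c" by force
    then show False
      using facet_hyperplane_cuts_no_cell[OF P circ T _ E(1,3) PE e(1) hE \<tau>] \<sigma>(1) E(2) by blast
  qed
  define S where "S = {F. F face_of P \<inter> {x. h \<bullet> x \<le> c}} \<union> {F. F face_of P \<inter> {x. h \<bullet> x \<ge> c}}"
  have convP: "convex P" using P by (rule polytope_imp_convex)
  show ?thesis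
  proof
    have "vertices (P \<inter> {x. h \<bullet> x \<le> c}) \<subseteq> vertices P"
      by (rule uncut_halfspace[OF P T uncut])
    moreover have "vertices (P \<inter> {x. (- h) \<bullet> x \<le> - c}) \<subseteq> vertices P"
      by (rule uncut_halfspace[OF P T]) (use uncut in auto)
    moreover have "{x. (- h) \<bullet> x \<le> - c} = {x. h \<bullet> x \<ge> c}" by auto
    moreover have "e \<in> P" using e E by (auto simp: vertices_def extreme_point_of_def)
    ultimately show "split_of P S" unfolding S_def
      using he hx x by (intro halfspace_split[OF P]) auto
    show "\<forall>C\<in>T. \<exists>D\<in>S. C \<subseteq> D"
    proof
      fix C assume C: "C \<in> T"
      then have "C \<subseteq> P" using T by (auto simp: triangulation_of_def subdivision_def)
      moreover have "P \<inter> {x. h \<bullet> x \<le> c} \<in> S" "P \<inter> {x. h \<bullet> x \<ge> c} \<in> S"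
        by (auto simp: S_def face_of_refl_eq convP convex_Int convex_halfspace_le convex_halfspace_ge)
      ultimately show "\<exists>D\<in>S. C \<subseteq> D" using uncut[OF C] by blast
    qed
    show "\<forall>D\<in>S. D \<subseteq> {x. h \<bullet> x \<le> c} \<or> D \<subseteq> {x. h \<bullet> x \<ge> c}"
      unfolding S_def using face_of_imp_subset by blast
    show "\<sigma> \<subseteq> {x. h \<bullet> x \<ge> c}"
      unfolding E(2) by (intro hull_minimal convex_halfspace_ge) (use hE he in force)
  qed (rule hx)
qed

lemma circuits_le_4_imp_split_triangulation:
  assumes P: "polytope P" "P \<noteq> {}" and circ: "circuits_le_4 (vertices P)" and T: "triangulation_of P T"
  shows "split_triangulation P T"
proof -
  \<comment> \<open>All splits that \<open>T\<close> refines. Taking every one of them makes each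
    split found by \<open>separating_split\<close> available.\<close>
  define \<S> where "\<S> = {S. split_of P S \<and> (\<forall>C\<in>T. \<exists>D\<in>S. C \<subseteq> D)}"
  have convP: "convex P" using P(1) by (rule polytope_imp_convex)
  have subT: "subdivision P T" using T by (simp add: triangulation_of_def)
  have sub: "subdivision P S" if "S \<in> \<S>" for S using that by (simp add: \<S>_def split_of_def)
  have cell: "convex D" "polytope D" "D \<subseteq> P" if "subdivision P S" "D \<in> S" for S D
    using that polytope_imp_convex by (auto simp: subdivision_def)
  have inter: "C \<inter> D face_of C" "C \<inter> D face_of D" if "subdivision P S" "C \<in> S" "D \<in> S" for S C D
    using that by (auto simp: subdivision_def)
  have fin\<S>: "finite \<S>"
  proof -
    have "\<S> \<subseteq> Pow ((\<lambda>E. convex hull E) ` Pow (vertices P))"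
    proof clarify
      fix S D assume S: "S \<in> \<S>" and D: "D \<in> S"
      then have "vertices D \<in> Pow (vertices P)" using sub[OF S] by (auto simp: subdivision_def)
      moreover have "convex hull (vertices D) = D"
        using cell(2)[OF sub[OF S] D] by (rule convex_hull_vertices)
      ultimately show "D \<in> (\<lambda>E. convex hull E) ` Pow (vertices P)" by (metis imageI)
    qed
    then show ?thesis by (rule finite_subset) (simp add: finite_vertices[OF P(1)])
  qed
  have refined: "F \<inter> (\<Inter>S\<in>\<S>. f S) \<in> T" if F: "F face_of P" and f: "\<forall>S\<in>\<S>. f S \<in> S" for F f
  proof (cases "F \<inter> (\<Inter>S\<in>\<S>. f S) = {}")
    case True
    \<comment> \<open>A nonempty \<open>P\<close> rules out the complex without any cell, which
      would lack the empty face.\<close>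
    have "T \<noteq> {}" using subT P by (auto simp: subdivision_def)
    then show ?thesis using subT True empty_face_of by (auto simp: subdivision_def)
  next
    case False
    define K where "K = F \<inter> (\<Inter>S\<in>\<S>. f S)"
    have convK: "convex K" unfolding K_def
      using F f cell(1)[OF sub] by (intro convex_Int convex_INT) (auto simp: face_of_imp_convex)
    then obtain x where x: "x \<in> rel_interior K"
      using False rel_interior_eq_empty K_def by blast
    have xK: "x \<in> K" using x rel_interior_subset by blast
    have KP: "K \<subseteq> P" using F face_of_imp_subset by (auto simp: K_def)
    have "\<Union>{C \<in> T. aff_dim C = aff_dim P} = P"
      using subT cell[OF subT] convP
      by (intro convex_Union_fulldim_cells) (auto simp: subdivision_def polytope_imp_closed)
    then obtain \<sigma> where \<sigma>: "\<sigma> \<in> T" "aff_dim \<sigma> = aff_dim P" "x \<in> \<sigma>" using xK KP by blast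
    \<comment> \<open>A point \<open>y\<close> of \<open>K\<close> outside \<sigma> would be cut off
      by a split in \<S>. The cell \<open>f S\<close> keeps \<open>K\<close> on the side of
      \<open>y\<close>, so \<open>x\<close>, which is in \<sigma>, lies on the hyperplane. But the
      segment from \<open>y\<close> can be prolonged beyond \<open>x\<close> inside
      \<open>K\<close>, and it crosses.\<close>
    have "K \<subseteq> \<sigma>"
    proof
      fix y assume y: "y \<in> K"
      show "y \<in> \<sigma>"
      proof (rule ccontr)
        assume "y \<notin> \<sigma>"
        then obtain S h c where S: "split_of P S" "\<forall>C\<in>T. \<exists>D\<in>S. C \<subseteq> D"
            "\<forall>D\<in>S. D \<subseteq> {x. h \<bullet> x \<le> c} \<or> D \<subseteq> {x. h \<bullet> x \<ge> c}"
            "\<sigma> \<subseteq> {x. h \<bullet> x \<ge> c}" "h \<bullet> y < c"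
          using separating_split[OF P(1) circ T \<sigma>(1,2), of y] y KP by blast
        then have "S \<in> \<S>" by (simp add: \<S>_def)
        then have "f S \<in> S" "K \<subseteq> f S" using f by (auto simp: K_def)
        then have K: "K \<subseteq> {x. h \<bullet> x \<le> c}" using S(3,5) y by fastforce
        then have hx: "h \<bullet> x = c" using xK S(4) \<sigma>(3) by fastforce
        obtain e where e: "e > 1" "(1 - e) *\<^sub>R y + e *\<^sub>R x \<in> K"
          using x y convex_rel_interior_iff[OF convK] xK by blast
        have "h \<bullet> ((1 - e) *\<^sub>R y + e *\<^sub>R x) = c + (e - 1) * (c - h \<bullet> y)"
          by (simp add: inner_simps hx algebra_simps)
        moreover have "(e - 1) * (c - h \<bullet> y) > 0" using e S by simp
        ultimately show False using K e(2) by fastforce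
      qed
    qed
    \<comment> \<open>Every split in \<S> has a cell \<open>D\<close> containing \<sigma>, so
      slicing the face \<open>f S \<inter> D\<close> of \<open>D\<close> by \<sigma> gives a face of
      \<sigma>. \<open>K\<close> is an intersection of such faces.\<close>
    have "f S \<inter> \<sigma> face_of \<sigma>" if S: "S \<in> \<S>" for S
    proof -
      obtain D where D: "D \<in> S" "\<sigma> \<subseteq> D" using S \<sigma> by (auto simp: \<S>_def)
      have "f S \<inter> D face_of D" using inter(2)[OF sub[OF S] _ D(1)] f S by blast
      then have "f S \<inter> D \<inter> \<sigma> face_of D \<inter> \<sigma>"
        using cell(1)[OF subT \<sigma>(1)] by (rule face_of_slice)
      moreover have "f S \<inter> D \<inter> \<sigma> = f S \<inter> \<sigma>" "D \<inter> \<sigma> = \<sigma>" using D by auto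
      ultimately show ?thesis by simp
    qed
    moreover have "F \<inter> \<sigma> face_of \<sigma>"
    proof -
      have "F \<inter> \<sigma> face_of P \<inter> \<sigma>" using F cell(1)[OF subT \<sigma>(1)] by (rule face_of_slice)
      then show ?thesis using cell(3)[OF subT \<sigma>(1)] by (simp add: Int_absorb1)
    qed
    ultimately have "\<Inter>(insert (F \<inter> \<sigma>) ((\<lambda>S. f S \<inter> \<sigma>) ` \<S>)) face_of \<sigma>"
      by (intro face_of_Inter) auto
    moreover have "\<Inter>(insert (F \<inter> \<sigma>) ((\<lambda>S. f S \<inter> \<sigma>) ` \<S>)) = K"
      using \<open>K \<subseteq> \<sigma>\<close> by (auto simp: K_def)
    ultimately show ?thesis using subT \<sigma>(1) by (auto simp: subdivision_def K_def)
  qed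
  have "\<tau> \<in> common_refinement P \<S>" if \<tau>: "\<tau> \<in> T" for \<tau>
  proof -
    have "\<forall>S\<in>\<S>. \<exists>D. D \<in> S \<and> \<tau> \<subseteq> D" using \<tau> by (auto simp: \<S>_def)
    then obtain g where g: "\<And>S. S \<in> \<S> \<Longrightarrow> g S \<in> S" "\<And>S. S \<in> \<S> \<Longrightarrow> \<tau> \<subseteq> g S" by metis
    show ?thesis
    proof (cases "\<tau> = {}")
      case True
      then have "\<tau> = {} \<inter> (\<Inter>S\<in>\<S>. g S)" by simp
      then show ?thesis unfolding common_refinement_def using g(1) empty_face_of by blast
    next
      case False
      have conv\<tau>: "convex \<tau>" using cell(1)[OF subT \<tau>] .
      then obtain x where x: "x \<in> rel_interior \<tau>" using False rel_interior_eq_empty by blast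
      have x\<tau>: "x \<in> \<tau>" using x rel_interior_subset by blast
      \<comment> \<open>\<open>F\<close> and the cells \<open>f S\<close> are chosen with
        \<open>x\<close> in their relative interiors. Then \<open>x\<close> is in the relative
        interior of their intersection \<open>K\<close>, which is a cell of \<open>T\<close> having
        \<tau> as a face; a face through such a point is all of \<open>K\<close>.\<close>
      obtain F where F: "F face_of P" "x \<in> rel_interior F"
      proof (rule rel_interior_cell_exists[of "{F. F face_of P}" P x])
        show "x \<in> P" using x\<tau> cell(3)[OF subT \<tau>] by blast
      qed (use P convP in \<open>auto simp: finite_polytope_faces face_of_refl dest: face_of_polytope_polytope face_of_trans\<close>)
      have "\<exists>D. D \<in> S \<and> x \<in> rel_interior D" if S: "S \<in> \<S>" for S
      proof -
        have "x \<in> g S" using g(2)[OF S] x\<tau> by blast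
        then show ?thesis
          using rel_interior_cell_exists[of S "g S" x] g(1)[OF S] sub[OF S]
          unfolding subdivision_def by metis
      qed
      then obtain f where f: "\<And>S. S \<in> \<S> \<Longrightarrow> f S \<in> S" "\<And>S. S \<in> \<S> \<Longrightarrow> x \<in> rel_interior (f S)"
        by metis
      define K where "K = F \<inter> (\<Inter>S\<in>\<S>. f S)"
      have KT: "K \<in> T" unfolding K_def using refined F f by blast
      have "\<tau> \<subseteq> F"
        using subset_of_face_of[OF F(1) cell(3)[OF subT \<tau>]] x F(2) rel_interior_subset by blast
      moreover have "\<tau> \<subseteq> f S" if S: "S \<in> \<S>" for S
      proof -
        have "f S \<inter> g S face_of g S" using inter(2)[OF sub[OF S]] f(1) g(1) S by blast
        moreover have "x \<in> f S" using f(2)[OF S] rel_interior_subset by blast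
        ultimately have "\<tau> \<subseteq> f S \<inter> g S"
          using subset_of_face_of[of "f S \<inter> g S" "g S" \<tau>] g(2)[OF S] x x\<tau> by blast
        then show ?thesis by blast
      qed
      ultimately have "\<tau> \<subseteq> K" by (auto simp: K_def)
      have "rel_interior (\<Inter>(insert F (f ` \<S>))) = \<Inter>(rel_interior ` insert F (f ` \<S>))"
      proof (rule convex_rel_interior_finite_Inter)
        show "convex C" if "C \<in> insert F (f ` \<S>)" for C
          using that F(1) face_of_imp_convex cell(1)[OF sub] f(1) by blast
        show "\<Inter>(rel_interior ` insert F (f ` \<S>)) \<noteq> {}" using F(2) f(2) by blast
      qed (use fin\<S> in simp)
      moreover have "x \<in> \<Inter>(rel_interior ` insert F (f ` \<S>))" using F(2) f(2) by blast
      moreover have "\<Inter>(insert F (f ` \<S>)) = K" by (auto simp: K_def)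
      ultimately have "x \<in> rel_interior K" by simp
      moreover have "\<tau> face_of K" using inter(2)[OF subT \<tau> KT] \<open>\<tau> \<subseteq> K\<close> by (simp add: Int_absorb2)
      ultimately have "K \<subseteq> \<tau>" using subset_of_face_of[of \<tau> K K] x\<tau> by blast
      then have "\<tau> = K" using \<open>\<tau> \<subseteq> K\<close> by blast
      then show ?thesis unfolding common_refinement_def K_def using F(1) f(1) by blast
    qed
  qed
  then have "T = common_refinement P \<S>"
    using refined by (auto simp: common_refinement_def)
  then show ?thesis
    unfolding split_triangulation_def using T by (intro conjI exI[of _ \<S>]) (auto simp: \<S>_def)
qed

section \<open>The oriented matroid determines the circuits\<close>

lemma covectors_eq:
  fixes P :: "'a::euclidean_space set"
  shows "covectors P = {(\<lambda>v. if v \<in> vertices P then sgn (c + h \<bullet> v) else 0) | c h. True}"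
proof (intro set_eqI iffI)
  fix X assume "X \<in> covectors P"
  then obtain a :: "real \<times> 'a \<Rightarrow> real" where a: "linear a"
    and X: "X = (\<lambda>v. if v \<in> vertices P then sgn (a (1, v)) else 0)"
    by (auto simp: covectors_def)
  define h where "h = snd (adjoint a 1)"
  define c where "c = fst (adjoint a 1)"
  have "a (1, v) = c + h \<bullet> v" for v
    using adjoint_works[OF a, of "(1, v)" 1] by (simp add: h_def c_def inner_prod_def inner_commute)
  then have "X = (\<lambda>v. if v \<in> vertices P then sgn (c + h \<bullet> v) else 0)" using X by (simp cong: if_cong)
  then show "X \<in> {(\<lambda>v. if v \<in> vertices P then sgn (c + h \<bullet> v) else 0) | c h. True}"
    by blast
next
  fix X assume "X \<in> {(\<lambda>v. if v \<in> vertices P then sgn (c + h \<bullet> v) else 0) | c h. True}"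
  then obtain c h where X: "X = (\<lambda>v. if v \<in> vertices P then sgn (c + h \<bullet> v) else 0)" by blast
  have "linear (\<lambda>z. (c, h) \<bullet> z)" by (rule bounded_linear.linear[OF bounded_linear_inner_right])
  moreover have "X = (\<lambda>v. if v \<in> vertices P then sgn ((c, h) \<bullet> (1, v)) else 0)"
    by (simp add: X inner_prod_def cong: if_cong)
  ultimately show "X \<in> covectors P" unfolding covectors_def by blast
qed

text \<open>Evaluating a dependency on the functional attached to \<open>v\<close> leaves only the
  coefficient of \<open>v\<close>: the functionals act as a dual basis.\<close>

lemma affine_independentI:
  fixes D :: "'a::euclidean_space set"
  assumes "finite D" "\<And>v. v \<in> D \<Longrightarrow> \<exists>c h. c + h \<bullet> v \<noteq> 0 \<and> (\<forall>u\<in>D-{v}. c + h \<bullet> u = 0)"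
  shows "\<not> affine_dependent D"
proof
  assume "affine_dependent D"
  then obtain l v where l: "sum l D = 0" "(\<Sum>v\<in>D. l v *\<^sub>R v) = 0" "v \<in> D" "l v \<noteq> 0"
    unfolding affine_dependent_explicit_finite[OF assms(1)] by blast
  obtain c h where ch: "c + h \<bullet> v \<noteq> 0" "\<forall>u\<in>D-{v}. c + h \<bullet> u = 0" using assms(2)[OF l(3)] by blast
  have "0 = (\<Sum>u\<in>D. l u * (c + h \<bullet> u))" using affine_dependency_eval[OF l(1,2)] by simp
  also have "\<dots> = l v * (c + h \<bullet> v)"
    using ch(2) assms(1) l(3) by (subst sum.remove[of D v]) auto
  finally show False using l ch by simp
qed

text \<open>The support is minimised only among functionals that vanish on \<open>D - {v}\<close>
  but not at \<open>v\<close>. A smaller nonempty support omitting \<open>v\<close> is excluded by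
  elimination: subtracting a multiple of that functional removes a further point \<open>u\<close>
  and keeps the value at \<open>v\<close>.\<close>

lemma cocircuit_through:
  fixes P :: "'a::euclidean_space set"
  assumes fin: "finite (vertices P)" and D: "D \<subseteq> vertices P" "\<not> affine_dependent D" "v \<in> D"
  obtains Y where "Y \<in> cocircuits P" "Y v \<noteq> 0" "\<forall>u\<in>D-{v}. Y u = 0"
proof -
  define V where "V = vertices P"
  define supp where "supp = (\<lambda>ch :: real \<times> 'a. {u \<in> V. fst ch + snd ch \<bullet> u \<noteq> 0})"
  define good where "good = (\<lambda>ch. v \<in> supp ch \<and> supp ch \<inter> (D - {v}) = {})"
  have finV: "finite V" using fin by (simp add: V_def)
  obtain c0 h0 where "\<And>x. x \<in> D \<Longrightarrow> c0 + h0 \<bullet> x = (if x = v then 1 else 0)"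
    using affine_interpolation[OF D(2), of "\<lambda>x. if x = v then 1 else 0"] by metis
  then have "good (c0, h0)" using D by (auto simp: good_def supp_def V_def split: if_splits)
  then obtain ch where ch: "good ch" and min: "\<And>ch'. good ch' \<Longrightarrow> card (supp ch) \<le> card (supp ch')"
    using ex_has_least_nat[of good "(c0, h0)" "\<lambda>ch. card (supp ch)"] by blast
  define cov where "cov = (\<lambda>(c, h :: 'a) v. if v \<in> V then sgn (c + h \<bullet> v) else 0)"
  have cov: "covectors P = range cov"
    by (auto simp: covectors_eq cov_def V_def image_def)
  have ss: "sign_support (cov ch) = supp ch" for ch
    by (auto simp: sign_support_def cov_def supp_def sgn_zero_iff split: prod.splits)
  have min': "\<not> supp ch' \<subset> supp ch" if "good ch'" for ch'
  proof
    assume "supp ch' \<subset> supp ch"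
    moreover have "finite (supp ch)" using finV by (simp add: supp_def)
    ultimately have "card (supp ch') < card (supp ch)" by (rule psubset_card_mono[rotated])
    then show False using min[OF that] by simp
  qed
  have "cov ch \<in> cocircuits P"
    unfolding cocircuits_def mem_Collect_eq
  proof (intro conjI ballI impI)
    show "cov ch \<in> covectors P" using cov by blast
    show "sign_support (cov ch) \<noteq> {}" using ch ss by (auto simp: good_def)
    fix Y assume "Y \<in> covectors P" and Ys: "sign_support Y \<noteq> {} \<and> sign_support Y \<subseteq> sign_support (cov ch)"
    then obtain ch' where Y: "Y = cov ch'" using cov by blast
    have sub: "supp ch' \<subseteq> supp ch" "supp ch' \<noteq> {}" using Ys ss Y by auto
    show "sign_support Y = sign_support (cov ch)"
    proof (cases "v \<in> supp ch'")
      case True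
      then have "good ch'" using ch sub by (auto simp: good_def)
      then show ?thesis using min'[of ch'] sub ss Y by blast
    next
      case False
      obtain u where u: "u \<in> supp ch'" using sub by blast
      define t where "t = (fst ch + snd ch \<bullet> u) / (fst ch' + snd ch' \<bullet> u)"
      define ch'' where "ch'' = (fst ch - t * fst ch', snd ch - t *\<^sub>R snd ch')"
      have eq: "fst ch'' + snd ch'' \<bullet> x = (fst ch + snd ch \<bullet> x) - t * (fst ch' + snd ch' \<bullet> x)" for x
        by (simp add: ch''_def inner_diff_left algebra_simps)
      have "supp ch'' \<subseteq> supp ch" unfolding supp_def eq using sub by (auto simp: supp_def)
      moreover have "u \<notin> supp ch''" using u unfolding supp_def eq by (simp add: t_def)
      moreover have "u \<in> supp ch" using u sub by blast
      moreover have "v \<in> supp ch''" using ch False unfolding good_def supp_def eq by auto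
      ultimately have "good ch''" "supp ch'' \<subset> supp ch" using ch by (auto simp: good_def)
      then show ?thesis using min' by blast
    qed
  qed
  moreover have "cov ch v \<noteq> 0" "\<forall>u\<in>D-{v}. cov ch u = 0"
    using ch ss[of ch] by (auto simp: good_def sign_support_def)
  ultimately show ?thesis using that by blast
qed

text \<open>Cocircuits serve as the dual functionals of \<open>affine_independentI\<close>. The
  right-hand side mentions no coordinates, so affine dependence becomes an invariant of the oriented
  matroid.\<close>

lemma affine_independent_iff_cocircuits:
  assumes P: "polytope P" and D: "D \<subseteq> vertices P"
  shows "\<not> affine_dependent D \<longleftrightarrow> (\<forall>v\<in>D. \<exists>Y\<in>cocircuits P. Y v \<noteq> 0 \<and> (\<forall>u\<in>D-{v}. Y u = 0))"
proof
  assume "\<not> affine_dependent D"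
  then show "\<forall>v\<in>D. \<exists>Y\<in>cocircuits P. Y v \<noteq> 0 \<and> (\<forall>u\<in>D-{v}. Y u = 0)"
    using cocircuit_through[OF finite_vertices[OF P] D] by metis
next
  assume *: "\<forall>v\<in>D. \<exists>Y\<in>cocircuits P. Y v \<noteq> 0 \<and> (\<forall>u\<in>D-{v}. Y u = 0)"
  show "\<not> affine_dependent D"
  proof (rule affine_independentI)
    show "finite D" by (rule finite_subset[OF D finite_vertices[OF P]])
    fix v assume v: "v \<in> D"
    then obtain Y where Y: "Y \<in> cocircuits P" "Y v \<noteq> 0" "\<forall>u\<in>D-{v}. Y u = 0" using * by blast
    then have "Y \<in> covectors P" by (simp add: cocircuits_def)
    then obtain c h where ch: "Y = (\<lambda>v. if v \<in> vertices P then sgn (c + h \<bullet> v) else 0)"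
      by (auto simp: covectors_eq)
    have "c + h \<bullet> v \<noteq> 0" using Y(2) by (metis ch sgn_0)
    moreover have "c + h \<bullet> u = 0" if "u \<in> D - {v}" for u
    proof -
      have "u \<in> vertices P" "Y u = 0" using that D Y by auto
      then show ?thesis by (simp add: ch sgn_zero_iff)
    qed
    ultimately show "\<exists>c h. c + h \<bullet> v \<noteq> 0 \<and> (\<forall>u\<in>D-{v}. c + h \<bullet> u = 0)" by blast
  qed
qed

lemma same_oriented_matroid_circuits:
  assumes P: "polytope P" and Q: "polytope Q" and same: "same_oriented_matroid P Q"
    and circ: "circuits_le_4 (vertices Q)"
  shows "circuits_le_4 (vertices P)"
proof -
  obtain f where f: "bij_betw f (vertices P) (vertices Q)"
    and coc: "cocircuits P = (\<lambda>Y v. if v \<in> vertices P then Y (f v) else 0) ` cocircuits Q"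
    using same by (auto simp: same_oriented_matroid_def)
  have inj: "inj_on f (vertices P)" and img: "f ` vertices P = vertices Q"
    using f by (auto simp: bij_betw_def)
  have dep: "affine_dependent D \<longleftrightarrow> affine_dependent (f ` D)" if D: "D \<subseteq> vertices P" for D
  proof -
    have fD: "f ` D \<subseteq> vertices Q" using D img by blast
    have "(\<exists>Y\<in>cocircuits P. Y v \<noteq> 0 \<and> (\<forall>u\<in>D-{v}. Y u = 0)) \<longleftrightarrow>
        (\<exists>Y\<in>cocircuits Q. Y (f v) \<noteq> 0 \<and> (\<forall>u\<in>f ` D-{f v}. Y u = 0))" if v: "v \<in> D" for v
    proof -
      have "f ` D - {f v} = f ` (D - {v})"
        using inj_on_image_set_diff[OF inj, of D "{v}"] D v by auto
      moreover have "w \<in> vertices P" if "w \<in> D" for w using that D by blast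
      ultimately show ?thesis unfolding coc using v by simp
    qed
    then have "(\<forall>v\<in>D. \<exists>Y\<in>cocircuits P. Y v \<noteq> 0 \<and> (\<forall>u\<in>D-{v}. Y u = 0)) \<longleftrightarrow>
        (\<forall>w\<in>f ` D. \<exists>Y\<in>cocircuits Q. Y w \<noteq> 0 \<and> (\<forall>u\<in>f ` D-{w}. Y u = 0))" by simp
    then show ?thesis
      unfolding affine_independent_iff_cocircuits[OF P D, symmetric]
        affine_independent_iff_cocircuits[OF Q fD, symmetric] by simp
  qed
  show ?thesis
    unfolding circuits_le_4_def
  proof (intro allI impI)
    fix D assume D: "D \<subseteq> vertices P" "affine_dependent D"
    then have "f ` D \<subseteq> vertices Q" "affine_dependent (f ` D)" using dep img by blast+
    then obtain E' where E': "E' \<subseteq> f ` D" "card E' \<le> 4" "affine_dependent E'"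
      by (rule circuits_le_4D[OF circ])
    then obtain E where E: "E \<subseteq> D" "E' = f ` E" by (meson subset_image_iff)
    then have "inj_on f E" using inj D inj_on_subset by (metis subset_trans)
    then have "card E' = card E" using E card_image by blast
    moreover have "affine_dependent E" using dep[of E] E E'(3) D by auto
    moreover have "card E \<le> 4" using \<open>card E' = card E\<close> E'(2) by simp
    ultimately show "\<exists>E\<subseteq>D. card E \<le> 4 \<and> affine_dependent E" using E(1) by blast
  qed
qed

section \<open>Circuits of the building blocks and their joins\<close>

lemma affine_dependent_image_iff:
  fixes h :: "'a::euclidean_space \<Rightarrow> 'b::euclidean_space"
  assumes h: "linear h" and inj: "inj_on (\<lambda>x. c + h x) (affine hull S)" and S: "finite S"
  shows "affine_dependent ((\<lambda>x. c + h x) ` S) \<longleftrightarrow> affine_dependent S"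
proof -
  define g where "g = (\<lambda>x. c + h x)"
  have injS: "inj_on g S" unfolding g_def by (rule inj_on_subset[OF inj hull_subset])
  have sumg: "sum l (g ` S) = (\<Sum>v\<in>S. l (g v))"
    "(\<Sum>w\<in>g ` S. l w *\<^sub>R w) = sum (\<lambda>v. l (g v)) S *\<^sub>R c + h (\<Sum>v\<in>S. l (g v) *\<^sub>R v)" for l
    using injS by (simp_all add: sum.reindex o_def g_def scaleR_add_right sum.distrib
        scaleR_left.sum linear_sum[OF h] linear_cmul[OF h])
  have "affine_dependent (g ` S) \<longleftrightarrow> affine_dependent S"
  proof
    assume "affine_dependent (g ` S)"
    then obtain l where l: "sum l (g ` S) = 0" "\<exists>w\<in>g ` S. l w \<noteq> 0" "(\<Sum>w\<in>g ` S. l w *\<^sub>R w) = 0"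
      using affine_dependent_explicit_finite[of "g ` S"] S by auto
    define m where "m = (\<lambda>v. l (g v))"
    have m: "sum m S = 0" "h (\<Sum>v\<in>S. m v *\<^sub>R v) = 0" "\<exists>v\<in>S. m v \<noteq> 0"
      using l by (auto simp: sumg m_def)
    obtain p where p: "p \<in> S" using m(3) by blast
    \<comment> \<open>The vector \<open>\<Sum>v\<in>S. m v *\<^sub>R v\<close> is in the kernel of
      \<open>h\<close>, and adding it to \<open>p\<close> does not leave the affine hull. So
      injectivity on the hull forces it to be 0.\<close>
    define q where "q = p + (\<Sum>v\<in>S. m v *\<^sub>R v)"
    have "q = (\<Sum>v\<in>S. (m v + (if v = p then 1 else 0)) *\<^sub>R v)"
      using S p by (simp add: q_def scaleR_add_left sum.distrib if_distrib[of "\<lambda>r. r *\<^sub>R _"] add.commute cong: if_cong)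
    moreover have "(\<Sum>v\<in>S. m v + (if v = p then 1 else 0)) = 1"
      using S p m(1) by (simp add: sum.distrib)
    ultimately have "q \<in> affine hull S" unfolding affine_hull_finite[OF S] by blast
    moreover have "g q = g p" using m(2) by (simp add: g_def q_def linear_add[OF h])
    ultimately have "q = p" using inj hull_inc[OF p] by (auto simp: g_def inj_on_def)
    then show "affine_dependent S"
      unfolding affine_dependent_explicit_finite[OF S] using m by (intro exI[of _ m]) (auto simp: q_def)
  next
    assume "affine_dependent S"
    then obtain m where m: "sum m S = 0" "\<exists>v\<in>S. m v \<noteq> 0" "(\<Sum>v\<in>S. m v *\<^sub>R v) = 0"
      unfolding affine_dependent_explicit_finite[OF S] by blast
    define l where "l = (\<lambda>w. m (inv_into S g w))"
    have lg: "l (g v) = m v" if "v \<in> S" for v using injS that by (simp add: l_def)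
    then have "sum l (g ` S) = 0" "(\<Sum>w\<in>g ` S. l w *\<^sub>R w) = 0"
      using m by (simp_all add: sumg linear_0[OF h])
    moreover have "\<exists>w\<in>g ` S. l w \<noteq> 0" using m lg by auto
    ultimately show "affine_dependent (g ` S)"
      using affine_dependent_explicit_finite[of "g ` S"] S by blast
  qed
  then show ?thesis by (simp add: g_def)
qed

lemma affine_image_convex_hull:
  assumes "linear h"
  shows "(\<lambda>x. c + h x) ` (convex hull S) = convex hull ((\<lambda>x. c + h x) ` S)"
proof -
  have "(+) c ` h ` (convex hull S) = convex hull ((+) c ` h ` S)"
    by (simp only: convex_hull_linear_image[OF assms] convex_hull_translation)
  then show ?thesis by (simp add: image_image)
qed

lemma circuits_le_4_affine_image:
  fixes h :: "'a::euclidean_space \<Rightarrow> 'b::euclidean_space"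
  assumes h: "linear h" and inj: "inj_on (\<lambda>x. c + h x) (affine hull W)" and fin: "finite W"
    and circ: "circuits_le_4 W"
  shows "circuits_le_4 ((\<lambda>x. c + h x) ` W)"
  unfolding circuits_le_4_def
proof (intro allI impI)
  have dep: "affine_dependent ((\<lambda>x. c + h x) ` S) \<longleftrightarrow> affine_dependent S" if "S \<subseteq> W" for S
    using that fin
    by (intro affine_dependent_image_iff[OF h] inj_on_subset[OF inj] hull_mono) (auto intro: finite_subset)
  fix D assume D: "D \<subseteq> (\<lambda>x. c + h x) ` W" "affine_dependent D"
  then obtain D0 where D0: "D0 \<subseteq> W" "D = (\<lambda>x. c + h x) ` D0" by (meson subset_image_iff)
  then have "affine_dependent D0" using D dep by blast
  with D0(1) obtain E where E: "E \<subseteq> D0" "card E \<le> 4" "affine_dependent E"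
    by (rule circuits_le_4D[OF circ])
  have "finite E" using E D0 fin by (meson finite_subset)
  then have "card ((\<lambda>x. c + h x) ` E) \<le> 4" using card_image_le E(2) le_trans by blast
  moreover have "affine_dependent ((\<lambda>x. c + h x) ` E)" using dep E D0 by (metis subset_trans)
  moreover have "(\<lambda>x. c + h x) ` E \<subseteq> D" using E D0 by blast
  ultimately show "\<exists>E\<subseteq>D. card E \<le> 4 \<and> affine_dependent E" by blast
qed

section \<open>Circuits of crosspolytopes and prisms\<close>

lemma affine_dependent_parallelogram:
  fixes x y z w :: "'a::euclidean_space"
  assumes "x + y = z + w" "x \<notin> {y, z, w}"
  shows "affine_dependent {x, y, z, w}"
proof -
  have "x = (- 1) *\<^sub>R y + 1 *\<^sub>R z + 1 *\<^sub>R w" using assms(1) by (simp add: algebra_simps)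
  moreover have "- 1 + 1 + 1 = (1 :: real)" by simp
  ultimately have "x \<in> affine hull {y, z, w}" unfolding affine_hull_3 by blast
  moreover have "{x, y, z, w} - {x} = {y, z, w}" using assms(2) by blast
  ultimately show ?thesis unfolding affine_dependent_def by (metis insertI1)
qed

text \<open>A set containing two full pairs contains a small dependent set. Any other set has at
  most one full pair and lies in a set of the form treated by \<open>indep\<close>. Crosspolytopes
  (antipodal pairs) and prisms (vertical edges) both fit.\<close>

lemma circuits_le_4_pairs:
  fixes x y :: "'i \<Rightarrow> 'a::euclidean_space"
  assumes dep: "\<And>i j. i \<in> I \<Longrightarrow> j \<in> I \<Longrightarrow> i \<noteq> j \<Longrightarrow> affine_dependent {x i, y i, x j, y j}"
    and indep: "\<And>k z. k \<in> I \<Longrightarrow> \<forall>i\<in>I. z i \<in> {x i, y i} \<Longrightarrow>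
      \<not> affine_dependent ({x k, y k} \<union> z ` (I - {k}))"
  shows "circuits_le_4 (x ` I \<union> y ` I)"
  unfolding circuits_le_4_def
proof (intro allI impI)
  fix D assume D: "D \<subseteq> x ` I \<union> y ` I" "affine_dependent D"
  show "\<exists>E\<subseteq>D. card E \<le> 4 \<and> affine_dependent E"
  proof (cases "\<exists>i\<in>I. \<exists>j\<in>I. i \<noteq> j \<and> {x i, y i, x j, y j} \<subseteq> D")
    case True
    then obtain i j where "i \<in> I" "j \<in> I" "i \<noteq> j" "{x i, y i, x j, y j} \<subseteq> D" by blast
    moreover have "card {x i, y i, x j, y j} \<le> 4"
      by (rule order_trans[OF card_insert_le_m1]) (auto intro!: card_insert_le_m1)
    ultimately show ?thesis using dep by blast
  next
    case False
    have "D \<noteq> {}" using D by auto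
    then obtain k0 where "k0 \<in> I" using D by blast
    then obtain k where k: "k \<in> I" "\<And>i. i \<in> I \<Longrightarrow> i \<noteq> k \<Longrightarrow> \<not> {x i, y i} \<subseteq> D"
      using False by (metis (no_types, lifting) insert_subset)
    \<comment> \<open>The element of the pair that is present in \<open>D\<close>; if neither is,
      \<open>y i\<close> is an arbitrary filler.\<close>
    define z where "z = (\<lambda>i. if x i \<in> D then x i else y i)"
    have "D \<subseteq> {x k, y k} \<union> z ` (I - {k})"
    proof
      fix p assume p: "p \<in> D"
      then obtain i where i: "i \<in> I" "p = x i \<or> p = y i" using D by blast
      show "p \<in> {x k, y k} \<union> z ` (I - {k})"
      proof (cases "i = k")
        case False
        then have "p = z i" using k(2)[OF i(1)] i(2) p by (auto simp: z_def)
        then show ?thesis using i False by blast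
      qed (use i in auto)
    qed
    moreover have "\<not> affine_dependent ({x k, y k} \<union> z ` (I - {k}))"
      by (rule indep[OF k(1)]) (simp add: z_def)
    ultimately show ?thesis using D affine_dependent_subset by blast
  qed
qed

lemma circuits_le_4_crosspolytope:
  fixes D :: "'a::euclidean_space set"
  assumes D: "D \<subseteq> Basis"
  shows "circuits_le_4 (D \<union> uminus ` D)"
proof -
  have finD: "finite D" using D finite_Basis by (rule finite_subset)
  have ip: "i \<bullet> j = (if i = j then 1 else 0)" if "i \<in> D" "j \<in> D" for i j
    using that D inner_not_same_Basis[of i j] inner_same_Basis[of i] by auto
  have neg: "i \<noteq> - j" if "i \<in> D" "j \<in> D" for i j
  proof
    assume "i = - j"
    then have "i \<bullet> i = - (j \<bullet> i)" by (metis inner_minus_left)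
    then show False using ip[OF that(1,1)] ip[OF that(2,1)] by (auto split: if_splits)
  qed
  have "circuits_le_4 ((\<lambda>i. i) ` D \<union> uminus ` D)"
  proof (rule circuits_le_4_pairs)
    fix i j assume ij: "i \<in> D" "j \<in> D" "i \<noteq> j"
    then show "affine_dependent {i, - i, j, - j}"
      using neg by (intro affine_dependent_parallelogram) auto
  next
    fix k z assume k: "k \<in> D" and z: "\<forall>i\<in>D. z i \<in> {i, - i}"
    define s where "s = (\<lambda>i. z i \<bullet> i)"
    have zs: "z i = s i *\<^sub>R i" "s i * s i = 1" if "i \<in> D" for i
      using z[rule_format, OF that] ip[OF that that] by (auto simp: s_def)
    have zip: "i \<bullet> z j = (if i = j then s i else 0)" if "i \<in> D" "j \<in> D" for i j
      using zs(1)[OF that(2)] ip[OF that] by simp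
    show "\<not> affine_dependent ({k, - k} \<union> z ` (D - {k}))"
    proof (rule affine_independentI)
      show "finite ({k, - k} \<union> z ` (D - {k}))" using finD by simp
      fix v assume v: "v \<in> {k, - k} \<union> z ` (D - {k})"
      show "\<exists>c h. c + h \<bullet> v \<noteq> 0 \<and> (\<forall>u\<in>({k, - k} \<union> z ` (D - {k})) - {v}. c + h \<bullet> u = 0)"
      proof (cases "v \<in> z ` (D - {k})")
        case True
        then obtain i where i: "i \<in> D" "i \<noteq> k" "v = z i" by blast
        have "i \<bullet> u = 0" if u: "u \<in> ({k, - k} \<union> z ` (D - {k})) - {v}" for u
        proof -
          consider "u = k" | "u = - k" | j where "j \<in> D" "u = z j" "j \<noteq> i" using u i by blast
          then show ?thesis
          proof cases
            case 3
            then show ?thesis using zip[OF i(1) 3(1)] by simp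
          qed (use ip[OF i(1) k] i in auto)
        qed
        moreover have "i \<bullet> v \<noteq> 0" using zip[OF i(1,1)] zs(2)[OF i(1)] i(3) by auto
        ultimately show ?thesis by (intro exI[of _ 0] exI[of _ i]) auto
      next
        case False
        define t :: real where "t = (if v = k then 1 else - 1)"
        have vt: "v = t *\<^sub>R k" "t * t = 1" using v False by (auto simp: t_def)
        \<comment> \<open>Designed so that \<open>1 + h \<bullet> u\<close> vanishes at
          \<open>- v\<close> and at every \<open>z j\<close>, where \<open>h\<close> takes the value
          -1, and equals 2 at \<open>v\<close>.\<close>
        define h where "h = t *\<^sub>R k - (\<Sum>i\<in>D-{k}. s i *\<^sub>R i)"
        have "(\<Sum>i\<in>D-{k}. s i *\<^sub>R i) \<bullet> k = 0"
          using ip k by (simp add: inner_sum_left)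
        then have hk: "h \<bullet> k = t" using ip[OF k k] by (simp add: h_def inner_diff_left)
        have hz: "h \<bullet> z j = - 1" if j: "j \<in> D" "j \<noteq> k" for j
        proof -
          have "(\<Sum>i\<in>D-{k}. s i *\<^sub>R i) \<bullet> z j = (\<Sum>i\<in>D-{k}. s i * (if i = j then s i else 0))"
            unfolding inner_sum_left using zip j by (intro sum.cong) auto
          also have "\<dots> = s j * s j" using finD j by (simp add: if_distrib cong: if_cong)
          finally show ?thesis using zs(2)[OF j(1)] zip[OF k j(1)] j by (simp add: h_def inner_diff_left)
        qed
        have "1 + h \<bullet> u = 0" if u: "u \<in> ({k, - k} \<union> z ` (D - {k})) - {v}" for u
        proof -
          consider "u = - v" | j where "j \<in> D" "u = z j" "j \<noteq> k" using u v False by auto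
          then show ?thesis
          proof cases
            case 1
            then show ?thesis using vt hk by simp
          qed (use hz in simp)
        qed
        moreover have "1 + h \<bullet> v \<noteq> 0" using vt hk by simp
        ultimately show ?thesis by blast
      qed
    qed
  qed
  then show ?thesis by simp
qed

lemma circuits_le_4_prism:
  fixes K :: "'a::euclidean_space set"
  assumes K: "\<not> affine_dependent K"
  shows "circuits_le_4 (K \<times> {0, 1 :: real})"
proof -
  have finK: "finite K" using K aff_independent_finite by blast
  have "circuits_le_4 ((\<lambda>i. (i, 0 :: real)) ` K \<union> (\<lambda>i. (i, 1)) ` K)"
  proof (rule circuits_le_4_pairs)
    fix i j assume ij: "i \<in> K" "j \<in> K" "i \<noteq> j"
    have "affine_dependent {(i, 0 :: real), (j, 1), (j, 0), (i, 1)}"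
      using ij by (intro affine_dependent_parallelogram) auto
    then show "affine_dependent {(i, 0 :: real), (i, 1), (j, 0), (j, 1)}"
      by (simp add: insert_commute)
  next
    fix k z assume k: "k \<in> K" and z: "\<forall>i\<in>K. z i \<in> {(i, 0 :: real), (i, 1)}"
    have fz: "fst (z i) = i" if "i \<in> K" for i using z that by force
    show "\<not> affine_dependent ({(k, 0), (k, 1)} \<union> z ` (K - {k}))"
    proof (rule affine_independentI)
      show "finite ({(k, 0), (k, 1)} \<union> z ` (K - {k}))" using finK by simp
      fix v assume v: "v \<in> {(k, 0), (k, 1)} \<union> z ` (K - {k})"
      show "\<exists>c h. c + h \<bullet> v \<noteq> 0 \<and> (\<forall>u\<in>({(k, 0), (k, 1)} \<union> z ` (K - {k})) - {v}. c + h \<bullet> u = 0)"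
      proof (cases "v \<in> z ` (K - {k})")
        case True
        then obtain i where i: "i \<in> K" "i \<noteq> k" "v = z i" by blast
        \<comment> \<open>The barycentric coordinate at \<open>i\<close> of the base point, constant
          along vertical edges.\<close>
        obtain a c where ac: "\<And>x. x \<in> K \<Longrightarrow> c + a \<bullet> x = (if x = i then 1 else 0)"
          using affine_interpolation[OF K, of "\<lambda>x. if x = i then 1 else 0"] by metis
        have val: "c + (a, 0) \<bullet> u = c + a \<bullet> fst u" for u :: "'a \<times> real" by (simp add: inner_prod_def)
        show ?thesis
        proof (intro exI conjI ballI)
          show "c + (a, 0) \<bullet> v \<noteq> 0" unfolding val using ac[OF i(1)] i fz by simp
          fix u assume "u \<in> {(k, 0), (k, 1)} \<union> z ` (K - {k}) - {v}"
          then have "fst u \<in> K" "fst u \<noteq> i" using k i fz by auto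
          then show "c + (a, 0) \<bullet> u = 0" unfolding val using ac by simp
        qed
      next
        case False
        \<comment> \<open>Heights of a hyperplane that is a graph over the base: it passes through
          all the chosen \<open>z x\<close> and, over \<open>k\<close>, through the end of the edge
          other than \<open>v\<close>.\<close>
        define r where "r = (\<lambda>x. if x = k then 1 - snd v else snd (z x))"
        obtain a c where ac: "\<And>x. x \<in> K \<Longrightarrow> c + a \<bullet> x = r x"
          using affine_interpolation[OF K, of r] by metis
        have val: "- c + (- a, 1) \<bullet> u = snd u - (c + a \<bullet> fst u)" for u :: "'a \<times> real"
          by (simp add: inner_prod_def)
        have vk: "v = (k, 0) \<or> v = (k, 1)" using v False by blast
        show ?thesis
        proof (intro exI conjI ballI)
          show "- c + (- a, 1) \<bullet> v \<noteq> 0" unfolding val using ac[OF k] vk by (auto simp: r_def)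
          fix u assume u: "u \<in> {(k, 0), (k, 1)} \<union> z ` (K - {k}) - {v}"
          show "- c + (- a, 1) \<bullet> u = 0"
          proof (cases "u \<in> z ` (K - {k})")
            case True
            then obtain j where "j \<in> K" "j \<noteq> k" "u = z j" by blast
            then show ?thesis unfolding val using ac[of j] fz by (simp add: r_def)
          next
            case False
            then show ?thesis unfolding val using ac[OF k] vk u by (auto simp: r_def)
          qed
        qed
      qed
    qed
  qed
  moreover have "(\<lambda>i. (i, 0 :: real)) ` K \<union> (\<lambda>i. (i, 1)) ` K = K \<times> {0, 1}" by auto
  ultimately show ?thesis by simp
qed

text \<open>The two parts of a dependency have opposite coefficient sums \<open>s\<close>,
  \<open>- s\<close> and opposite vectors \<open>d\<close>, \<open>- d\<close>. If \<open>s\<close>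
  is nonzero, \<open>d /\<^sub>R s\<close> lies in both subspaces; if \<open>s = 0\<close>, then
  \<open>d\<close> is a direction of both. Skewness excludes the first and gives
  \<open>d = 0\<close> in the second, so each part vanishes by itself.\<close>

lemma affine_independent_skew_Un:
  fixes A B :: "'a::euclidean_space set"
  assumes skew: "skew X Y" and X: "affine X" "A \<subseteq> X" and Y: "affine Y" "B \<subseteq> Y"
    and A: "\<not> affine_dependent A" and B: "\<not> affine_dependent B"
  shows "\<not> affine_dependent (A \<union> B)"
proof
  assume dep: "affine_dependent (A \<union> B)"
  have fin: "finite A" "finite B" using A B aff_independent_finite by auto
  have disj: "A \<inter> B = {}" using skew X Y by (auto simp: skew_def)
  obtain l where l: "sum l (A \<union> B) = 0" "\<exists>v\<in>A \<union> B. l v \<noteq> 0" "(\<Sum>v\<in>A \<union> B. l v *\<^sub>R v) = 0"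
    using dep affine_dependent_explicit_finite[of "A \<union> B"] fin by auto
  define s where "s = sum l A"
  define d where "d = (\<Sum>v\<in>A. l v *\<^sub>R v)"
  have sB: "sum l B = - s" using l(1) fin disj by (simp add: sum.union_disjoint s_def)
  have dB: "(\<Sum>v\<in>B. l v *\<^sub>R v) = - d"
    using l(3) fin disj by (simp add: sum.union_disjoint d_def eq_neg_iff_add_eq_0 add.commute)
  have comb: "(\<Sum>v\<in>S. u v *\<^sub>R v) \<in> Z" if "affine Z" "S \<subseteq> Z" "finite S" "sum u S = 1" for Z S u
    using that affine_hull_finite[OF that(3)] hull_minimal[of S Z affine] by blast
  show False
  proof (cases "s = 0")
    case False
    have "(\<Sum>v\<in>A. (l v / s) *\<^sub>R v) \<in> X"
      using False X fin by (intro comb) (simp_all add: s_def sum_divide_distrib[symmetric])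
    then have dX: "d /\<^sub>R s \<in> X" by (simp add: d_def scaleR_sum_right divide_inverse mult.commute)
    have "(\<Sum>v\<in>B. (- l v / s) *\<^sub>R v) \<in> Y"
      using False Y fin sB by (intro comb) (simp_all add: sum_divide_distrib[symmetric] sum_negf)
    moreover have "(\<Sum>v\<in>B. (- l v / s) *\<^sub>R v) = - (inverse s *\<^sub>R (\<Sum>v\<in>B. l v *\<^sub>R v))"
      by (simp add: scaleR_sum_right divide_inverse mult.commute sum_negf)
    ultimately have "d /\<^sub>R s \<in> Y" by (simp add: dB)
    then show False using dX skew by (auto simp: skew_def)
  next
    case True
    have diff: "\<exists>p q. e = p - q \<and> p \<in> Z \<and> q \<in> Z"
      if Z: "affine Z" "S \<subseteq> Z" "finite S" and u: "sum u S = 0" "(\<Sum>v\<in>S. u v *\<^sub>R v) = e" and ne: "S \<noteq> {}"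
      for Z S u e
    proof -
      obtain p where p: "p \<in> S" using ne by blast
      have "(\<Sum>v\<in>S. (u v + (if v = p then 1 else 0)) *\<^sub>R v) \<in> Z"
        using Z u p by (intro comb) (simp_all add: sum.distrib)
      moreover have "(\<Sum>v\<in>S. (u v + (if v = p then 1 else 0)) *\<^sub>R v) = e + p"
        using Z u p by (simp add: scaleR_add_left sum.distrib if_distrib[of "\<lambda>r. r *\<^sub>R _"] cong: if_cong)
      ultimately show ?thesis using p Z by (intro exI[of _ "e + p"] exI[of _ p]) auto
    qed
    have d0: "d = 0"
    proof (cases "A = {} \<or> B = {}")
      case True
      then show ?thesis using dB by (auto simp: d_def)
    next
      case False
      have "\<exists>p q. d = p - q \<and> p \<in> X \<and> q \<in> X"
        using diff[OF X fin(1), of l d] True False by (simp add: s_def d_def)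
      moreover have "\<exists>p q. - d = p - q \<and> p \<in> Y \<and> q \<in> Y"
        using diff[OF Y fin(2), of l "- d"] True False sB dB by simp
      then have "\<exists>p q. d = p - q \<and> p \<in> Y \<and> q \<in> Y" by (metis minus_diff_eq minus_minus)
      ultimately show ?thesis using skew by (auto simp: skew_def)
    qed
    have "l v = 0" if "v \<in> A" for v
      using affine_independentD[OF A fin(1) _ _ that, of l] True d0 by (simp add: s_def d_def)
    moreover have "l v = 0" if "v \<in> B" for v
      using affine_independentD[OF B fin(2) _ _ that, of l] True d0 sB dB by simp
    ultimately show False using l(2) by blast
  qed
qed

text \<open>\<open>W\<close> is merely a finite generating set; in this form the claim passes
  directly to affine images and to unions. In a join, a dependent set is already dependent within
  one factor.\<close>

lemma join_of_basic_circuits: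
  fixes Q :: "'a::euclidean_space set"
  assumes "join_of_basic Q"
  shows "\<exists>W. finite W \<and> Q = convex hull W \<and> circuits_le_4 W"
  using assms
proof induction
  case (simplex n Q)
  then obtain C where C: "\<not> affine_dependent C" "Q = convex hull C" by (auto simp: simplex_def)
  then have "circuits_le_4 C" unfolding circuits_le_4_def using affine_dependent_subset by blast
  then show ?case using C aff_independent_finite by blast
next
  case (crosspolytope Q)
  then obtain D :: "'a set" and h c where D: "D \<subseteq> Basis" and h: "linear h"
    and inj: "inj_on (\<lambda>x. c + h x) (affine hull (regular_crosspolytope D))"
    and Q: "Q = (\<lambda>x. c + h x) ` regular_crosspolytope D"
    by (auto simp: crosspolytope_def affinely_isomorphic_def)
  define W where "W = D \<union> uminus ` D"
  have "finite D" using D finite_Basis by (rule finite_subset)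
  then have fin: "finite W" by (simp add: W_def)
  have reg: "regular_crosspolytope D = convex hull W" by (simp add: regular_crosspolytope_def W_def)
  have "Q = convex hull ((\<lambda>x. c + h x) ` W)" unfolding Q reg by (rule affine_image_convex_hull[OF h])
  moreover have "circuits_le_4 ((\<lambda>x. c + h x) ` W)"
    using inj fin circuits_le_4_crosspolytope[OF D]
    by (intro circuits_le_4_affine_image[OF h]) (simp_all add: reg W_def[symmetric] affine_hull_convex_hull)
  ultimately show ?case using fin by blast
next
  case (polygon Q)
  define W where "W = vertices Q"
  have Q: "polytope Q" "aff_dim Q = 2" using polygon by (auto simp: polygon_def)
  have fin: "finite W" and QW: "Q = convex hull W"
    using finite_vertices[OF Q(1)] convex_hull_vertices[OF Q(1)] by (auto simp: W_def)
  have "circuits_le_4 W"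
    unfolding circuits_le_4_def
  proof (intro allI impI)
    fix D assume D: "D \<subseteq> W" "affine_dependent D"
    show "\<exists>E\<subseteq>D. card E \<le> 4 \<and> affine_dependent E"
    proof (cases "card D \<le> 4")
      case True
      then show ?thesis using D by blast
    next
      case False
      \<comment> \<open>Any four points of a plane are dependent.\<close>
      then have "4 \<le> card D" by simp
      then obtain E where E: "E \<subseteq> D" "card E = 4" by (metis obtain_subset_with_card_n)
      have "W \<subseteq> Q" by (subst QW) (rule hull_subset)
      then have "aff_dim E \<le> aff_dim Q" using E(1) D(1) by (intro aff_dim_subset) blast
      then have "aff_dim E \<noteq> int (card E) - 1" using Q E by simp
      then have "affine_dependent E" using affine_independent_iff_card by blast
      moreover have "card E \<le> 4" using E by simp
      ultimately show ?thesis using E(1) by blast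
    qed
  qed
  then show ?case using fin QW by blast
next
  case (prism Q)
  then obtain n and \<Delta> :: "'a set" and h :: "'a \<times> real \<Rightarrow> 'a" and c where \<Delta>: "n simplex \<Delta>"
    and h: "linear h" and inj: "inj_on (\<lambda>x. c + h x) (affine hull (\<Delta> \<times> {0..1}))"
    and Q: "Q = (\<lambda>x. c + h x) ` (\<Delta> \<times> {0..1})"
    by (auto simp: prism_over_simplex_def affinely_isomorphic_def)
  obtain K where K: "\<not> affine_dependent K" "\<Delta> = convex hull K" using \<Delta> by (auto simp: simplex_def)
  define W where "W = K \<times> {0, 1 :: real}"
  have fin: "finite W" using K aff_independent_finite by (auto simp: W_def)
  have "{0..1 :: real} = convex hull {0, 1}" by (simp add: segment_convex_hull[symmetric] closed_segment_eq_real_ivl)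
  then have prod: "\<Delta> \<times> {0..1 :: real} = convex hull W" by (simp add: K W_def convex_hull_Times)
  have "Q = convex hull ((\<lambda>x. c + h x) ` W)" unfolding Q prod by (rule affine_image_convex_hull[OF h])
  moreover have "circuits_le_4 ((\<lambda>x. c + h x) ` W)"
    using inj fin circuits_le_4_prism[OF K(1)]
    by (intro circuits_le_4_affine_image[OF h]) (simp_all add: prod W_def[symmetric] affine_hull_convex_hull)
  ultimately show ?case using fin by blast
next
  case (join Q1 Q2)
  then obtain W1 W2 where W1: "finite W1" "Q1 = convex hull W1" "circuits_le_4 W1"
    and W2: "finite W2" "Q2 = convex hull W2" "circuits_le_4 W2" by blast
  have "convex hull (Q1 \<union> Q2) = convex hull (W1 \<union> W2)"
    unfolding W1 W2 by (rule hull_Un[symmetric]) (auto intro: convex_Inter)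
  moreover have "circuits_le_4 (W1 \<union> W2)"
    unfolding circuits_le_4_def
  proof (intro allI impI)
    fix D assume D: "D \<subseteq> W1 \<union> W2" "affine_dependent D"
    have "W1 \<subseteq> affine hull Q1" "W2 \<subseteq> affine hull Q2"
      unfolding W1 W2 by (meson hull_subset subset_trans)+
    then have "affine_dependent (D \<inter> W1) \<or> affine_dependent (D \<inter> W2)"
      using affine_independent_skew_Un[OF join.hyps(3), of "D \<inter> W1" "D \<inter> W2"] D
      by (auto simp: Int_Un_distrib[symmetric] Int_absorb2 le_infI2)
    then show "\<exists>E\<subseteq>D. card E \<le> 4 \<and> affine_dependent E"
      using circuits_le_4D[OF W1(3), of "D \<inter> W1"] circuits_le_4D[OF W2(3), of "D \<inter> W2"]
      by (metis inf_le1 inf_le2 subset_trans)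
  qed
  ultimately show ?case using W1(1) W2(1) by blast
qed

section \<open>Sign-equivalent point sets\<close>

text \<open>The two halves say that \<open>f\<close> carries the covectors of \<open>V\<close>
  exactly onto those of its image. Phrased by functionals, configurations can be compared and glued
  without minimal supports.\<close>

definition sign_equivalent :: "('a::euclidean_space \<Rightarrow> 'a) \<Rightarrow> 'a set \<Rightarrow> bool" where
  "sign_equivalent f V \<longleftrightarrow>
     (\<forall>c h. \<exists>c' h'. \<forall>v\<in>V. sgn (c' + h' \<bullet> f v) = sgn (c + h \<bullet> v)) \<and>
     (\<forall>c h. \<exists>c' h'. \<forall>v\<in>V. sgn (c' + h' \<bullet> v) = sgn (c + h \<bullet> f v))"

text \<open>Keeping the affine hull guarantees that realizations of different blocks remain skew and
  can be joined.\<close>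

definition realizable_as_join :: "'a::euclidean_space set \<Rightarrow> bool" where
  "realizable_as_join V \<longleftrightarrow>
     (\<exists>W f. bij_betw f V W \<and> sign_equivalent f V \<and> affine hull W = affine hull V \<and>
        join_of_basic (convex hull W))"

text \<open>Strict separation of one point from all the others is a condition on signs, so it is
  transported by \<open>f\<close>.\<close>

lemma sign_equivalent_convex_position:
  assumes V: "convex_position V" and f: "bij_betw f V W" and eq: "sign_equivalent f V"
  shows "convex_position W"
  unfolding convex_position_def
proof (intro conjI ballI)
  have fin: "finite V" using V by (simp add: convex_position_def)
  show "finite W" using f fin bij_betw_finite by blast
  fix w assume "w \<in> W"
  then obtain v where v: "v \<in> V" "w = f v" using f by (auto simp: bij_betw_def)
  have "v \<notin> convex hull (V - {v})" using V v by (simp add: convex_position_def)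
  then obtain h b where hb: "h \<bullet> v < b" "\<forall>x\<in>convex hull (V - {v}). h \<bullet> x > b"
    using separating_hyperplane_closed_point[of "convex hull (V - {v})" v] fin
    by (auto simp: finite_imp_compact_convex_hull compact_imp_closed)
  obtain c' h' where c': "\<forall>u\<in>V. sgn (c' + h' \<bullet> f u) = sgn (- b + h \<bullet> u)"
    using eq unfolding sign_equivalent_def by blast
  have neg: "c' + h' \<bullet> w < 0" using c' v hb by (metis add.commute add_uminus_conv_diff diff_less_0_iff_less sgn_less)
  have "h' \<bullet> x > - c'" if x: "x \<in> W - {w}" for x
  proof -
    obtain u where u: "u \<in> V - {v}" "x = f u" using x f v by (auto simp: bij_betw_def)
    then have "h \<bullet> u > b" using hb(2)[rule_format, OF hull_inc[OF u(1)]] by simp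
    then have "sgn (c' + h' \<bullet> x) = 1" using c' u by simp
    then show ?thesis by (simp add: sgn_1_pos)
  qed
  then have "convex hull (W - {w}) \<subseteq> {x. h' \<bullet> x > - c'}"
    by (intro hull_minimal convex_halfspace_gt) auto
  then show "w \<notin> convex hull (W - {w})" using neg by auto
qed

text \<open>Pulling back along \<open>f\<close> maps covectors onto covectors and preserves and
  reflects inclusion of supports. Minimality of supports is therefore preserved, which passes from
  covectors to cocircuits.\<close>

lemma sign_equivalent_same_oriented_matroid:
  fixes P :: "'a::euclidean_space set"
  assumes P: "polytope P" and f: "bij_betw f (vertices P) W" and eq: "sign_equivalent f (vertices P)"
  shows "same_oriented_matroid P (convex hull W)"
proof -
  define V where "V = vertices P"
  define Q where "Q = convex hull W"
  define \<Phi> where "\<Phi> = (\<lambda>(Y :: 'a \<Rightarrow> real) v. if v \<in> V then Y (f v) else 0)"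
  have VQ: "vertices Q = W"
    unfolding Q_def
    by (intro vertices_convex_hull sign_equivalent_convex_position[OF convex_position_vertices[OF P] f eq])
  have fV: "f ` V = W" using f by (simp add: V_def bij_betw_def)
  have fW: "f v \<in> W" if "v \<in> V" for v using fV that by blast
  have cov: "covectors P = \<Phi> ` covectors Q"
  proof (intro set_eqI iffI)
    fix X assume "X \<in> covectors P"
    then obtain c h where X: "X = (\<lambda>v. if v \<in> V then sgn (c + h \<bullet> v) else 0)"
      by (auto simp: covectors_eq V_def)
    obtain c' h' where c': "\<forall>v\<in>V. sgn (c' + h' \<bullet> f v) = sgn (c + h \<bullet> v)"
      using eq unfolding sign_equivalent_def V_def by blast
    define Y where "Y = (\<lambda>v. if v \<in> W then sgn (c' + h' \<bullet> v) else 0)"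
    have "X = \<Phi> Y" using c' fW by (auto simp: X \<Phi>_def Y_def)
    moreover have "Y \<in> covectors Q" by (auto simp: covectors_eq VQ Y_def)
    ultimately show "X \<in> \<Phi> ` covectors Q" by blast
  next
    fix X assume "X \<in> \<Phi> ` covectors Q"
    then obtain c h where X: "X = \<Phi> (\<lambda>v. if v \<in> W then sgn (c + h \<bullet> v) else 0)"
      by (auto simp: covectors_eq VQ)
    obtain c' h' where c': "\<forall>v\<in>V. sgn (c' + h' \<bullet> v) = sgn (c + h \<bullet> f v)"
      using eq unfolding sign_equivalent_def V_def by blast
    have "X = (\<lambda>v. if v \<in> V then sgn (c' + h' \<bullet> v) else 0)"
      using c' fW by (auto simp: X \<Phi>_def)
    then show "X \<in> covectors P" by (auto simp: covectors_eq V_def)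
  qed
  have supp: "f ` sign_support (\<Phi> Y) = sign_support Y" "sign_support (\<Phi> Y) = {v \<in> V. f v \<in> sign_support Y}"
    if "Y \<in> covectors Q" for Y
  proof -
    have "sign_support Y \<subseteq> W" using that by (auto simp: covectors_eq VQ sign_support_def split: if_splits)
    moreover show S: "sign_support (\<Phi> Y) = {v \<in> V. f v \<in> sign_support Y}"
      by (auto simp: sign_support_def \<Phi>_def)
    ultimately show "f ` sign_support (\<Phi> Y) = sign_support Y" unfolding S using fV by blast
  qed
  have sub: "sign_support (\<Phi> Y) \<subseteq> sign_support (\<Phi> Z) \<longleftrightarrow> sign_support Y \<subseteq> sign_support Z"
    if "Y \<in> covectors Q" "Z \<in> covectors Q" for Y Z
  proof
    assume "sign_support (\<Phi> Y) \<subseteq> sign_support (\<Phi> Z)"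
    then have "f ` sign_support (\<Phi> Y) \<subseteq> f ` sign_support (\<Phi> Z)" by (rule image_mono)
    then show "sign_support Y \<subseteq> sign_support Z" using supp(1) that by simp
  next
    assume "sign_support Y \<subseteq> sign_support Z"
    then show "sign_support (\<Phi> Y) \<subseteq> sign_support (\<Phi> Z)"
      unfolding supp(2)[OF that(1)] supp(2)[OF that(2)] by blast
  qed
  have emp: "sign_support (\<Phi> Y) = {} \<longleftrightarrow> sign_support Y = {}" if "Y \<in> covectors Q" for Y
    using supp(1)[OF that] by (metis image_is_empty)
  have equal: "sign_support (\<Phi> Y) = sign_support (\<Phi> Z) \<longleftrightarrow> sign_support Y = sign_support Z"
    if "Y \<in> covectors Q" "Z \<in> covectors Q" for Y Z
    using sub that by (metis set_eq_subset)
  have "\<Phi> X \<in> cocircuits P \<longleftrightarrow> X \<in> cocircuits Q" if X: "X \<in> covectors Q" for X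
  proof -
    have "\<Phi> X \<in> cocircuits P \<longleftrightarrow> sign_support (\<Phi> X) \<noteq> {} \<and>
        (\<forall>Y\<in>covectors Q. sign_support (\<Phi> Y) \<noteq> {} \<and> sign_support (\<Phi> Y) \<subseteq> sign_support (\<Phi> X)
          \<longrightarrow> sign_support (\<Phi> Y) = sign_support (\<Phi> X))"
      unfolding cocircuits_def cov using X by simp
    also have "\<dots> \<longleftrightarrow> X \<in> cocircuits Q"
      unfolding cocircuits_def using X sub[OF _ X] emp equal[OF _ X] by simp
    finally show ?thesis .
  qed
  moreover have "cocircuits P \<subseteq> \<Phi> ` covectors Q" "cocircuits Q \<subseteq> covectors Q"
    unfolding cov[symmetric] by (auto simp: cocircuits_def)
  ultimately have "cocircuits P = \<Phi> ` cocircuits Q" by blast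
  then show ?thesis
    unfolding same_oriented_matroid_def Q_def[symmetric] VQ
    using f by (intro exI[of _ f]) (simp add: \<Phi>_def V_def)
qed

section \<open>Realizations of simplices, polygons and joins\<close>

lemma sign_equivalent_id: "sign_equivalent (\<lambda>v. v) V"
  unfolding sign_equivalent_def by blast

lemma realizable_as_join_simplex:
  assumes "\<not> affine_dependent V" "V \<noteq> {}"
  shows "realizable_as_join V"
proof -
  have "finite V" using assms aff_independent_finite by blast
  then have "(int (card V) - 1) simplex (convex hull V)" "int (card V) - 1 \<ge> 0"
    using assms by (auto simp: simplex_def Suc_le_eq card_gt_0_iff)
  then show ?thesis
    unfolding realizable_as_join_def
    by (intro exI[of _ V] exI[of _ "\<lambda>v. v"] conjI join_of_basic.simplex[of "int (card V) - 1"])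
      (auto simp: bij_betw_def sign_equivalent_id)
qed

lemma realizable_as_join_polygon:
  assumes "finite V" "aff_dim V = 2"
  shows "realizable_as_join V"
proof -
  have "polygon (convex hull V)"
    using assms by (simp add: polygon_def polytope_convex_hull aff_dim_convex_hull)
  then show ?thesis
    unfolding realizable_as_join_def
    by (intro exI[of _ V] exI[of _ "\<lambda>v. v"]) (auto simp: bij_betw_def sign_equivalent_id intro: join_of_basic.polygon)
qed

lemma affine_functional_eq_on_hull:
  fixes h h' :: "'a::euclidean_space"
  assumes "\<And>x. x \<in> S \<Longrightarrow> c + h \<bullet> x = c' + h' \<bullet> x" "y \<in> affine hull S"
  shows "c + h \<bullet> y = c' + h' \<bullet> y"
proof -
  have "affine hull S \<subseteq> {x. (h - h') \<bullet> x = c' - c}"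
    by (intro hull_minimal affine_hyperplane) (use assms(1) in \<open>force simp: inner_diff_left\<close>)
  then show ?thesis using assms(2) by (auto simp: inner_diff_left)
qed

lemma sum_in_affine_hull:
  fixes S :: "'a::euclidean_space set"
  assumes "finite S" "sum u S = 1"
  shows "(\<Sum>v\<in>S. u v *\<^sub>R v) \<in> affine hull S"
  using assms affine_hull_finite by blast

text \<open>A functional equal to 1 on \<open>B1\<close> and 0 on \<open>B2\<close> separates the
  hulls. A common difference vector, written in coordinates on both sides, is an affine dependency
  of \<open>B1 \<union> B2\<close> and hence 0.\<close>

lemma skew_affine_hulls:
  fixes B1 B2 :: "'a::euclidean_space set"
  assumes indep: "\<not> affine_dependent (B1 \<union> B2)" and disj: "B1 \<inter> B2 = {}" and ne: "B1 \<noteq> {}" "B2 \<noteq> {}"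
  shows "skew (affine hull B1) (affine hull B2)"
proof -
  obtain a c where ac: "\<And>x. x \<in> B1 \<union> B2 \<Longrightarrow> c + a \<bullet> x = (if x \<in> B1 then 1 else 0)"
    using affine_interpolation[OF indep, of "\<lambda>x. if x \<in> B1 then 1 else 0"] by metis
  have one: "c + a \<bullet> x = 1" if "x \<in> affine hull B1" for x
    using affine_functional_eq_on_hull[of B1 c a 1 0 x] ac that by simp
  have zero: "c + a \<bullet> x = 0" if "x \<in> affine hull B2" for x
  proof -
    have "c + a \<bullet> y = 0 + 0 \<bullet> y" if "y \<in> B2" for y using ac[of y] disj that by auto
    then show ?thesis using affine_functional_eq_on_hull[of B2 c a 0 0 x] that by simp
  qed
  have only_zero: "d = 0" if d1: "d = x - y" "x \<in> affine hull B1" "y \<in> affine hull B1"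
    and d2: "d = z - w" "z \<in> affine hull B2" "w \<in> affine hull B2" for d x y z w
  proof -
    obtain p where p: "p \<in> B1" using ne by blast
    have fin: "finite B1" "finite B2" using aff_independent_finite[OF indep] by auto
    obtain u1 u2 where u: "sum u1 B1 = 1" "(\<Sum>v\<in>B1. u1 v *\<^sub>R v) = x" "sum u2 B1 = 1" "(\<Sum>v\<in>B1. u2 v *\<^sub>R v) = y"
      using d1 unfolding affine_hull_finite[OF fin(1)] by blast
    obtain u3 u4 where u': "sum u3 B2 = 1" "(\<Sum>v\<in>B2. u3 v *\<^sub>R v) = z" "sum u4 B2 = 1" "(\<Sum>v\<in>B2. u4 v *\<^sub>R v) = w"
      using d2 unfolding affine_hull_finite[OF fin(2)] by blast
    define l where "l = (\<lambda>v. if v \<in> B1 then u1 v - u2 v else u4 v - u3 v)"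
    have l1: "sum l B1 = 0" "(\<Sum>v\<in>B1. l v *\<^sub>R v) = d"
      using u d1 by (simp_all add: l_def sum_subtractf scaleR_diff_left cong: sum.cong)
    have "sum l B2 = (\<Sum>v\<in>B2. u4 v - u3 v)"
      using disj by (intro sum.cong) (auto simp: l_def)
    moreover have "(\<Sum>v\<in>B2. l v *\<^sub>R v) = (\<Sum>v\<in>B2. (u4 v - u3 v) *\<^sub>R v)"
      using disj by (intro sum.cong) (auto simp: l_def)
    ultimately have l2: "sum l B2 = 0" "(\<Sum>v\<in>B2. l v *\<^sub>R v) = - d"
      using u' d2 by (simp_all add: sum_subtractf scaleR_diff_left)
    have "l v = 0" if "v \<in> B1" for v
      using affine_independentD[OF indep, of l v] l1 l2 fin disj that by (simp add: sum.union_disjoint)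
    then show "d = 0" using l1(2) by simp
  qed
  have disj_hulls: "affine hull B1 \<inter> affine hull B2 = {}"
  proof -
    have False if "x \<in> affine hull B1" "x \<in> affine hull B2" for x using one[OF that(1)] zero[OF that(2)] by simp
    then show ?thesis by blast
  qed
  have zero_diff: "0 \<in> {x - y |x y. x \<in> affine hull B \<and> y \<in> affine hull B}" if ne: "B \<noteq> {}" for B :: "'a set"
  proof -
    obtain b where "b \<in> B" using ne by blast
    then have "b \<in> affine hull B" by (rule hull_inc)
    then show ?thesis by (intro CollectI exI[of _ b]) auto
  qed
  have "{x - y |x y. x \<in> affine hull B1 \<and> y \<in> affine hull B1} \<inter>
      {x - y |x y. x \<in> affine hull B2 \<and> y \<in> affine hull B2} = {0}"
  proof
    show "{x - y |x y. x \<in> affine hull B1 \<and> y \<in> affine hull B1} \<inter>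
      {x - y |x y. x \<in> affine hull B2 \<and> y \<in> affine hull B2} \<subseteq> {0}"
      using only_zero by blast
  qed (use zero_diff[OF ne(1)] zero_diff[OF ne(2)] in simp)
  then show ?thesis unfolding skew_def using disj_hulls by blast
qed

text \<open>Independence of \<open>B1 \<union> B2\<close> lets functionals on the two hulls be
  prescribed separately (\<open>glue\<close>). Since the realizations stay in these hulls, the two
  sign equivalences combine.\<close>

lemma realizable_as_join_Un:
  fixes V1 V2 :: "'a::euclidean_space set"
  assumes indep: "\<not> affine_dependent (B1 \<union> B2)" and disj: "B1 \<inter> B2 = {}"
    and V1: "affine hull V1 = affine hull B1" and V2: "affine hull V2 = affine hull B2"
    and ne: "V1 \<noteq> {}" "V2 \<noteq> {}"
    and real: "realizable_as_join V1" "realizable_as_join V2"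
  shows "realizable_as_join (V1 \<union> V2)"
proof -
  obtain W1 f1 where W1: "bij_betw f1 V1 W1" "sign_equivalent f1 V1" "affine hull W1 = affine hull B1"
      "join_of_basic (convex hull W1)"
    using real V1 by (auto simp: realizable_as_join_def)
  obtain W2 f2 where W2: "bij_betw f2 V2 W2" "sign_equivalent f2 V2" "affine hull W2 = affine hull B2"
      "join_of_basic (convex hull W2)"
    using real V2 by (auto simp: realizable_as_join_def)
  have neB: "B1 \<noteq> {}" "B2 \<noteq> {}" using ne V1 V2 by (metis affine_hull_eq_empty)+
  have skew: "skew (affine hull B1) (affine hull B2)"
    by (rule skew_affine_hulls[OF indep disj neB])
  have disjV: "V1 \<inter> V2 = {}" "W1 \<inter> W2 = {}"
    using skew V1 V2 W1(3) W2(3) hull_subset[of V1 affine] hull_subset[of V2 affine]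
      hull_subset[of W1 affine] hull_subset[of W2 affine] unfolding skew_def by blast+
  define f where "f = (\<lambda>v. if v \<in> V1 then f1 v else f2 v)"
  have f1: "f v = f1 v" if "v \<in> V1" for v using that by (simp add: f_def)
  have f2: "f v = f2 v" if "v \<in> V2" for v using that disjV by (auto simp: f_def)
  have fW: "f1 v \<in> W1" if "v \<in> V1" for v using W1 that by (auto simp: bij_betw_def)
  have fW': "f2 v \<in> W2" if "v \<in> V2" for v using W2 that by (auto simp: bij_betw_def)
  have bij: "bij_betw f (V1 \<union> V2) (W1 \<union> W2)"
  proof (rule bij_betw_combine)
    show "bij_betw f V1 W1" using W1(1) f1 by (subst bij_betw_cong)
    show "bij_betw f V2 W2" using W2(1) f2 by (subst bij_betw_cong)
  qed (rule disjV(2))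
  have glue: "\<exists>c h. (\<forall>x\<in>affine hull B1. c + h \<bullet> x = c1 + h1 \<bullet> x) \<and> (\<forall>x\<in>affine hull B2. c + h \<bullet> x = c2 + h2 \<bullet> x)"
    for c1 c2 and h1 h2 :: 'a
  proof -
    obtain h c where hc: "\<And>x. x \<in> B1 \<union> B2 \<Longrightarrow> c + h \<bullet> x = (if x \<in> B1 then c1 + h1 \<bullet> x else c2 + h2 \<bullet> x)"
      using affine_interpolation[OF indep, of "\<lambda>x. if x \<in> B1 then c1 + h1 \<bullet> x else c2 + h2 \<bullet> x"] by metis
    have on: "c + h \<bullet> x = c1 + h1 \<bullet> x" if "x \<in> B1" for x using hc[of x] that by simp
    have off: "c + h \<bullet> x = c2 + h2 \<bullet> x" if "x \<in> B2" for x using hc[of x] that disj by auto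
    show ?thesis
      using affine_functional_eq_on_hull[of B1 c h c1 h1, OF on]
        affine_functional_eq_on_hull[of B2 c h c2 h2, OF off] by blast
  qed
  have in1: "v \<in> affine hull B1" "f1 v \<in> affine hull B1" if "v \<in> V1" for v
    using that V1 W1(3) fW hull_inc by metis+
  have in2: "v \<in> affine hull B2" "f2 v \<in> affine hull B2" if "v \<in> V2" for v
    using that V2 W2(3) fW' hull_inc by metis+
  have "sign_equivalent f (V1 \<union> V2)"
    unfolding sign_equivalent_def
  proof (intro conjI allI)
    fix c and h :: 'a
    obtain c1 h1 where g1: "\<forall>v\<in>V1. sgn (c1 + h1 \<bullet> f1 v) = sgn (c + h \<bullet> v)"
      using W1(2) unfolding sign_equivalent_def by blast
    obtain c2 h2 where g2: "\<forall>v\<in>V2. sgn (c2 + h2 \<bullet> f2 v) = sgn (c + h \<bullet> v)"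
      using W2(2) unfolding sign_equivalent_def by blast
    obtain c' h' where g': "\<forall>x\<in>affine hull B1. c' + h' \<bullet> x = c1 + h1 \<bullet> x" "\<forall>x\<in>affine hull B2. c' + h' \<bullet> x = c2 + h2 \<bullet> x"
      using glue by blast
    have "sgn (c' + h' \<bullet> f v) = sgn (c + h \<bullet> v)" if "v \<in> V1 \<union> V2" for v
      using that g1 g2 g' in1 in2 f1 f2 by (metis UnE)
    then show "\<exists>c' h'. \<forall>v\<in>V1 \<union> V2. sgn (c' + h' \<bullet> f v) = sgn (c + h \<bullet> v)" by blast
  next
    fix c and h :: 'a
    obtain c1 h1 where g1: "\<forall>v\<in>V1. sgn (c1 + h1 \<bullet> v) = sgn (c + h \<bullet> f1 v)"
      using W1(2) unfolding sign_equivalent_def by blast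
    obtain c2 h2 where g2: "\<forall>v\<in>V2. sgn (c2 + h2 \<bullet> v) = sgn (c + h \<bullet> f2 v)"
      using W2(2) unfolding sign_equivalent_def by blast
    obtain c' h' where g': "\<forall>x\<in>affine hull B1. c' + h' \<bullet> x = c1 + h1 \<bullet> x" "\<forall>x\<in>affine hull B2. c' + h' \<bullet> x = c2 + h2 \<bullet> x"
      using glue by blast
    have "sgn (c' + h' \<bullet> v) = sgn (c + h \<bullet> f v)" if "v \<in> V1 \<union> V2" for v
      using that g1 g2 g' in1 in2 f1 f2 by (metis UnE)
    then show "\<exists>c' h'. \<forall>v\<in>V1 \<union> V2. sgn (c' + h' \<bullet> v) = sgn (c + h \<bullet> f v)" by blast
  qed
  moreover have "affine hull (W1 \<union> W2) = affine hull (V1 \<union> V2)"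
    using W1(3) W2(3) V1 V2 hull_Un[of affine] affine_Inter by (metis (no_types, lifting))
  moreover have "join_of_basic (convex hull (W1 \<union> W2))"
  proof -
    have "join_of_basic (convex hull (convex hull W1 \<union> convex hull W2))"
      by (rule join_of_basic.join[OF W1(4) W2(4)]) (use skew W1(3) W2(3) in \<open>simp add: affine_hull_convex_hull\<close>)
    moreover have "convex hull (convex hull W1 \<union> convex hull W2) = convex hull (W1 \<union> W2)"
      by (rule hull_Un[symmetric]) (auto intro: convex_Inter)
    ultimately show ?thesis by simp
  qed
  ultimately show ?thesis unfolding realizable_as_join_def using bij by blast
qed

section \<open>Configurations of pairs\<close>

text \<open>The perpendicular bisector of two points gives them opposite signs, which a common image
  could not have.\<close>

lemma sign_equivalent_inj_on:
  assumes "sign_equivalent f V"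
  shows "inj_on f V"
proof (rule inj_onI, rule ccontr)
  fix u v assume uv: "u \<in> V" "v \<in> V" "f u = f v" "u \<noteq> v"
  define h where "h = v - u"
  define c where "c = - (h \<bullet> u + h \<bullet> v) / 2"
  have "h \<bullet> h > 0" using uv by (simp add: h_def)
  then have gt: "h \<bullet> v > h \<bullet> u" by (simp add: h_def inner_diff_left inner_diff_right inner_commute)
  obtain c' h' where "\<forall>w\<in>V. sgn (c' + h' \<bullet> f w) = sgn (c + h \<bullet> w)"
    using assms unfolding sign_equivalent_def by blast
  then have "sgn (c + h \<bullet> u) = sgn (c + h \<bullet> v)" using uv by metis
  moreover have "c + h \<bullet> u < 0" "c + h \<bullet> v > 0" using gt by (simp_all add: c_def field_simps)
  ultimately show False by simp
qed

lemma affine_interpolation_insert: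
  fixes q :: "'a::euclidean_space" and r :: real
  assumes indep: "\<not> affine_dependent (insert q (x ` I))" and q: "q \<notin> x ` I" and inj: "inj_on x I"
  shows "\<exists>c h. c + h \<bullet> q = r \<and> (\<forall>i\<in>I. c + h \<bullet> x i = t i)"
proof -
  obtain h c where hc: "\<And>v. v \<in> insert q (x ` I) \<Longrightarrow> c + h \<bullet> v = (if v = q then r else t (inv_into I x v))"
    using affine_interpolation[OF indep, of "\<lambda>v. if v = q then r else t (inv_into I x v)"] by metis
  have "c + h \<bullet> x i = t i" if i: "i \<in> I" for i
  proof -
    have "x i \<noteq> q" using i q by (metis imageI)
    then show ?thesis using hc[of "x i"] i inj by simp
  qed
  moreover have "c + h \<bullet> q = r" using hc[of q] by simp
  ultimately show ?thesis by blast
qed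

lemma spanning_independent:
  fixes S V :: "'a::euclidean_space set"
  assumes "finite S" "card S \<le> n + 1" "V \<subseteq> affine hull S" "aff_dim V = int n"
  shows "\<not> affine_dependent S" "card S = n + 1"
proof -
  have "int n \<le> aff_dim S" using aff_dim_subset[OF assms(3)] assms(4) by simp
  moreover have "aff_dim S \<le> int (card S) - 1" using aff_dim_le_card[OF assms(1)] by simp
  ultimately have "aff_dim S = int (card S) - 1" "card S = n + 1" using assms(2) by linarith+
  then show "\<not> affine_dependent S" "card S = n + 1" using affine_independent_iff_card assms(1) by blast+
qed

text \<open>Homogeneously, all lines through a pair \<open>x i\<close>, \<open>y i\<close> contain the common point with weight \<open>s\<close> and
  position \<open>p\<close>. It lies between \<open>x i\<close> and \<open>y i\<close> in a crosspolytope, and outside or at infinity in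
  a prism.\<close>

locale paired_points =
  fixes I :: "'i set" and x y :: "'i \<Rightarrow> 'a::euclidean_space" and \<alpha> \<beta> :: "'i \<Rightarrow> real"
    and p :: 'a and s :: real and k :: 'i
  assumes finI: "finite I" and k: "k \<in> I"
    and rel: "i \<in> I \<Longrightarrow> \<alpha> i *\<^sub>R x i + \<beta> i *\<^sub>R y i = p"
    and weight: "i \<in> I \<Longrightarrow> \<alpha> i + \<beta> i = s"
    and nonzero: "i \<in> I \<Longrightarrow> \<beta> i \<noteq> 0"
    and dim: "aff_dim (x ` I \<union> y ` I) = int (card I)"
    and disj: "x ` I \<inter> y ` I = {}" and injy: "inj_on y I"
begin

lemma value_sum:
  assumes "i \<in> I"
  shows "\<alpha> i * (c + h \<bullet> x i) + \<beta> i * (c + h \<bullet> y i) = s * c + h \<bullet> p"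
  using rel[OF assms, symmetric] weight[OF assms, symmetric]
  by (simp add: algebra_simps)

text \<open>Keeps every \<open>x i\<close> and exchanges \<open>y i\<close> for \<open>z i\<close>;
  it acts on points instead of indices because \<open>sign_equivalent\<close> compares maps of
  points.\<close>

definition partner :: "('i \<Rightarrow> 'a) \<Rightarrow> 'a \<Rightarrow> 'a" where
  "partner z v = (if v \<in> x ` I then v else z (inv_into I y v))"

lemma partner_x: "i \<in> I \<Longrightarrow> partner z (x i) = x i"
  by (simp add: partner_def)

lemma partner_y: "i \<in> I \<Longrightarrow> partner z (y i) = z i"
  using disj injy by (auto simp: partner_def)

lemma partner_image: "partner z ` (x ` I \<union> y ` I) = x ` I \<union> z ` I"
  unfolding image_Un image_image using partner_x partner_y by (metis (mono_tags, lifting) image_cong)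

lemma realizableI:
  assumes fwd: "\<And>c h. \<exists>c' h'. \<forall>i\<in>I. sgn (c' + h' \<bullet> x i) = sgn (c + h \<bullet> x i) \<and> sgn (c' + h' \<bullet> z i) = sgn (c + h \<bullet> y i)"
    and bwd: "\<And>c h. \<exists>c' h'. \<forall>i\<in>I. sgn (c' + h' \<bullet> x i) = sgn (c + h \<bullet> x i) \<and> sgn (c' + h' \<bullet> y i) = sgn (c + h \<bullet> z i)"
    and hull: "affine hull (x ` I \<union> z ` I) = affine hull (x ` I \<union> y ` I)"
    and join: "join_of_basic (convex hull (x ` I \<union> z ` I))"
  shows "realizable_as_join (x ` I \<union> y ` I)"
proof -
  have eq: "sign_equivalent (partner z) (x ` I \<union> y ` I)"
    unfolding sign_equivalent_def using fwd bwd by (simp add: ball_Un partner_x partner_y ball_conj_distrib)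
  then have "bij_betw (partner z) (x ` I \<union> y ` I) (x ` I \<union> z ` I)"
    unfolding bij_betw_def using sign_equivalent_inj_on partner_image by blast
  then show ?thesis unfolding realizable_as_join_def using eq hull join by blast
qed

section \<open>Crosspolytopes and prisms from paired points\<close>

lemma card_x: "card (x ` I) \<le> card I" by (rule card_image_le[OF finI])

text \<open>Scaling \<open>(1, x i)\<close> by \<open>2 * \<alpha> i / s\<close> and
  \<open>(1, y i)\<close> by \<open>2 * \<beta> i / s\<close> turns the relation into a sum equal to
  \<open>2 (1, q)\<close>. So \<open>y i\<close> may be replaced by the reflection of
  \<open>x i\<close> in \<open>q\<close>; the functionals \<open>c'\<close>, \<open>h'\<close> below
  absorb these factors.\<close>

lemma realizable_crosspolytope:
  assumes pos: "\<And>i. i \<in> I \<Longrightarrow> \<alpha> i > 0" "\<And>i. i \<in> I \<Longrightarrow> \<beta> i > 0"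
  shows "realizable_as_join (x ` I \<union> y ` I)"
proof -
  have s: "s > 0" using pos[OF k] weight[OF k] by simp
  define q where "q = p /\<^sub>R s"
  have p: "p = s *\<^sub>R q" using s by (simp add: q_def)
  define S where "S = insert q (x ` I)"
  have yS: "y i \<in> affine hull S" if i: "i \<in> I" for i
  proof -
    have "\<beta> i *\<^sub>R y i = s *\<^sub>R q - \<alpha> i *\<^sub>R x i" using rel[OF i] p by (metis add_diff_cancel_left')
    then have "(1 / \<beta> i) *\<^sub>R (\<beta> i *\<^sub>R y i) = (1 / \<beta> i) *\<^sub>R (s *\<^sub>R q - \<alpha> i *\<^sub>R x i)" by simp
    then have "y i = (s / \<beta> i) *\<^sub>R q + (- \<alpha> i / \<beta> i) *\<^sub>R x i"
      using nonzero[OF i] by (simp add: scaleR_diff_right)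
    moreover have "s / \<beta> i + (- \<alpha> i / \<beta> i) = 1"
      using weight[OF i] nonzero[OF i] by (simp add: field_simps)
    ultimately have "y i \<in> affine hull {q, x i}" unfolding affine_hull_2 by blast
    moreover have "affine hull {q, x i} \<subseteq> affine hull S" by (intro hull_mono) (use i in \<open>auto simp: S_def\<close>)
    ultimately show ?thesis by blast
  qed
  have finS: "finite S" using finI by (simp add: S_def)
  have cardS: "card S \<le> card I + 1"
    using card_insert_le_m1[of "card I + 1" "x ` I" q] card_x by (simp add: S_def)
  have sub: "x ` I \<union> y ` I \<subseteq> affine hull S" using yS hull_inc[of _ S] by (auto simp: S_def)
  have indep: "\<not> affine_dependent S" and card: "card S = card I + 1"
    by (rule spanning_independent[OF finS cardS sub dim])+
  have qx: "q \<notin> x ` I"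
    using card card_x finI unfolding S_def by (metis Suc_eq_plus1 Suc_n_not_le_n insert_absorb)
  have "card (x ` I) = card I" using card qx finI by (simp add: S_def)
  then have injx: "inj_on x I" using finI eq_card_imp_inj_on by blast
  define z where "z = (\<lambda>i. 2 *\<^sub>R q - x i)"
  have interp: "\<exists>c h. c + h \<bullet> q = r \<and> (\<forall>i\<in>I. c + h \<bullet> x i = t i)" for r t
    using indep qx injx unfolding S_def by (rule affine_interpolation_insert)
  have vz: "c + h \<bullet> z i = 2 * (c + h \<bullet> q) - (c + h \<bullet> x i)" for c i and h :: 'a
    by (simp add: z_def inner_diff_right)
  have vy: "\<beta> i * (c + h \<bullet> y i) = s * (c + h \<bullet> q) - \<alpha> i * (c + h \<bullet> x i)" if "i \<in> I" for c i and h :: 'a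
    using value_sum[OF that, of c h] by (simp add: p algebra_simps)
  have sgn_mult: "sgn (a * b) = sgn b" if "a > 0" for a b :: real using that by (simp add: sgn_mult)
  show ?thesis
  proof (rule realizableI[of z])
    fix c and h :: 'a
    obtain c' h' where g: "c' + h' \<bullet> q = c + h \<bullet> q"
        "\<And>i. i \<in> I \<Longrightarrow> c' + h' \<bullet> x i = (2 * \<alpha> i / s) * (c + h \<bullet> x i)"
      using interp[of "c + h \<bullet> q" "\<lambda>i. (2 * \<alpha> i / s) * (c + h \<bullet> x i)"] by blast
    have "c' + h' \<bullet> z i = (2 * \<beta> i / s) * (c + h \<bullet> y i)" if i: "i \<in> I" for i
    proof -
      have "(2 * \<beta> i / s) * (c + h \<bullet> y i) = (2 / s) * (\<beta> i * (c + h \<bullet> y i))" by simp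
      also have "\<dots> = 2 * (c + h \<bullet> q) - (2 * \<alpha> i / s) * (c + h \<bullet> x i)"
        unfolding vy[OF i] using s by (simp add: field_simps)
      finally show ?thesis by (simp add: vz g i)
    qed
    then show "\<exists>c' h'. \<forall>i\<in>I. sgn (c' + h' \<bullet> x i) = sgn (c + h \<bullet> x i) \<and> sgn (c' + h' \<bullet> z i) = sgn (c + h \<bullet> y i)"
      using g(2) pos s by (intro exI[of _ c'] exI[of _ h'] ballI) (simp add: sgn_mult del: times_divide_eq_left)
  next
    fix c and h :: 'a
    obtain c' h' where g: "c' + h' \<bullet> q = c + h \<bullet> q"
        "\<And>i. i \<in> I \<Longrightarrow> c' + h' \<bullet> x i = (s / (2 * \<alpha> i)) * (c + h \<bullet> x i)"
      using interp[of "c + h \<bullet> q" "\<lambda>i. (s / (2 * \<alpha> i)) * (c + h \<bullet> x i)"] by blast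
    have "c' + h' \<bullet> y i = (s / (2 * \<beta> i)) * (c + h \<bullet> z i)" if i: "i \<in> I" for i
    proof -
      have "\<beta> i * (c' + h' \<bullet> y i) = s * (c + h \<bullet> q) - \<alpha> i * ((s / (2 * \<alpha> i)) * (c + h \<bullet> x i))"
        unfolding vy[OF i] g(1) g(2)[OF i] ..
      also have "\<alpha> i * ((s / (2 * \<alpha> i)) * (c + h \<bullet> x i)) = (s / 2) * (c + h \<bullet> x i)"
        using pos(1)[OF i] by simp
      also have "s * (c + h \<bullet> q) - (s / 2) * (c + h \<bullet> x i) = (s / 2) * (c + h \<bullet> z i)"
        unfolding vz by (simp add: field_simps)
      finally show ?thesis using pos(2)[OF i] by (simp add: field_simps)
    qed
    then show "\<exists>c' h'. \<forall>i\<in>I. sgn (c' + h' \<bullet> x i) = sgn (c + h \<bullet> x i) \<and> sgn (c' + h' \<bullet> y i) = sgn (c + h \<bullet> z i)"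
      using g(2) pos s by (intro exI[of _ c'] exI[of _ h'] ballI) (simp add: sgn_mult del: times_divide_eq_left)
  next
    have "z i \<in> affine hull S" if "i \<in> I" for i
    proof -
      have "z i = 2 *\<^sub>R q + (- 1) *\<^sub>R x i" by (simp add: z_def)
      moreover have "(2 :: real) + - 1 = 1" by simp
      ultimately have "z i \<in> affine hull {q, x i}" unfolding affine_hull_2 by blast
      moreover have "affine hull {q, x i} \<subseteq> affine hull S" by (intro hull_mono) (use that in \<open>auto simp: S_def\<close>)
      ultimately show ?thesis by blast
    qed
    then have subz: "x ` I \<union> z ` I \<subseteq> affine hull S" using hull_inc[of _ S] by (auto simp: S_def)
    have span: "affine hull T = affine hull S" if T: "T \<subseteq> affine hull S" "x ` I \<subseteq> T" "q \<in> affine hull T" for T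
    proof
      show "affine hull T \<subseteq> affine hull S" using T by (simp add: hull_minimal)
      have "S \<subseteq> affine hull T" using T hull_subset[of T affine] by (auto simp: S_def)
      then show "affine hull S \<subseteq> affine hull T" by (simp add: hull_minimal)
    qed
    have mid: "q \<in> affine hull T" if "a \<in> T" "b \<in> T" "q = u *\<^sub>R a + v *\<^sub>R b" "u + v = 1" for T a b u v
    proof -
      have "q \<in> affine hull {a, b}" unfolding affine_hull_2 using that by blast
      moreover have "affine hull {a, b} \<subseteq> affine hull T" by (intro hull_mono) (use that in auto)
      ultimately show ?thesis by blast
    qed
    have "q = (1 / 2) *\<^sub>R x k + (1 / 2) *\<^sub>R z k" by (simp add: z_def flip: scaleR_add_right)
    then have "affine hull (x ` I \<union> z ` I) = affine hull S"
      using k by (intro span subz mid[of "x k" _ "z k"]) auto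
    moreover have "q = (\<alpha> k / s) *\<^sub>R x k + (\<beta> k / s) *\<^sub>R y k"
      using rel[OF k] s by (simp add: q_def divide_inverse_commute flip: scaleR_scaleR scaleR_add_right)
    then have "affine hull (x ` I \<union> y ` I) = affine hull S"
      using k weight[OF k] s by (intro span sub mid[of "x k" _ "y k"]) (auto simp flip: add_divide_distrib)
    ultimately show "affine hull (x ` I \<union> z ` I) = affine hull (x ` I \<union> y ` I)" by simp
    \<comment> \<open>The model crosspolytope must live in the same type, so enough coordinate
      directions are needed.\<close>
    have "card I \<le> DIM('a)" using aff_dim_le_DIM[of "x ` I \<union> y ` I"] dim by simp
    then obtain D :: "'a set" where D: "D \<subseteq> Basis" "card D = card I" by (metis obtain_subset_with_card_n)
    have finD: "finite D" using D finite_Basis by (meson finite_subset)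
    then obtain g where g: "bij_betw g D I" using finite_same_card_bij[OF _ finI] D by blast
    define h where "h = (\<lambda>v. \<Sum>e\<in>D. (v \<bullet> e) *\<^sub>R (x (g e) - q))"
    have lin: "linear h"
      by (rule linearI) (simp_all add: h_def inner_add_left scaleR_add_left sum.distrib scaleR_sum_right)
    have he: "h e = x (g e) - q" if e: "e \<in> D" for e
    proof -
      have "h e = (\<Sum>e'\<in>D. if e' = e then x (g e) - q else 0)"
        unfolding h_def
      proof (intro sum.cong refl)
        fix e' assume "e' \<in> D"
        then have "e \<bullet> e' = (if e' = e then 1 else 0)"
          using D(1) e inner_not_same_Basis[of e e'] inner_same_Basis[of e] by auto
        then show "(e \<bullet> e') *\<^sub>R (x (g e') - q) = (if e' = e then x (g e) - q else 0)" by simp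
      qed
      then show ?thesis using finD e by simp
    qed
    have "(\<lambda>v. q + h v) ` (D \<union> uminus ` D) = x ` I \<union> z ` I"
    proof -
      have "(\<lambda>v. q + h v) ` D = x ` g ` D" unfolding image_image by (intro image_cong) (auto simp: he)
      moreover have "(\<lambda>v. q + h v) ` uminus ` D = z ` g ` D"
        unfolding image_image by (intro image_cong) (auto simp: he linear_neg[OF lin] z_def scaleR_2)
      ultimately show ?thesis using g by (simp add: image_Un bij_betw_def)
    qed
    moreover have "(\<lambda>v. q + h v) ` regular_crosspolytope D = convex hull ((\<lambda>v. q + h v) ` (D \<union> uminus ` D))"
      unfolding regular_crosspolytope_def by (rule affine_image_convex_hull[OF lin])
    \<comment> \<open>The affine hull of the model lies in \<open>span D\<close>. There the
      coordinate at \<open>e\<close> is recovered from \<open>h\<close> by a functional that takes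
      the value 1 on \<open>x (g e) - q\<close> and 0 on the other such vectors.\<close>
    moreover have "inj_on (\<lambda>v. q + h v) (affine hull (regular_crosspolytope D))"
    proof (rule inj_onI)
      have "D \<union> uminus ` D \<subseteq> span D" by (auto intro: span_base span_neg)
      then have sp: "affine hull (regular_crosspolytope D) \<subseteq> span D"
        unfolding regular_crosspolytope_def affine_hull_convex_hull
        by (intro hull_minimal subspace_imp_affine) auto
      fix u v assume uv: "u \<in> affine hull (regular_crosspolytope D)" "v \<in> affine hull (regular_crosspolytope D)"
        "q + h u = q + h v"
      then have h0: "h (u - v) = 0" by (simp add: linear_diff[OF lin])
      have "(u - v) \<bullet> e = 0" if e: "e \<in> D" for e
      proof -
        obtain c a where ca: "c + a \<bullet> q = 0" "\<forall>i\<in>I. c + a \<bullet> x i = (if i = g e then 1 else 0)"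
          using interp[of 0 "\<lambda>i. if i = g e then 1 else 0"] by blast
        have "a \<bullet> (x (g e') - q) = (if e' = e then 1 else 0)" if e': "e' \<in> D" for e'
        proof -
          have "g e' \<in> I" "g e' = g e \<longleftrightarrow> e' = e" using g e e' by (auto simp: bij_betw_def inj_on_def)
          then have "c + a \<bullet> x (g e') = (if e' = e then 1 else 0)" using ca(2) by simp
          then show ?thesis using ca(1) by (simp add: inner_diff_right split: if_splits)
        qed
        then have "a \<bullet> h (u - v) = (\<Sum>e'\<in>D. if e' = e then (u - v) \<bullet> e else 0)"
          unfolding h_def inner_sum_right by (intro sum.cong) auto
        then show ?thesis using h0 finD e by simp
      qed
      then have "orthogonal (u - v) e" if "e \<in> D" for e using that by (simp add: orthogonal_def)
      moreover have "u - v \<in> span D" using uv sp by (meson span_diff subsetD)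
      ultimately have "orthogonal (u - v) (u - v)" by (meson orthogonal_to_span)
      then show "u = v" by (simp add: orthogonal_self)
    qed
    moreover have "D \<noteq> {}" using D(2) k finI by auto
    ultimately have "crosspolytope (convex hull (x ` I \<union> z ` I))"
      unfolding crosspolytope_def affinely_isomorphic_def using D(1) lin by metis
    then show "join_of_basic (convex hull (x ` I \<union> z ` I))" by (rule join_of_basic.crosspolytope)
  qed
qed

text \<open>Scaling \<open>(1, x i)\<close> by \<open>\<alpha> i\<close> and \<open>(1, y i)\<close>
  by \<open>- \<beta> i\<close> makes their difference the same vector for all \<open>i\<close>. So
  \<open>y i\<close> may be replaced by the translate of \<open>x i\<close> by
  \<open>y k - x k\<close>, whatever the weight \<open>s\<close> is.\<close>

lemma realizable_prism:
  assumes pos: "\<And>i. i \<in> I \<Longrightarrow> \<alpha> i > 0" and neg: "\<And>i. i \<in> I \<Longrightarrow> \<beta> i < 0"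
  shows "realizable_as_join (x ` I \<union> y ` I)"
proof -
  define S where "S = insert (y k) (x ` I)"
  have vy: "\<beta> i * (c + h \<bullet> y i) = \<alpha> k * (c + h \<bullet> x k) + \<beta> k * (c + h \<bullet> y k) - \<alpha> i * (c + h \<bullet> x i)"
    if "i \<in> I" for c i and h :: 'a
    using value_sum[OF that, of c h] value_sum[OF k, of c h] by simp
  have yS: "y i \<in> affine hull S" if i: "i \<in> I" for i
  proof -
    have "\<beta> i *\<^sub>R y i = \<alpha> k *\<^sub>R x k + \<beta> k *\<^sub>R y k - \<alpha> i *\<^sub>R x i"
      using rel[OF i] rel[OF k] by (metis add_diff_cancel_left')
    then have "(1 / \<beta> i) *\<^sub>R (\<beta> i *\<^sub>R y i) = (1 / \<beta> i) *\<^sub>R (\<alpha> k *\<^sub>R x k + \<beta> k *\<^sub>R y k - \<alpha> i *\<^sub>R x i)" by simp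
    then have "y i = (\<alpha> k / \<beta> i) *\<^sub>R x k + (\<beta> k / \<beta> i) *\<^sub>R y k + (- \<alpha> i / \<beta> i) *\<^sub>R x i"
      using nonzero[OF i] by (simp add: scaleR_diff_right scaleR_add_right)
    moreover have "\<alpha> k / \<beta> i + \<beta> k / \<beta> i + (- \<alpha> i / \<beta> i) = 1"
      using weight[OF i] weight[OF k] nonzero[OF i] by (simp add: field_simps)
    ultimately have "y i \<in> affine hull {x k, y k, x i}" unfolding affine_hull_3 by blast
    moreover have "affine hull {x k, y k, x i} \<subseteq> affine hull S"
      by (intro hull_mono) (use i k in \<open>auto simp: S_def\<close>)
    ultimately show ?thesis by blast
  qed
  have finS: "finite S" using finI by (simp add: S_def)
  have cardS: "card S \<le> card I + 1"
    using card_insert_le_m1[of "card I + 1" "x ` I" "y k"] card_x by (simp add: S_def)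
  have sub: "x ` I \<union> y ` I \<subseteq> affine hull S" using yS hull_inc[of _ S] by (auto simp: S_def)
  have indep: "\<not> affine_dependent S" and card: "card S = card I + 1"
    by (rule spanning_independent[OF finS cardS sub dim])+
  have yx: "y k \<notin> x ` I" using disj k by blast
  have cardx: "card (x ` I) = card I" using card yx finI by (simp add: S_def)
  then have injx: "inj_on x I" using finI eq_card_imp_inj_on by blast
  define u where "u = y k - x k"
  define z where "z = (\<lambda>i. x i + u)"
  have interp: "\<exists>c h. c + h \<bullet> y k = r \<and> (\<forall>i\<in>I. c + h \<bullet> x i = t i)" for r t
    using indep yx injx unfolding S_def by (rule affine_interpolation_insert)
  have vz: "c + h \<bullet> z i = (c + h \<bullet> x i) + (c + h \<bullet> y k) - (c + h \<bullet> x k)" for c i and h :: 'a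
    by (simp add: z_def u_def inner_add_right inner_diff_right)
  have sgn_mult: "sgn (a * b) = sgn b" if "a > 0" for a b :: real using that by (simp add: sgn_mult)
  show ?thesis
  proof (rule realizableI[of z])
    fix c and h :: 'a
    obtain c' h' where g: "c' + h' \<bullet> y k = (- \<beta> k) * (c + h \<bullet> y k)"
        "\<And>i. i \<in> I \<Longrightarrow> c' + h' \<bullet> x i = \<alpha> i * (c + h \<bullet> x i)"
      using interp[of "(- \<beta> k) * (c + h \<bullet> y k)" "\<lambda>i. \<alpha> i * (c + h \<bullet> x i)"] by blast
    have "c' + h' \<bullet> z i = (- \<beta> i) * (c + h \<bullet> y i)" if i: "i \<in> I" for i
      using vy[OF i, of c h] unfolding vz g(1) g(2)[OF i] g(2)[OF k] by simp
    then show "\<exists>c' h'. \<forall>i\<in>I. sgn (c' + h' \<bullet> x i) = sgn (c + h \<bullet> x i) \<and> sgn (c' + h' \<bullet> z i) = sgn (c + h \<bullet> y i)"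
      using sgn_mult[of "- \<beta> _"] sgn_mult[OF pos] neg g(2)
      by (intro exI[of _ c'] exI[of _ h'] ballI conjI) (metis, metis neg_0_less_iff_less)
  next
    fix c and h :: 'a
    obtain c' h' where g: "c' + h' \<bullet> y k = (1 / - \<beta> k) * (c + h \<bullet> y k)"
        "\<And>i. i \<in> I \<Longrightarrow> c' + h' \<bullet> x i = (1 / \<alpha> i) * (c + h \<bullet> x i)"
      using interp[of "(1 / - \<beta> k) * (c + h \<bullet> y k)" "\<lambda>i. (1 / \<alpha> i) * (c + h \<bullet> x i)"] by blast
    have "c' + h' \<bullet> y i = (1 / - \<beta> i) * (c + h \<bullet> z i)" if i: "i \<in> I" for i
    proof -
      have "\<beta> i * (c' + h' \<bullet> y i) = (c + h \<bullet> x k) - (c + h \<bullet> y k) - (c + h \<bullet> x i)"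
        unfolding vy[OF i] g(1) g(2)[OF i] g(2)[OF k]
        using pos[OF i] pos[OF k] neg[OF k] by simp
      then have "\<beta> i * (c' + h' \<bullet> y i) = - (c + h \<bullet> z i)" unfolding vz by simp
      then show ?thesis using neg[OF i] by (simp add: field_simps)
    qed
    then show "\<exists>c' h'. \<forall>i\<in>I. sgn (c' + h' \<bullet> x i) = sgn (c + h \<bullet> x i) \<and> sgn (c' + h' \<bullet> y i) = sgn (c + h \<bullet> z i)"
      using g(2) pos neg
      by (intro exI[of _ c'] exI[of _ h'] ballI)
        (simp add: sgn_mult del: mult_minus_left times_divide_eq_left divide_minus_right mult_1)
  next
    have "z i \<in> affine hull S" if "i \<in> I" for i
    proof -
      have "z i = 1 *\<^sub>R x i + 1 *\<^sub>R y k + (- 1) *\<^sub>R x k" by (simp add: z_def u_def)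
      moreover have "(1 :: real) + 1 + - 1 = 1" by simp
      ultimately have "z i \<in> affine hull {x i, y k, x k}" unfolding affine_hull_3 by blast
      moreover have "affine hull {x i, y k, x k} \<subseteq> affine hull S"
        by (intro hull_mono) (use that k in \<open>auto simp: S_def\<close>)
      ultimately show ?thesis by blast
    qed
    then have subz: "x ` I \<union> z ` I \<subseteq> affine hull S" using hull_inc[of _ S] by (auto simp: S_def)
    have span: "affine hull T = affine hull S" if T: "T \<subseteq> affine hull S" "S \<subseteq> T" for T
      using T by (simp add: hull_minimal hull_mono subset_antisym)
    have "z k = y k" by (simp add: z_def u_def)
    then have "S \<subseteq> x ` I \<union> z ` I" using imageI[OF k, of z] by (simp add: S_def)
    moreover have "S \<subseteq> x ` I \<union> y ` I" using k by (auto simp: S_def)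
    ultimately have "affine hull (x ` I \<union> z ` I) = affine hull S" "affine hull (x ` I \<union> y ` I) = affine hull S"
      using span[OF subz] span[OF sub] by blast+
    then show "affine hull (x ` I \<union> z ` I) = affine hull (x ` I \<union> y ` I)" by simp
    define \<Delta> where "\<Delta> = convex hull (x ` I)"
    define h :: "'a \<times> real \<Rightarrow> 'a" where "h = (\<lambda>w. fst w + snd w *\<^sub>R u)"
    have lin: "linear h" by (rule linearI) (simp_all add: h_def scaleR_add_left algebra_simps)
    have indx: "\<not> affine_dependent (x ` I)"
      using indep affine_independent_subset[of S "x ` I"] by (auto simp: S_def)
    have simplex: "(int (card I) - 1) simplex \<Delta>"
      unfolding simplex_def \<Delta>_def using indx cardx by (intro exI[of _ "x ` I"]) simp
    have "{0..1 :: real} = convex hull {0, 1}"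
      by (simp add: segment_convex_hull[symmetric] closed_segment_eq_real_ivl)
    then have prod: "\<Delta> \<times> {0..1 :: real} = convex hull (x ` I \<times> {0, 1})" by (simp add: \<Delta>_def convex_hull_Times)
    have "h ` (\<Delta> \<times> {0..1}) = convex hull (h ` (x ` I \<times> {0, 1}))"
      unfolding prod by (rule convex_hull_linear_image[OF lin])
    also have "x ` I \<times> {0, 1} = (\<lambda>i. (x i, 0)) ` I \<union> (\<lambda>i. (x i, 1 :: real)) ` I" by auto
    also have "h ` \<dots> = x ` I \<union> z ` I"
      by (simp add: image_Un image_image h_def z_def)
    finally have img: "convex hull (x ` I \<union> z ` I) = (\<lambda>w. 0 + h w) ` (\<Delta> \<times> {0..1})" by simp
    have inj: "inj_on (\<lambda>w. 0 + h w) (affine hull (\<Delta> \<times> {0..1}))"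
    proof (rule inj_onI)
      have sub: "affine hull (\<Delta> \<times> {0..1 :: real}) \<subseteq> (affine hull (x ` I)) \<times> UNIV"
      proof (rule hull_minimal)
        show "\<Delta> \<times> {0..1 :: real} \<subseteq> (affine hull (x ` I)) \<times> UNIV"
          using convex_hull_subset_affine_hull by (auto simp: \<Delta>_def)
        show "affine ((affine hull (x ` I)) \<times> (UNIV :: real set))"
          using affine_affine_hull[of "x ` I"] by (auto simp: affine_def)
      qed
      fix v w assume vw: "v \<in> affine hull (\<Delta> \<times> {0..1 :: real})" "w \<in> affine hull (\<Delta> \<times> {0..1 :: real})" "0 + h v = 0 + h w"
      obtain a s b t where ab: "v = (a, s)" "w = (b, t)" by fastforce
      have aff: "a \<in> affine hull (x ` I)" "b \<in> affine hull (x ` I)" using subsetD[OF sub vw(1)] subsetD[OF sub vw(2)] ab by auto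
      have eq: "a - b = (t - s) *\<^sub>R u" using vw(3) by (simp add: ab h_def algebra_simps)
      have "t = s"
      proof (rule ccontr)
        assume "t \<noteq> s"
        then have "u = (1 / (t - s)) *\<^sub>R (a - b)" using eq by simp
        then have "y k = 1 *\<^sub>R x k + (1 / (t - s)) *\<^sub>R a + (- 1 / (t - s)) *\<^sub>R b"
          by (simp add: u_def scaleR_diff_right algebra_simps)
        moreover have "1 + 1 / (t - s) + (- 1 / (t - s)) = 1" by simp
        ultimately have "y k \<in> affine hull {x k, a, b}" unfolding affine_hull_3 by blast
        moreover have "affine hull {x k, a, b} \<subseteq> affine hull (x ` I)"
          by (intro hull_minimal) (use aff k in \<open>auto intro: hull_inc\<close>)
        moreover have "S - {y k} = x ` I" using yx by (auto simp: S_def)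
        ultimately show False using indep unfolding affine_dependent_def by (metis S_def insertI1 subsetD)
      qed
      then show "v = w" using eq by (simp add: ab)
    qed
    have "prism_over_simplex (convex hull (x ` I \<union> z ` I))"
      unfolding prism_over_simplex_def affinely_isomorphic_def
    proof (intro exI conjI)
      show "(int (card I) - 1) simplex \<Delta>" by (rule simplex)
      show "int (card I) - 1 \<ge> 0" using k finI by (simp add: Suc_le_eq card_gt_0_iff) blast
      show "linear h" by (rule lin)
      show "inj_on (\<lambda>w. 0 + h w) (affine hull (\<Delta> \<times> {0..1}))" by (rule inj)
      show "convex hull (x ` I \<union> z ` I) = (\<lambda>w. 0 + h w) ` (\<Delta> \<times> {0..1})" by (rule img)
    qed
    then show "join_of_basic (convex hull (x ` I \<union> z ` I))" by (rule join_of_basic.prism)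
  qed
qed

end

section \<open>Coordinates with respect to a basis\<close>

text \<open>\<open>\<phi> v\<close> holds the affine coordinates of \<open>v\<close> in the basis
  \<open>B\<close>.\<close>

locale basis_coordinates =
  fixes V B :: "'a::euclidean_space set" and \<phi> :: "'a \<Rightarrow> 'a \<Rightarrow> real"
  assumes pos: "convex_position V" and circ: "circuits_le_4 V"
    and BV: "B \<subseteq> V" and indep: "\<not> affine_dependent B"
    and chi_sum: "v \<in> V \<Longrightarrow> sum (\<phi> v) B = 1"
    and chi: "v \<in> V \<Longrightarrow> (\<Sum>b\<in>B. \<phi> v b *\<^sub>R b) = v"
begin

section \<open>Dependencies in coordinates\<close>

definition N :: "'a set" where "N = V - B"

definition T :: "'a \<Rightarrow> 'a set" where "T v = {b \<in> B. \<phi> v b \<noteq> 0}"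

definition dependency :: "('a \<Rightarrow> real) \<Rightarrow> bool" where
  "dependency l \<longleftrightarrow> sum l V = 0 \<and> (\<Sum>v\<in>V. l v *\<^sub>R v) = 0"

text \<open>The coefficients on \<open>N\<close> are the free parameters of a dependency; this fills
  in the ones that they force on \<open>B\<close>.\<close>

definition extend :: "('a \<Rightarrow> real) \<Rightarrow> 'a \<Rightarrow> real" where
  "extend \<mu> u = (if u \<in> B then - (\<Sum>v\<in>N. \<mu> v * \<phi> v u) else \<mu> u)"

lemma finite_V: "finite V" using pos by (simp add: convex_position_def)

lemma finite_B: "finite B" by (rule finite_subset[OF BV finite_V])

lemma finite_N: "finite N" by (simp add: N_def finite_V)

lemma N_disj: "v \<in> N \<Longrightarrow> v \<in> V \<and> v \<notin> B" by (simp add: N_def)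

lemma T_subset: "T v \<subseteq> B" by (auto simp: T_def)

lemma finite_T: "finite (T v)" by (rule finite_subset[OF T_subset finite_B])

lemma sum_V: "sum f V = sum f B + sum f N" for f :: "'a \<Rightarrow> 'b::comm_monoid_add"
  unfolding N_def using sum.subset_diff[OF BV finite_V, of f] by (simp add: add.commute)

lemma in_hull_T: "v \<in> V \<Longrightarrow> v \<in> affine hull T v"
proof -
  assume v: "v \<in> V"
  have "sum (\<phi> v) (T v) = sum (\<phi> v) B"
    by (rule sum.mono_neutral_left[OF finite_B]) (auto simp: T_def)
  moreover have "(\<Sum>b\<in>T v. \<phi> v b *\<^sub>R b) = (\<Sum>b\<in>B. \<phi> v b *\<^sub>R b)"
    by (rule sum.mono_neutral_left[OF finite_B]) (auto simp: T_def)
  ultimately show ?thesis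
    using sum_in_affine_hull[OF finite_T, of "\<phi> v" v] chi[OF v] chi_sum[OF v] by simp
qed

text \<open>Substituting the coordinates of the points of \<open>N\<close> rewrites a dependency as
  one of \<open>B\<close> alone, with coefficients \<open>m\<close>; these must vanish.\<close>

lemma dependency_iff: "dependency l \<longleftrightarrow> (\<forall>b\<in>B. l b = - (\<Sum>v\<in>N. l v * \<phi> v b))"
proof -
  define m where "m = (\<lambda>b. l b + (\<Sum>v\<in>N. l v * \<phi> v b))"
  have "sum m B = sum l B + (\<Sum>v\<in>N. l v * sum (\<phi> v) B)"
    unfolding m_def sum.distrib by (subst sum.swap) (simp add: sum_distrib_left)
  also have "(\<Sum>v\<in>N. l v * sum (\<phi> v) B) = sum l N"
    using chi_sum N_disj by (intro sum.cong) auto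
  finally have m0: "sum m B = sum l V" by (simp add: sum_V)
  have "(\<Sum>b\<in>B. m b *\<^sub>R b) = (\<Sum>b\<in>B. l b *\<^sub>R b) + (\<Sum>b\<in>B. \<Sum>v\<in>N. l v *\<^sub>R (\<phi> v b *\<^sub>R b))"
    by (simp add: m_def scaleR_add_left sum.distrib scaleR_sum_left)
  also have "(\<Sum>b\<in>B. \<Sum>v\<in>N. l v *\<^sub>R (\<phi> v b *\<^sub>R b)) = (\<Sum>v\<in>N. l v *\<^sub>R (\<Sum>b\<in>B. \<phi> v b *\<^sub>R b))"
    by (subst sum.swap) (simp only: scaleR_sum_right)
  also have "\<dots> = (\<Sum>v\<in>N. l v *\<^sub>R v)"
    using chi N_disj by (intro sum.cong) auto
  finally have m1: "(\<Sum>b\<in>B. m b *\<^sub>R b) = (\<Sum>v\<in>V. l v *\<^sub>R v)" by (simp add: sum_V)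
  have "dependency l \<longleftrightarrow> (\<forall>b\<in>B. m b = 0)"
  proof
    assume "dependency l"
    then show "\<forall>b\<in>B. m b = 0"
      using affine_independentD[OF indep finite_B, of m] m0 m1 by (simp add: dependency_def)
  next
    assume "\<forall>b\<in>B. m b = 0"
    then show "dependency l" using m0 m1 by (simp add: dependency_def)
  qed
  then show ?thesis by (simp add: m_def eq_neg_iff_add_eq_0)
qed

lemma dependency_extend: "dependency (extend \<mu>)"
  unfolding dependency_iff
proof
  fix b assume "b \<in> B"
  moreover have "(\<Sum>v\<in>N. extend \<mu> v * \<phi> v b) = (\<Sum>v\<in>N. \<mu> v * \<phi> v b)"
    using N_disj by (intro sum.cong) (auto simp: extend_def)
  ultimately show "extend \<mu> b = - (\<Sum>v\<in>N. extend \<mu> v * \<phi> v b)" by (simp add: extend_def)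
qed

lemma extend_N: "v \<in> N \<Longrightarrow> extend \<mu> v = \<mu> v" using N_disj by (simp add: extend_def)

lemma extend_B:
  assumes "b \<in> B" "F \<subseteq> N" "\<And>v. v \<in> N \<Longrightarrow> v \<notin> F \<Longrightarrow> \<mu> v = 0"
  shows "extend \<mu> b = - (\<Sum>v\<in>F. \<mu> v * \<phi> v b)"
proof -
  have "(\<Sum>v\<in>N. \<mu> v * \<phi> v b) = (\<Sum>v\<in>F. \<mu> v * \<phi> v b)"
    using assms by (intro sum.mono_neutral_right finite_N) auto
  then show ?thesis using assms by (simp add: extend_def)
qed

lemma two_positive:
  assumes l: "dependency l" and ne: "v \<in> V" "l v \<noteq> 0"
  shows "card {v \<in> V. l v > 0} \<ge> 2"
proof -
  have "\<exists>u\<in>V. l u > 0"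
  proof (rule ccontr)
    assume "\<not> ?thesis"
    then have "\<And>u. u \<in> V \<Longrightarrow> 0 \<le> - l u" by (simp add: not_less)
    moreover have "sum (\<lambda>u. - l u) V = 0" using l by (simp add: dependency_def sum_negf)
    ultimately have "- l v = 0" using sum_nonneg_eq_0_iff[OF finite_V, of "\<lambda>u. - l u"] ne by auto
    then show False using ne by simp
  qed
  then obtain u where u: "u \<in> V" "l u > 0" by blast
  then obtain u' where u': "u' \<in> V" "u' \<noteq> u" "l u' > 0"
    using convex_position_two_positive[OF pos, of l u] l by (auto simp: dependency_def)
  have "card {u, u'} \<le> card {v \<in> V. l v > 0}"
    using u u' finite_V by (intro card_mono) auto
  then show ?thesis using u' by simp
qed

text \<open>The condition \<open>elem\<close> says that the support of \<open>l\<close> carries only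
  multiples of \<open>l\<close>, that is, it is a circuit. The bound on circuits gives at most four
  elements, and convex position at least two of each sign.\<close>

lemma elementary_dependency:
  assumes l: "dependency l" and ne: "v0 \<in> V" "l v0 \<noteq> 0"
    and elem: "\<And>m. dependency m \<Longrightarrow> (\<And>v. v \<in> V \<Longrightarrow> l v = 0 \<Longrightarrow> m v = 0) \<Longrightarrow> \<exists>t. \<forall>v\<in>N. m v = t * l v"
  shows "card {v \<in> V. l v \<noteq> 0} = 4" "card {v \<in> V. l v > 0} = 2" "card {v \<in> V. l v < 0} = 2"
proof -
  define D where "D = {v \<in> V. l v \<noteq> 0}"
  have DV: "D \<subseteq> V" "finite D" using finite_V by (auto simp: D_def)
  have "sum l D = sum l V" "(\<Sum>v\<in>D. l v *\<^sub>R v) = (\<Sum>v\<in>V. l v *\<^sub>R v)"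
    by (rule sum.mono_neutral_left[OF finite_V]; auto simp: D_def)+
  then have "affine_dependent D"
    unfolding affine_dependent_explicit_finite[OF DV(2)] using l ne
    by (intro exI[of _ l]) (auto simp: dependency_def D_def)
  then obtain E where E: "E \<subseteq> D" "card E \<le> 4" "affine_dependent E"
    by (rule circuits_le_4D[OF circ DV(1)])
  have finE: "finite E" using E(1) DV(2) by (rule finite_subset)
  obtain m' where m': "sum m' E = 0" "\<exists>v\<in>E. m' v \<noteq> 0" "(\<Sum>v\<in>E. m' v *\<^sub>R v) = 0"
    using E(3) unfolding affine_dependent_explicit_finite[OF finE] by blast
  define m where "m = (\<lambda>v. if v \<in> E then m' v else 0)"
  have EV: "E \<subseteq> V" using E DV by blast
  have "sum m V = sum m' E" "(\<Sum>v\<in>V. m v *\<^sub>R v) = (\<Sum>v\<in>E. m' v *\<^sub>R v)"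
    by (rule sum.mono_neutral_cong_right[OF finite_V EV]; simp add: m_def)+
  then have dm: "dependency m" using m' by (simp add: dependency_def)
  moreover have "m v = 0" if "v \<in> V" "l v = 0" for v
    using that E(1) by (auto simp: m_def D_def)
  ultimately obtain t where t: "\<forall>v\<in>N. m v = t * l v" using elem by blast
  \<comment> \<open>\<open>elem\<close> compares only the coefficients on \<open>N\<close>; those on
    \<open>B\<close> are linear in them.\<close>
  have tV: "m v = t * l v" if "v \<in> V" for v
  proof (cases "v \<in> B")
    case True
    have "(\<Sum>u\<in>N. m u * \<phi> u v) = (\<Sum>u\<in>N. t * (l u * \<phi> u v))"
      using t by (intro sum.cong) auto
    then show ?thesis
      using True dm l unfolding dependency_iff by (simp add: sum_distrib_left[symmetric])
  qed (use that t in \<open>simp add: N_def\<close>)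
  have "t \<noteq> 0"
  proof
    assume "t = 0"
    then have "m v = 0" if "v \<in> E" for v using tV that EV by auto
    then show False using m'(2) by (auto simp: m_def)
  qed
  then have "m v \<noteq> 0" if "v \<in> D" for v using that tV by (simp add: D_def)
  then have "D \<subseteq> E" unfolding m_def by (meson subsetI)
  then have "card D \<le> 4" using E(2) card_mono[OF finE] by (meson le_trans)
  moreover have "D = {v \<in> V. l v > 0} \<union> {v \<in> V. l v < 0}" by (auto simp: D_def)
  then have "card D = card {v \<in> V. l v > 0} + card {v \<in> V. l v < 0}"
    using finite_V by (subst card_Un_disjoint[symmetric]) auto
  moreover have "card {v \<in> V. l v > 0} \<ge> 2" by (rule two_positive[OF l ne])
  moreover have "card {v \<in> V. l v < 0} \<ge> 2"
    using two_positive[of "\<lambda>v. - l v" v0] l ne by (simp add: dependency_def sum_negf)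
  ultimately show "card {v \<in> V. l v \<noteq> 0} = 4" "card {v \<in> V. l v > 0} = 2" "card {v \<in> V. l v < 0} = 2"
    by (simp_all add: D_def)
qed

text \<open>This is the fundamental circuit of \<open>v\<close> with respect to \<open>B\<close>.
  Its coefficient at \<open>v\<close> is 1 and those on \<open>B\<close> are
  \<open>- \<phi> v b\<close>, so the pattern 2+2 leaves one negative and two positive
  coordinates.\<close>

lemma card_T:
  assumes v: "v \<in> N"
  shows "card (T v) = 3" "card {b \<in> B. \<phi> v b > 0} = 2" "card {b \<in> B. \<phi> v b < 0} = 1"
proof -
  define l where "l = extend (\<lambda>u. if u = v then 1 else 0)"
  have lB: "l b = - \<phi> v b" if "b \<in> B" for b
    unfolding l_def using extend_B[OF that, of "{v}"] v by simp
  have lN: "l u = (if u = v then 1 else 0)" if "u \<in> N" for u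
    using that by (simp add: l_def extend_N)
  have vV: "v \<in> V" "v \<notin> B" using v N_disj by auto
  have "\<exists>t. \<forall>u\<in>N. m u = t * l u" if "\<And>u. u \<in> V \<Longrightarrow> l u = 0 \<Longrightarrow> m u = 0" for m
    using that lN N_disj by (intro exI[of _ "m v"]) auto
  then have card: "card {v \<in> V. l v \<noteq> 0} = 4" "card {v \<in> V. l v > 0} = 2" "card {v \<in> V. l v < 0} = 2"
    using elementary_dependency[of l v] lN[OF v] vV dependency_extend l_def by simp_all
  have V: "u \<in> V \<longleftrightarrow> u \<in> B \<or> u \<in> N" for u using BV by (auto simp: N_def)
  have "{u \<in> V. l u \<noteq> 0} = insert v (T v)" "{u \<in> V. l u > 0} = insert v {b \<in> B. \<phi> v b < 0}"
    "{u \<in> V. l u < 0} = {b \<in> B. \<phi> v b > 0}"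
    using v lB lN N_disj by (auto simp: V T_def split: if_splits)
  then show "card (T v) = 3" "card {b \<in> B. \<phi> v b > 0} = 2" "card {b \<in> B. \<phi> v b < 0} = 1"
    using card vV finite_B finite_T by (simp_all add: T_def)
qed

text \<open>Eliminate \<open>a\<close> from the fundamental circuits of \<open>v\<close> and
  \<open>w\<close>. The result is elementary since vanishing at \<open>a\<close> fixes the ratio of
  the coefficients at \<open>v\<close> and \<open>w\<close>. Of its four elements, two are
  \<open>v\<close> and \<open>w\<close>; the others are where the 2x2 minor with column
  \<open>a\<close> is nonzero.\<close>

lemma card_minors:
  assumes v: "v \<in> N" and w: "w \<in> N" and vw: "v \<noteq> w" and a: "a \<in> T v" "a \<in> T w"
  shows "card {b \<in> B. \<phi> w a * \<phi> v b \<noteq> \<phi> v a * \<phi> w b} = 2"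
proof -
  define l where "l = extend (\<lambda>u. if u = v then \<phi> w a else if u = w then - \<phi> v a else 0)"
  have lB: "l b = - (\<phi> w a * \<phi> v b - \<phi> v a * \<phi> w b)" if "b \<in> B" for b
    unfolding l_def using extend_B[OF that, of "{v, w}"] v w vw by simp
  have lN: "l u = (if u = v then \<phi> w a else if u = w then - \<phi> v a else 0)" if "u \<in> N" for u
    using that by (simp add: l_def extend_N)
  have nz: "\<phi> v a \<noteq> 0" "\<phi> w a \<noteq> 0" "a \<in> B" using a by (auto simp: T_def)
  have "\<exists>t. \<forall>u\<in>N. m u = t * l u" if m: "dependency m" and zero: "\<And>u. u \<in> V \<Longrightarrow> l u = 0 \<Longrightarrow> m u = 0" for m
  proof -
    have mN: "m u = 0" if "u \<in> N" "u \<noteq> v" "u \<noteq> w" for u using zero[of u] that lN N_disj by simp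
    have "m a = 0" using zero[of a] lB[OF nz(3)] nz(3) BV by auto
    moreover have "m a = - (\<Sum>u\<in>N. m u * \<phi> u a)" using m nz(3) by (simp add: dependency_iff)
    moreover have "(\<Sum>u\<in>N. m u * \<phi> u a) = (\<Sum>u\<in>{v, w}. m u * \<phi> u a)"
      using v w mN by (intro sum.mono_neutral_right finite_N) auto
    ultimately have "m v * \<phi> v a + m w * \<phi> w a = 0" using vw by simp
    then have "m w = - (m v / \<phi> w a) * \<phi> v a" using nz by (simp add: field_simps)
    then show ?thesis
      using lN mN nz vw by (intro exI[of _ "m v / \<phi> w a"]) auto
  qed
  then have card: "card {u \<in> V. l u \<noteq> 0} = 4"
    using elementary_dependency(1)[of l v] lN[OF v] v N_disj nz dependency_extend l_def by simp
  have V: "u \<in> V \<longleftrightarrow> u \<in> B \<or> u \<in> N" for u using BV by (auto simp: N_def)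
  have "{u \<in> V. l u \<noteq> 0} = {v, w} \<union> {b \<in> B. \<phi> w a * \<phi> v b \<noteq> \<phi> v a * \<phi> w b}"
    using v w lB lN N_disj nz by (auto simp: V split: if_splits)
  also have "card \<dots> = card {v, w} + card {b \<in> B. \<phi> w a * \<phi> v b \<noteq> \<phi> v a * \<phi> w b}"
    using v w N_disj finite_B by (intro card_Un_disjoint) auto
  finally show ?thesis using card vw by simp
qed

text \<open>On the symmetric difference of the supports the minors with a common column are nonzero,
  so it has at most two elements. As both supports have three, each loses at most one.\<close>

lemma T_Int:
  assumes v: "v \<in> N" and w: "w \<in> N" and ne: "T v \<inter> T w \<noteq> {}"
  shows "card (T v \<inter> T w) \<ge> 2"
proof (cases "v = w")
  case True
  then show ?thesis using card_T(1)[OF v] by simp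
next
  case False
  obtain a where a: "a \<in> T v" "a \<in> T w" using ne by blast
  define M where "M = {b \<in> B. \<phi> w a * \<phi> v b \<noteq> \<phi> v a * \<phi> w b}"
  have finM: "finite M" using finite_B by (simp add: M_def)
  have "(T v - T w) \<union> (T w - T v) \<subseteq> M" using a by (auto simp: M_def T_def)
  then have "card ((T v - T w) \<union> (T w - T v)) \<le> 2"
    using card_minors[OF v w False a] card_mono[OF finM] by (simp add: M_def)
  moreover have "card ((T v - T w) \<union> (T w - T v)) = card (T v - T w) + card (T w - T v)"
    using finite_T by (intro card_Un_disjoint) auto
  moreover have "card (T v - T w) = 3 - card (T v \<inter> T w)" "card (T w - T v) = 3 - card (T v \<inter> T w)"
    using card_Diff_subset_Int[of "T v" "T w"] card_Diff_subset_Int[of "T w" "T v"]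
      card_T(1) v w finite_T by (simp_all add: Int_commute)
  ultimately show ?thesis by linarith
qed

text \<open>The two elements outside the intersection already use up the two nonzero minors.\<close>

lemma T_proportional:
  assumes v: "v \<in> N" and w: "w \<in> N" and ne: "T v \<noteq> T w" and ab: "a \<in> T v \<inter> T w" "b \<in> T v \<inter> T w"
  shows "\<phi> w a * \<phi> v b = \<phi> v a * \<phi> w b"
proof (rule ccontr)
  assume neq: "\<not> ?thesis"
  have vw: "v \<noteq> w" using ne by blast
  define M where "M = {b \<in> B. \<phi> w a * \<phi> v b \<noteq> \<phi> v a * \<phi> w b}"
  have finM: "finite M" using finite_B by (simp add: M_def)
  have cM: "card M = 2" unfolding M_def using card_minors[OF v w vw] ab by blast
  have "\<not> T v \<subseteq> T w" "\<not> T w \<subseteq> T v"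
    using ne card_subset_eq[OF finite_T] card_T(1) v w by metis+
  then obtain c d where c: "c \<in> T v" "c \<notin> T w" and d: "d \<in> T w" "d \<notin> T v" by blast
  have "{b, c, d} \<subseteq> M" using neq ab c d by (auto simp: M_def T_def)
  moreover have "card {b, c, d} = 3" using ab c d by (auto simp: card_insert_if)
  ultimately show False using cM card_mono[OF finM, of "{b, c, d}"] by simp
qed

text \<open>If the minor of \<open>a\<close> and \<open>b\<close> vanished, only the third element
  of the common support would remain for two nonzero minors.\<close>

lemma T_not_proportional:
  assumes v: "v \<in> N" and w: "w \<in> N" and vw: "v \<noteq> w" and eq: "T v = T w"
    and ab: "a \<in> T v" "b \<in> T v" "a \<noteq> b"
  shows "\<phi> w a * \<phi> v b \<noteq> \<phi> v a * \<phi> w b"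
proof
  assume eq': "\<phi> w a * \<phi> v b = \<phi> v a * \<phi> w b"
  define M where "M = {b \<in> B. \<phi> w a * \<phi> v b \<noteq> \<phi> v a * \<phi> w b}"
  have cM: "card M = 2" unfolding M_def using card_minors[OF v w vw, of a] ab(1) eq by simp
  have "M \<subseteq> T v \<union> T w" by (auto simp: M_def T_def)
  moreover have "a \<notin> M" "b \<notin> M" using eq' by (auto simp: M_def)
  ultimately have "M \<subseteq> T v - {a, b}" using eq by blast
  then have "card M \<le> card (T v - {a, b})" by (intro card_mono) (simp_all add: finite_T)
  also have "\<dots> = 1" using ab card_T(1)[OF v] finite_T by (simp add: card_Diff_subset)
  finally show False using cM by simp
qed

text \<open>Three supports inside a four-element set would give a dual Fano configuration. Over the reals,
  the combination of \<open>v\<close>, \<open>w\<close>, \<open>u\<close> killing \<open>b\<close> and \<open>c\<close> is a circuit with five elements.\<close>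

lemma no_triangle:
  assumes v: "v \<in> N" and w: "w \<in> N" and u: "u \<in> N" and dist: "distinct [a, b, c, d]"
    and T: "T v = {a, b, c}" "T w = {a, b, d}" "T u = {a, c, d}"
  shows False
proof -
  have neq: "v \<noteq> w" "v \<noteq> u" "w \<noteq> u" using T dist by auto
  have TB: "{a, b, c, d} \<subseteq> B" using T T_subset by (metis Un_insert_right insert_subset)
  have nz: "\<phi> v a \<noteq> 0" "\<phi> v b \<noteq> 0" "\<phi> v c \<noteq> 0" "\<phi> w a \<noteq> 0" "\<phi> w b \<noteq> 0" "\<phi> w d \<noteq> 0"
    "\<phi> u a \<noteq> 0" "\<phi> u c \<noteq> 0" "\<phi> u d \<noteq> 0"
    using T unfolding T_def by blast+
  have z: "\<phi> v x = 0" if "x \<in> B" "x \<notin> {a, b, c}" for x using that T(1) by (auto simp: T_def)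
  have z': "\<phi> w x = 0" if "x \<in> B" "x \<notin> {a, b, d}" for x using that T(2) by (auto simp: T_def)
  have z'': "\<phi> u x = 0" if "x \<in> B" "x \<notin> {a, c, d}" for x using that T(3) by (auto simp: T_def)
  have Tne: "T v \<noteq> T w" "T v \<noteq> T u" "T w \<noteq> T u" using T dist by auto
  have p1: "\<phi> w a * \<phi> v b = \<phi> v a * \<phi> w b" by (rule T_proportional[OF v w Tne(1)]) (simp_all add: T)
  have p2: "\<phi> u a * \<phi> v c = \<phi> v a * \<phi> u c" by (rule T_proportional[OF v u Tne(2)]) (simp_all add: T)
  have p3: "\<phi> u a * \<phi> w d = \<phi> w a * \<phi> u d" by (rule T_proportional[OF w u Tne(3)]) (simp_all add: T)
  \<comment> \<open>In \<open>v - r w - s u\<close> the coordinates at \<open>b\<close> and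
    \<open>c\<close> cancel.\<close>
  define r where "r = \<phi> v b / \<phi> w b"
  define s where "s = \<phi> v c / \<phi> u c"
  have rs: "r \<noteq> 0" "s \<noteq> 0" using nz by (simp_all add: r_def s_def)
  have ra: "r * \<phi> w a = \<phi> v a" using p1 nz by (simp add: r_def field_simps)
  have sa: "s * \<phi> u a = \<phi> v a" using p2 nz by (simp add: s_def field_simps)
  have rd: "r * \<phi> w d = s * \<phi> u d"
  proof -
    have "\<phi> u a * (r * \<phi> w d) = (r * \<phi> w a) * \<phi> u d" using p3 by simp
    also have "\<dots> = (s * \<phi> u a) * \<phi> u d" using ra sa by simp
    also have "\<dots> = \<phi> u a * (s * \<phi> u d)" by simp
    finally show ?thesis using nz by simp
  qed
  define l where "l = extend (\<lambda>x. if x = v then 1 else if x = w then - r else if x = u then - s else 0)"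
  have lB: "l x = - (\<phi> v x - r * \<phi> w x - s * \<phi> u x)" if "x \<in> B" for x
    unfolding l_def using extend_B[OF that, of "{v, w, u}"] v w u neq by simp
  have lN: "l x = (if x = v then 1 else if x = w then - r else if x = u then - s else 0)" if "x \<in> N" for x
    using that by (simp add: l_def extend_N)
  have dist': "b \<noteq> a" "c \<noteq> a" "c \<noteq> b" "d \<noteq> a" "d \<noteq> b" "d \<noteq> c" using dist by auto
  have lb: "l b = 0" using lB[of b] z''[of b] TB dist dist' nz by (simp add: r_def)
  have lc: "l c = 0" using lB[of c] z'[of c] TB dist dist' nz by (simp add: s_def)
  \<comment> \<open>By the proportionalities, \<open>l a\<close> is \<open>\<phi> v a\<close> and
    \<open>l d\<close> is twice \<open>r * \<phi> w d\<close>. In characteristic 2 the latter would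
    vanish, which is where the Fano exception comes from.\<close>
  have la: "l a \<noteq> 0" using lB[of a] TB ra sa nz by simp
  have ld: "l d \<noteq> 0" using lB[of d] z[of d] TB dist' rd rs nz by simp
  have "\<exists>t. \<forall>x\<in>N. m x = t * l x" if m: "dependency m" and zero: "\<And>x. x \<in> V \<Longrightarrow> l x = 0 \<Longrightarrow> m x = 0" for m
  proof -
    have mN: "m x = 0" if "x \<in> N" "x \<noteq> v" "x \<noteq> w" "x \<noteq> u" for x using zero[of x] that lN N_disj by simp
    have mB: "m x = - (m v * \<phi> v x + m w * \<phi> w x + m u * \<phi> u x)" if "x \<in> B" for x
    proof -
      have "(\<Sum>y\<in>N. m y * \<phi> y x) = (\<Sum>y\<in>{v, w, u}. m y * \<phi> y x)"
        using v w u mN by (intro sum.mono_neutral_right finite_N) auto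
      then show ?thesis using m that neq by (simp add: dependency_iff)
    qed
    have "m b = 0" "m c = 0" using zero lb lc TB BV by auto
    then have "m v * \<phi> v b + m w * \<phi> w b = 0" "m v * \<phi> v c + m u * \<phi> u c = 0"
      using mB[of b] mB[of c] z''[of b] z'[of c] TB dist by auto
    then have "m w * \<phi> w b = (m v * - r) * \<phi> w b" "m u * \<phi> u c = (m v * - s) * \<phi> u c"
      using nz by (simp_all add: r_def s_def eq_neg_iff_add_eq_0 add.commute)
    then have "m w = m v * - r" "m u = m v * - s" using nz mult_right_cancel by blast+
    then show ?thesis using lN mN by (intro exI[of _ "m v"]) auto
  qed
  then have "card {x \<in> V. l x \<noteq> 0} = 4"
    using elementary_dependency(1)[of l v] lN[OF v] v N_disj dependency_extend l_def by simp
  moreover have "{v, w, u, a, d} \<subseteq> {x \<in> V. l x \<noteq> 0}"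
    using la ld lN v w u neq rs N_disj TB BV by auto
  then have "card {v, w, u, a, d} \<le> card {x \<in> V. l x \<noteq> 0}" by (intro card_mono) (simp_all add: finite_V)
  moreover have "card {v, w, u, a, d} = 5"
  proof -
    have "v \<notin> {w, u, a, d}" "w \<notin> {u, a, d}" "u \<notin> {a, d}" "a \<notin> {d}"
      using v w u neq N_disj TB dist by auto
    then show ?thesis by simp
  qed
  ultimately show False by simp
qed

text \<open>Two disjoint intersections with at least two elements each do not fit into the three
  elements of \<open>T v\<close>. Meeting supports is thus an equivalence relation on
  \<open>N\<close>.\<close>

lemma T_meets_trans:
  assumes "u \<in> N" "v \<in> N" "w \<in> N" "T u \<inter> T v \<noteq> {}" "T v \<inter> T w \<noteq> {}"
  shows "T u \<inter> T w \<noteq> {}"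
proof
  assume disj: "T u \<inter> T w = {}"
  have "card ((T u \<inter> T v) \<union> (T v \<inter> T w)) = card (T u \<inter> T v) + card (T v \<inter> T w)"
    using disj finite_T by (intro card_Un_disjoint) auto
  moreover have "card ((T u \<inter> T v) \<union> (T v \<inter> T w)) \<le> card (T v)"
    by (intro card_mono finite_T) auto
  ultimately show False using T_Int[of u v] T_Int[of v w] card_T(1)[of v] assms by simp
qed

section \<open>Blocks of points with meeting supports\<close>

definition block :: "'a \<Rightarrow> 'a set" where "block v = {w \<in> N. T w \<inter> T v \<noteq> {}}"

definition block_basis :: "'a \<Rightarrow> 'a set" where "block_basis v = (\<Union>w\<in>block v. T w)"

lemma block_N: "w \<in> block v \<Longrightarrow> w \<in> N" by (simp add: block_def)

lemma block_self: "v \<in> N \<Longrightarrow> v \<in> block v"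
  using card_T(1)[of v] by (auto simp: block_def)

lemma block_basis_subset: "block_basis v \<subseteq> B"
  using T_subset by (auto simp: block_basis_def)

lemma T_disjoint_block_basis:
  assumes "v \<in> N" "w \<in> N" "w \<notin> block v"
  shows "T w \<inter> block_basis v = {}"
proof (rule ccontr)
  assume "\<not> ?thesis"
  then obtain u where "u \<in> N" "T u \<inter> T v \<noteq> {}" "T w \<inter> T u \<noteq> {}"
    by (auto simp: block_basis_def block_def)
  then show False using T_meets_trans[of w u v] assms by (simp add: block_def)
qed

lemma in_hull_of_T_subset: "w \<in> V \<Longrightarrow> T w \<subseteq> S \<Longrightarrow> w \<in> affine hull S"
  using in_hull_T hull_mono by blast

lemma hull_block: "affine hull (block v \<union> block_basis v) = affine hull (block_basis v)"
proof
  have "w \<in> affine hull (block_basis v)" if "w \<in> block v" for w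
    by (rule in_hull_of_T_subset) (use that N_disj in \<open>auto simp: block_def block_basis_def\<close>)
  then show "affine hull (block v \<union> block_basis v) \<subseteq> affine hull (block_basis v)"
    by (intro hull_minimal) (auto simp: hull_inc)
  show "affine hull (block_basis v) \<subseteq> affine hull (block v \<union> block_basis v)"
    by (intro hull_mono) auto
qed

text \<open>A support without \<open>a\<close> that meets both others in two elements must be
  \<open>{b, c, d}\<close>, and the three supports would form the configuration excluded by
  \<open>no_triangle\<close>.\<close>

lemma block_support:
  assumes v: "v \<in> N" and w: "w \<in> block v" and T: "T v = {a, b, c}" "T w = {a, b, d}"
    and dist: "distinct [a, b, c, d]" and u: "u \<in> block v"
  shows "a \<in> T u"
proof (rule ccontr)
  assume a: "a \<notin> T u"
  have N: "w \<in> N" "u \<in> N" "T u \<inter> T v \<noteq> {}" "T v \<inter> T w \<noteq> {}"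
    using u w by (auto simp: block_def)
  then have meets: "T u \<inter> T w \<noteq> {}" using T_meets_trans[of u v w] v by blast
  have two: "{x, y} \<subseteq> S" if "card S \<ge> 2" "S \<subseteq> {x, y}" for S and x y :: 'a
  proof -
    have "card {x, y} \<le> 2" by (simp add: card_insert_if)
    then have "S = {x, y}" using that by (intro card_seteq) auto
    then show ?thesis by simp
  qed
  have "{b, c} \<subseteq> T u \<inter> T v"
    using a T by (intro two T_Int[OF N(2) v N(3)]) auto
  moreover have "{b, d} \<subseteq> T u \<inter> T w"
    using a T by (intro two T_Int[OF N(2) N(1) meets]) auto
  ultimately have "{b, c, d} \<subseteq> T u" by blast
  moreover have "card {b, c, d} = 3" using dist by simp
  ultimately have "T u = {b, c, d}" using card_T(1)[OF N(2)] card_subset_eq[OF finite_T] by metis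
  moreover have "T v = {b, a, c}" "T w = {b, a, d}" using T by auto
  ultimately show False
    using no_triangle[OF v N(1) N(2), of b a c d] dist by auto
qed

end

text \<open>Exchanging \<open>x i\<close> and \<open>y i\<close> wherever \<open>\<alpha> i\<close>
  is negative puts the positive weight on the same side in all pairs.\<close>

lemma (in paired_points) realizable_opposite_signs:
  assumes injx: "inj_on x I" and opp: "\<And>i. i \<in> I \<Longrightarrow> \<alpha> i * \<beta> i < 0"
  shows "realizable_as_join (x ` I \<union> y ` I)"
proof -
  define x' where "x' = (\<lambda>i. if \<alpha> i > 0 then x i else y i)"
  define y' where "y' = (\<lambda>i. if \<alpha> i > 0 then y i else x i)"
  define \<alpha>' where "\<alpha>' = (\<lambda>i. if \<alpha> i > 0 then \<alpha> i else \<beta> i)"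
  define \<beta>' where "\<beta>' = (\<lambda>i. if \<alpha> i > 0 then \<beta> i else \<alpha> i)"
  have Un: "x' ` I \<union> y' ` I = x ` I \<union> y ` I" by (auto simp: x'_def y'_def)
  have signs: "\<alpha>' i > 0" "\<beta>' i < 0" if "i \<in> I" for i
    using opp[OF that] by (auto simp: \<alpha>'_def \<beta>'_def mult_less_0_iff)
  have xy: "x i \<noteq> y j" if "i \<in> I" "j \<in> I" for i j using disj that by blast
  have injs: "i = j" if "i \<in> I" "j \<in> I" "x i = x j \<or> y i = y j" for i j
    using that injx injy by (auto simp: inj_on_def)
  interpret flip: paired_points I x' y' \<alpha>' \<beta>' p s k
  proof
    show "\<alpha>' i *\<^sub>R x' i + \<beta>' i *\<^sub>R y' i = p" if "i \<in> I" for i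
      using rel[OF that] by (simp add: x'_def y'_def \<alpha>'_def \<beta>'_def add.commute)
    show "\<alpha>' i + \<beta>' i = s" if "i \<in> I" for i
      using weight[OF that] by (simp add: \<alpha>'_def \<beta>'_def add.commute)
    show "\<beta>' i \<noteq> 0" if "i \<in> I" for i using signs[OF that] by simp
    show "aff_dim (x' ` I \<union> y' ` I) = int (card I)" unfolding Un by (rule dim)
    show "x' ` I \<inter> y' ` I = {}"
    proof -
      have "x' i \<noteq> y' j" if "i \<in> I" "j \<in> I" for i j
      proof
        assume "x' i = y' j"
        then have "i = j" "(\<alpha> i > 0) \<noteq> (\<alpha> j > 0)"
          using xy[OF that] xy[OF that(2,1)] injs[OF that] by (auto simp: x'_def y'_def split: if_splits)
        then show False by simp
      qed
      then show ?thesis by blast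
    qed
    show "inj_on y' I"
    proof (rule inj_onI)
      fix i j assume "i \<in> I" "j \<in> I" "y' i = y' j"
      then show "i = j" using xy[of i j] xy[of j i] injs[of i j] by (auto simp: y'_def split: if_splits)
    qed
  qed (rule finI k)+
  show ?thesis using flip.realizable_prism[OF signs] Un by simp
qed

context basis_coordinates
begin

text \<open>If all supports coincide, the block lies in the plane of one of them. Otherwise the
  coordinates at the shared \<open>a\<close> and \<open>b\<close> have the same ratio \<rho>
  throughout, so moving the third term of \<open>u\<close> to the other side leaves a multiple of
  the common vector \<open>a + \<rho> *\<^sub>R b\<close>.\<close>

lemma realizable_block:
  assumes v: "v \<in> N"
  shows "realizable_as_join (block v \<union> block_basis v)"
proof (cases "\<forall>w\<in>block v. T w = T v")
  case True
  then have "block_basis v = (\<Union>w\<in>block v. T v)" by (simp add: block_basis_def)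
  then have B1: "block_basis v = T v" using block_self[OF v] by auto
  have "\<not> affine_dependent (T v)" using indep T_subset affine_independent_subset by blast
  then have "aff_dim (T v) = 2" using card_T(1)[OF v] affine_independent_iff_card[of "T v"] by simp
  then have "aff_dim (block v \<union> block_basis v) = 2"
    using hull_block[of v] by (metis B1 aff_dim_affine_hull)
  moreover have "finite (block v \<union> block_basis v)"
    using finite_N finite_T by (simp add: B1 block_def)
  ultimately show ?thesis by (intro realizable_as_join_polygon)
next
  case False
  then obtain w where w: "w \<in> block v" "T w \<noteq> T v" by blast
  have wN: "w \<in> N" and "T v \<inter> T w \<noteq> {}" using w(1) by (auto simp: block_def)
  then have ge: "card (T v \<inter> T w) \<ge> 2" using T_Int v by blast
  obtain Y where "Y \<subseteq> T v \<inter> T w" "card Y = 2" by (metis obtain_subset_with_card_n[OF ge])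
  then obtain a b where ab: "a \<noteq> b" "a \<in> T v" "b \<in> T v" "a \<in> T w" "b \<in> T w" by (auto simp: card_2_iff)
  have "\<not> T v \<subseteq> T w" "\<not> T w \<subseteq> T v"
    using w(2) card_subset_eq[OF finite_T] card_T(1) v wN by metis+
  then obtain c d where c: "c \<in> T v" "c \<notin> T w" and d: "d \<in> T w" "d \<notin> T v" by blast
  have three: "T u = {a, b, e}" if "u \<in> N" "{a, b, e} \<subseteq> T u" "e \<noteq> a" "e \<noteq> b" for u e
  proof -
    have "card {a, b, e} = card (T u)" using card_T(1)[OF that(1)] that ab by (simp add: card_insert_if)
    then show ?thesis using that(2) card_subset_eq[OF finite_T] by metis
  qed
  have Tv: "T v = {a, b, c}" by (rule three) (use v ab c in auto)
  have Tw: "T w = {a, b, d}" by (rule three) (use wN ab d in auto)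
  have dist: "distinct [a, b, c, d]" using ab c d by auto
  define K where "K = block v"
  have KN: "u \<in> N" if "u \<in> K" for u using that by (simp add: K_def block_def)
  have abT: "a \<in> T u" "b \<in> T u" if u: "u \<in> K" for u
  proof -
    show "a \<in> T u" by (rule block_support[OF v w(1) Tv Tw dist]) (use u in \<open>simp add: K_def\<close>)
    show "b \<in> T u"
      by (rule block_support[OF v w(1), of b a c d]) (use u Tv Tw dist in \<open>auto simp: K_def\<close>)
  qed
  have "\<exists>e. T u = {a, b, e} \<and> e \<noteq> a \<and> e \<noteq> b" if u: "u \<in> K" for u
  proof -
    have "card (T u - {a, b}) = 1"
      using card_T(1)[OF KN[OF u]] abT[OF u] ab(1) finite_T by (simp add: card_Diff_subset)
    then obtain e where "T u - {a, b} = {e}" by (rule card_1_singletonE)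
    then have "T u = {a, b, e}" "e \<noteq> a" "e \<noteq> b" using abT[OF u] by auto
    then show ?thesis by blast
  qed
  then obtain cs where cs: "\<And>u. u \<in> K \<Longrightarrow> T u = {a, b, cs u} \<and> cs u \<noteq> a \<and> cs u \<noteq> b" by metis
  have nz: "\<phi> u a \<noteq> 0" "\<phi> u b \<noteq> 0" "\<phi> u (cs u) \<noteq> 0" "cs u \<in> B" if "u \<in> K" for u
    using cs[OF that] unfolding T_def by blast+
  have aB: "a \<in> B" "b \<in> B" using ab T_subset by auto
  have vK: "v \<in> K" using block_self[OF v] by (simp add: K_def)
  have wK: "w \<in> K" using w by (simp add: K_def)
  have prop_ne: "\<phi> u b * \<phi> u' a = \<phi> u a * \<phi> u' b" if "u \<in> K" "u' \<in> K" "T u \<noteq> T u'" for u u'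
    using T_proportional[OF KN[OF that(1)] KN[OF that(2)] that(3), of a b] abT that by (simp add: mult.commute)
  \<comment> \<open>\<open>T_proportional\<close> requires different supports; if \<open>u\<close>
    has the support of \<open>v\<close>, the comparison goes through \<open>w\<close>.\<close>
  have propv: "\<phi> u b * \<phi> v a = \<phi> u a * \<phi> v b" if u: "u \<in> K" for u
  proof (cases "T u = T v")
    case True
    then have "T u \<noteq> T w" using w(2) by simp
    then have 1: "\<phi> u b * \<phi> w a = \<phi> u a * \<phi> w b" and 2: "\<phi> v b * \<phi> w a = \<phi> v a * \<phi> w b"
      using prop_ne u wK vK w(2) by metis+
    have "\<phi> w a * (\<phi> u b * \<phi> v a) = (\<phi> u b * \<phi> w a) * \<phi> v a" by simp
    also have "\<dots> = \<phi> u a * (\<phi> v a * \<phi> w b)" using 1 by simp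
    also have "\<dots> = \<phi> w a * (\<phi> u a * \<phi> v b)" using 2 by (simp flip: 2)
    finally show ?thesis using nz(1)[OF wK] by simp
  qed (use prop_ne u vK in blast)
  define \<rho> where "\<rho> = \<phi> v b / \<phi> v a"
  have ratio: "\<phi> u b = \<rho> * \<phi> u a" if "u \<in> K" for u
    using propv[OF that] nz(1)[OF vK] by (simp add: \<rho>_def field_simps)
  have \<rho>0: "\<rho> \<noteq> 0" using nz[OF vK] by (simp add: \<rho>_def)
  \<comment> \<open>Equal third elements mean equal supports, for which
    \<open>T_not_proportional\<close> contradicts the constant ratio.\<close>
  have inj_cs: "inj_on cs K"
  proof (rule inj_onI, rule ccontr)
    fix u u' assume u: "u \<in> K" "u' \<in> K" "cs u = cs u'" "u \<noteq> u'"
    then have "T u = T u'" using cs by metis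
    then have "\<phi> u' a * \<phi> u b \<noteq> \<phi> u a * \<phi> u' b"
      by (intro T_not_proportional) (use u KN abT ab(1) in auto)
    then show False using ratio u by simp
  qed
  have split: "\<phi> u a *\<^sub>R a + \<phi> u b *\<^sub>R b + \<phi> u (cs u) *\<^sub>R cs u = u"
    "\<phi> u a + \<phi> u b + \<phi> u (cs u) = 1" if u: "u \<in> K" for u
  proof -
    have uV: "u \<in> V" using KN[OF u] N_disj by blast
    have d: "a \<notin> {b, cs u}" "b \<notin> {cs u}" using cs[OF u] ab(1) by auto
    have "(\<Sum>e\<in>B. \<phi> u e *\<^sub>R e) = (\<Sum>e\<in>T u. \<phi> u e *\<^sub>R e)" "sum (\<phi> u) B = sum (\<phi> u) (T u)"
      by (rule sum.mono_neutral_right[OF finite_B]; auto simp: T_def)+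
    then show "\<phi> u a *\<^sub>R a + \<phi> u b *\<^sub>R b + \<phi> u (cs u) *\<^sub>R cs u = u" "\<phi> u a + \<phi> u b + \<phi> u (cs u) = 1"
      using chi[OF uV] chi_sum[OF uV] conjunct1[OF cs[OF u]] d by (simp_all add: add.assoc)
  qed
  \<comment> \<open>The index \<open>a\<close>, which is not in \<open>K\<close>, stands for the
    pair \<open>a\<close>, \<open>b\<close>; an index \<open>u\<close> of \<open>K\<close> stands
    for the pair \<open>cs u\<close>, \<open>u\<close>. The weights arise by dividing the coordinate
    relation of \<open>u\<close> by \<open>\<phi> u a\<close>.\<close>
  define I where "I = insert a K"
  define x where "x = (\<lambda>i. if i = a then a else cs i)"
  define y where "y = (\<lambda>i. if i = a then b else i)"
  define \<alpha> where "\<alpha> = (\<lambda>i. if i = a then 1 else - \<phi> i (cs i) / \<phi> i a)"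
  define \<beta> where "\<beta> = (\<lambda>i. if i = a then \<rho> else 1 / \<phi> i a)"
  have KB: "u \<notin> B" if "u \<in> K" for u using KN[OF that] N_disj by blast
  then have aK: "a \<notin> K" "b \<notin> K" using aB by auto
  have finK: "finite K" using finite_N by (simp add: K_def block_def)
  have xK: "x u = cs u" "y u = u" "\<alpha> u = - \<phi> u (cs u) / \<phi> u a" "\<beta> u = 1 / \<phi> u a" if "u \<in> K" for u
    using that aK by (auto simp: x_def y_def \<alpha>_def \<beta>_def)
  have xa: "x a = a" "y a = b" "\<alpha> a = 1" "\<beta> a = \<rho>" by (simp_all add: x_def y_def \<alpha>_def \<beta>_def)
  have xI: "x ` I = insert a (cs ` K)" using xK(1) xa(1) by (auto simp: I_def image_iff)
  have yI: "y ` I = insert b K" using xK(2) xa(2) by (auto simp: I_def image_iff)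
  have bb: "block_basis v = insert b (x ` I)"
  proof -
    have "block_basis v = (\<Union>u\<in>K. {a, b, cs u})" unfolding block_basis_def K_def[symmetric] using cs by auto
    then show ?thesis using vK by (auto simp: xI)
  qed
  have Un: "x ` I \<union> y ` I = block v \<union> block_basis v" using bb by (auto simp: yI K_def)
  have injx: "inj_on x I"
    unfolding I_def
  proof (rule inj_on_insert[THEN iffD2], intro conjI)
    show "inj_on x K" using inj_cs xK(1) by (simp add: inj_on_def)
    show "x a \<notin> x ` (K - {a})" using xa(1) xK(1) cs by auto
  qed
  have bx: "b \<notin> x ` I" using ab(1) cs by (auto simp: xI)
  interpret pairs: paired_points I x y \<alpha> \<beta> "a + \<rho> *\<^sub>R b" "1 + \<rho>" a
  proof
    show "finite I" "a \<in> I" using finK by (simp_all add: I_def)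
    fix i assume "i \<in> I"
    then consider "i = a" | "i \<in> K" by (auto simp: I_def)
    then show "\<alpha> i *\<^sub>R x i + \<beta> i *\<^sub>R y i = a + \<rho> *\<^sub>R b"
    proof cases
      case 2
      have "\<alpha> i *\<^sub>R x i + \<beta> i *\<^sub>R y i = (1 / \<phi> i a) *\<^sub>R (i - \<phi> i (cs i) *\<^sub>R cs i)"
        using 2 by (simp add: xK scaleR_diff_right)
      also have "i - \<phi> i (cs i) *\<^sub>R cs i = \<phi> i a *\<^sub>R a + \<phi> i b *\<^sub>R b"
        using split(1)[OF 2] by (metis add_diff_cancel_right')
      also have "(1 / \<phi> i a) *\<^sub>R \<dots> = a + \<rho> *\<^sub>R b"
        using nz(1)[OF 2] by (simp add: ratio[OF 2] scaleR_add_right)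
      finally show ?thesis .
    qed (simp add: xa)
    from \<open>i \<in> I\<close> consider "i = a" | "i \<in> K" by (auto simp: I_def)
    then show "\<alpha> i + \<beta> i = 1 + \<rho>"
    proof cases
      case 2
      have "\<alpha> i + \<beta> i = (1 - \<phi> i (cs i)) / \<phi> i a" using 2 by (simp add: xK diff_divide_distrib)
      also have "1 - \<phi> i (cs i) = \<phi> i a * (1 + \<rho>)" using split(2)[OF 2] ratio[OF 2] by (simp add: algebra_simps)
      finally show ?thesis using nz(1)[OF 2] by simp
    qed (simp add: xa)
    from \<open>i \<in> I\<close> show "\<beta> i \<noteq> 0" using \<rho>0 nz(1) xK(4) xa(4) by (auto simp: I_def)
  next
    have "\<not> affine_dependent (block_basis v)"
      using indep block_basis_subset affine_independent_subset by blast
    then have "aff_dim (block_basis v) = int (card (block_basis v)) - 1"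
      using affine_independent_iff_card by blast
    moreover have "card (block_basis v) = card I + 1"
    proof -
      have "card (x ` I) = card I" by (rule card_image[OF injx])
      moreover have "finite (x ` I)" using finK by (simp add: I_def)
      ultimately show ?thesis using bx by (simp add: bb)
    qed
    ultimately show "aff_dim (x ` I \<union> y ` I) = int (card I)"
      using hull_block[of v] unfolding Un by (metis add_diff_cancel_right' aff_dim_affine_hull of_nat_1 of_nat_add)
    show "x ` I \<inter> y ` I = {}" using bx KB nz(4) aB by (auto simp: xI yI)
    show "inj_on y I"
      unfolding I_def
    proof (rule inj_on_insert[THEN iffD2], intro conjI)
      show "inj_on y K" using xK(2) by (simp add: inj_on_def)
      show "y a \<notin> y ` (K - {a})" using xa(2) xK(2) aK by auto
    qed
  qed
  have no_two_neg: "\<not> (\<phi> u e < 0 \<and> \<phi> u e' < 0)" if "u \<in> K" "e \<in> B" "e' \<in> B" "e \<noteq> e'" for u e e'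
  proof
    assume neg: "\<phi> u e < 0 \<and> \<phi> u e' < 0"
    have "card {e, e'} \<le> card {b \<in> B. \<phi> u b < 0}"
      by (intro card_mono) (use finite_B neg that in auto)
    then show False using card_T(3)[OF KN[OF that(1)]] that(4) by simp
  qed
  have not_all_pos: "\<not> (\<phi> u a > 0 \<and> \<phi> u b > 0 \<and> \<phi> u (cs u) > 0)" if "u \<in> K" for u
  proof
    assume p: "\<phi> u a > 0 \<and> \<phi> u b > 0 \<and> \<phi> u (cs u) > 0"
    have "card {a, b, cs u} \<le> card {b \<in> B. \<phi> u b > 0}"
      by (intro card_mono) (use finite_B p aB nz(4)[OF that] in auto)
    moreover have "a \<notin> {b, cs u}" "b \<notin> {cs u}" using cs[OF that] ab(1) by auto
    ultimately show False using card_T(2)[OF KN[OF that]] by simp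
  qed
  show ?thesis
  proof (cases "\<rho> > 0")
    case True
    \<comment> \<open>Coordinates at \<open>a\<close> and \<open>b\<close> of equal sign must both
      be positive, as only one coordinate is negative; that one is then at
      \<open>cs u\<close>.\<close>
    have signs: "\<phi> u a > 0 \<and> \<phi> u (cs u) < 0" if u: "u \<in> K" for u
    proof -
      have "\<not> \<phi> u a < 0"
        using no_two_neg[OF u aB ab(1)] ratio[OF u] True by (auto simp: mult_pos_neg)
      then have a: "\<phi> u a > 0" using nz(1)[OF u] by simp
      then have "\<phi> u b > 0" using ratio[OF u] True by simp
      then show ?thesis using a not_all_pos[OF u] nz(3)[OF u] by (meson linorder_neqE_linordered_idom)
    qed
    have "\<alpha> i > 0" if "i \<in> I" for i
      using that signs xK(3) xa(3) by (auto simp: I_def divide_neg_pos)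
    moreover have "\<beta> i > 0" if "i \<in> I" for i
      using that signs xK(4) xa(4) True by (auto simp: I_def)
    ultimately show ?thesis using pairs.realizable_crosspolytope Un by simp
  next
    case False
    then have neg: "\<rho> < 0" using \<rho>0 by simp
    \<comment> \<open>Here the single negative coordinate is at \<open>a\<close> or
      \<open>b\<close>.\<close>
    have signs: "\<phi> u (cs u) > 0" if u: "u \<in> K" for u
    proof (rule ccontr)
      assume "\<not> ?thesis"
      then have c: "\<phi> u (cs u) < 0" using nz(3)[OF u] by simp
      have "\<phi> u a < 0 \<or> \<phi> u b < 0"
        using ratio[OF u] nz(1)[OF u] neg by (cases "\<phi> u a < 0") (auto simp: mult_neg_pos)
      then show False
        using no_two_neg[OF u _ nz(4)[OF u], of a] no_two_neg[OF u _ nz(4)[OF u], of b] c aB cs[OF u] by auto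
    qed
    have "\<alpha> i * \<beta> i < 0" if "i \<in> I" for i
    proof (cases "i = a")
      case True
      then show ?thesis using xa neg by simp
    next
      case False
      then have i: "i \<in> K" using that by (simp add: I_def)
      have "\<phi> i a * \<phi> i a > 0" using nz(1)[OF i] not_real_square_gt_zero by blast
      then show ?thesis using signs[OF i] by (simp add: xK[OF i] divide_neg_pos)
    qed
    then show ?thesis using pairs.realizable_opposite_signs[OF injx] Un by simp
  qed
qed

end

section \<open>The classification\<close>

text \<open>One block is split off and induction treats the rest. Supports of points outside the
  block avoid \<open>block_basis v\<close>, so the rest is spanned by the remaining basis points;
  disjoint parts of one independent basis give the skew position that a join requires.\<close>

lemma circuits_le_4_imp_realizable:
  fixes V :: "'a::euclidean_space set"
  assumes "finite V" "convex_position V" "circuits_le_4 V" "V \<noteq> {}"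
  shows "realizable_as_join V"
  using assms
proof (induction V rule: finite_psubset_induct)
  case (psubset V)
  obtain B where B: "B \<subseteq> V" "\<not> affine_dependent B" "affine hull V = affine hull B"
    using affine_basis_exists by metis
  have finB: "finite B" using B(1) psubset.hyps(1) by (rule finite_subset)
  have "\<exists>u. sum u B = 1 \<and> (\<Sum>b\<in>B. u b *\<^sub>R b) = v" if "v \<in> V" for v
  proof -
    have "v \<in> affine hull B" using that B(3) hull_inc by metis
    then show ?thesis unfolding affine_hull_finite[OF finB] by blast
  qed
  then obtain \<phi> where \<phi>: "\<And>v. v \<in> V \<Longrightarrow> sum (\<phi> v) B = 1 \<and> (\<Sum>b\<in>B. \<phi> v b *\<^sub>R b) = v" by metis
  interpret basis_coordinates V B \<phi>
    using psubset.prems B(1,2) \<phi> by unfold_locales auto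
  show ?case
  proof (cases "N = {}")
    case True
    then have "V = B" using B(1) by (auto simp: N_def)
    then show ?thesis using B(2) psubset.prems by (simp add: realizable_as_join_simplex)
  next
    case False
    then obtain v where v: "v \<in> N" by blast
    define V1 where "V1 = block v \<union> block_basis v"
    define B2 where "B2 = B - block_basis v"
    define V2 where "V2 = V - V1"
    have V1V: "V1 \<subseteq> V"
      using block_N N_disj block_basis_subset B(1) unfolding V1_def by blast
    have real1: "realizable_as_join V1" unfolding V1_def by (rule realizable_block[OF v])
    show ?thesis
    proof (cases "V2 = {}")
      case True
      then have "V = V1" using V1V by (auto simp: V2_def)
      then show ?thesis using real1 by simp
    next
      case False
      have "v \<in> V1" using block_self[OF v] by (simp add: V1_def)
      then have "V2 \<subset> V" using V1V by (auto simp: V2_def)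
      then have real2: "realizable_as_join V2"
        using psubset.IH[of V2] psubset.prems False convex_position_mono circuits_le_4_mono by blast
      have "affine hull V2 = affine hull B2"
      proof
        have "w \<in> affine hull B2" if w: "w \<in> V2" for w
        proof (cases "w \<in> B")
          case True
          then have "w \<in> B2" using w by (auto simp: V2_def V1_def B2_def)
          then show ?thesis by (rule hull_inc)
        next
          case False
          then have wN: "w \<in> N" "w \<notin> block v" "w \<in> V" using w by (auto simp: V2_def V1_def N_def)
          then have "T w \<subseteq> B2" using T_disjoint_block_basis[OF v wN(1,2)] T_subset by (auto simp: B2_def)
          then show ?thesis using wN(3) by (intro in_hull_of_T_subset)
        qed
        then show "affine hull V2 \<subseteq> affine hull B2" by (intro hull_minimal) auto
        have "b \<in> V2" if "b \<in> B2" for b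
          using that B(1) block_N N_disj unfolding V2_def V1_def B2_def by blast
        then show "affine hull B2 \<subseteq> affine hull V2" by (intro hull_mono) auto
      qed
      moreover have "block_basis v \<union> B2 = B" "block_basis v \<inter> B2 = {}"
        using block_basis_subset by (auto simp: B2_def)
      moreover have "affine hull V1 = affine hull (block_basis v)" unfolding V1_def by (rule hull_block)
      moreover have "V1 \<noteq> {}" using \<open>v \<in> V1\<close> by blast
      ultimately have "realizable_as_join (V1 \<union> V2)"
        using realizable_as_join_Un[of "block_basis v" B2 V1 V2] B(2) False real1 real2 by simp
      moreover have "V1 \<union> V2 = V" using V1V by (auto simp: V2_def)
      ultimately show ?thesis by simp
    qed
  qed
qed

lemma polytope_join_of_basic:
  assumes "join_of_basic Q"
  shows "polytope Q"
  using join_of_basic_circuits[OF assms] polytope_convex_hull by blast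

theorem theorem8:
  fixes P :: "'a::euclidean_space set"
  assumes "polytope P" and "P \<noteq> {}"
  shows "totally_splittable P \<longleftrightarrow> (\<exists>Q::'a set. join_of_basic Q \<and> same_oriented_matroid P Q)"
proof
  assume "totally_splittable P"
  then have "circuits_le_4 (vertices P)" by (rule totally_splittable_imp_circuits_le_4[OF assms(1)])
  moreover have "vertices P \<noteq> {}" using convex_hull_vertices[OF assms(1)] assms(2) by auto
  ultimately have "realizable_as_join (vertices P)"
    using finite_vertices convex_position_vertices assms(1) by (intro circuits_le_4_imp_realizable)
  then show "\<exists>Q::'a set. join_of_basic Q \<and> same_oriented_matroid P Q"
    unfolding realizable_as_join_def
    using sign_equivalent_same_oriented_matroid[OF assms(1)] by blast
next
  assume "\<exists>Q::'a set. join_of_basic Q \<and> same_oriented_matroid P Q"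
  then obtain Q :: "'a set" where Q: "join_of_basic Q" "same_oriented_matroid P Q" by blast
  obtain W where W: "Q = convex hull W" "circuits_le_4 W" using join_of_basic_circuits[OF Q(1)] by blast
  have "circuits_le_4 (vertices Q)"
    using W vertices_convex_hull_subset circuits_le_4_mono by blast
  then have "circuits_le_4 (vertices P)"
    by (rule same_oriented_matroid_circuits[OF assms(1) polytope_join_of_basic[OF Q(1)] Q(2)])
  then show "totally_splittable P"
    unfolding totally_splittable_def
    using circuits_le_4_imp_split_triangulation[OF assms] by blast
qed

end
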